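(* Let $d\ge 3$ and let $\eta$ be any real number with $\eta<\frac{d-1}{2}+\frac{1}{8d}$. Then there is a constant $c>0$, depending only on $d$ and $\eta$, such that for every integer $n\ge 1$ and every choice of coefficients $\alpha(R)\in\{\pm 1\}$, indexed by the dyadic rectangles $R\subset[0,1]^d$ of volume $|R|=2^{-n}$, $$c\, n^{\eta}\le \Bigl\| \sum_{|R|=2^{-n}}\alpha(R)\,h_R\Bigr\|_{L^\infty([0,1]^d)},$$ where the sum is over all dyadic rectangles $R\subset[0,1]^d$ with $|R|=2^{-n}$.
   Context: Dyadic intervals are the intervals $[j2^k,(j+1)2^k)$ with $j,k\in\mathbb Z$. For a dyadic interval $I$ with left and right halves $I_{\rm left}$, $I_{\rm right}$ (themselves dyadic intervals), the $L^\infty$-normalized Haar function is $h_I=-\mathbf 1_{I_{\rm left}}+\mathbf 1_{I_{\rm right}}$. A dyadic rectangle in dimension $d$ is a product $R=R_1\times\cdots\times R_d$ of dyadic intervals, $|R|$ is its volume, and $h_R(x_1,\dots,x_d)=\prod_{j=1}^d h_{R_j}(x_j)$. *)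

theory Defs
  imports "HOL-Analysis.Analysis" "HOL-Probability.Essential_Supremum"
begin

definition dyadic_interval :: "real set \<Rightarrow> bool" where
  "dyadic_interval I \<longleftrightarrow>
     (\<exists>j k :: int. I = {of_int j * 2 powi k ..< (of_int j + 1) * 2 powi k})"

definition left_half :: "real set \<Rightarrow> real set" where
  "left_half I = {x \<in> I. x < (Inf I + Sup I) / 2}"

definition right_half :: "real set \<Rightarrow> real set" where
  "right_half I = {x \<in> I. (Inf I + Sup I) / 2 \<le> x}"

definition haar_interval :: "real set \<Rightarrow> real \<Rightarrow> real" where
  "haar_interval I x = - indicator (left_half I) x + indicator (right_half I) x"

definition dyadic_rectangle :: "(real ^ 'd) set \<Rightarrow> bool" where
  "dyadic_rectangle R \<longleftrightarrow>
     (\<exists>I. (\<forall>j. dyadic_interval (I j)) \<and> R = {x. \<forall>j. x $ j \<in> I j})"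

text \<open>A rectangle is kept as a set of points, so its side in direction \<open>j\<close> is recovered as
  its projection; see the lemma \<open>side_box\<close> below.\<close>

definition side :: "(real ^ 'd) set \<Rightarrow> 'd \<Rightarrow> real set" where
  "side R j = (\<lambda>x. x $ j) ` R"

definition haar :: "(real ^ 'd) set \<Rightarrow> real ^ 'd \<Rightarrow> real" where
  "haar R x = (\<Prod>j\<in>UNIV. haar_interval (side R j) (x $ j))"

definition dyadic_rectangles :: "nat \<Rightarrow> (real ^ 'd) set set" where
  "dyadic_rectangles n =
     {R. dyadic_rectangle R \<and> R \<subseteq> cbox 0 1 \<and> measure lebesgue R = 1 / 2 ^ n}"

text \<open>Extended-real valued, since \<^const>\<open>esssup\<close> needs a complete order.\<close>

definition Linf_norm_on :: "'a::euclidean_space set \<Rightarrow> ('a \<Rightarrow> real) \<Rightarrow> ereal" where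
  "Linf_norm_on S f = esssup (lebesgue_on S) (\<lambda>x. ereal \<bar>f x\<bar>)"

lemma halves_atLeastLessThan:
  assumes "a < (b::real)"
  shows "left_half {a..<b} = {a..<(a + b) / 2}" "right_half {a..<b} = {(a + b) / 2..<b}"
  using assms by (auto simp: left_half_def right_half_def cInf_atLeastLessThan cSup_atLeastLessThan)

lemma dyadic_intervalE:
  assumes "dyadic_interval I"
  obtains a b where "a < b" "I = {a..<b}"
proof -
  obtain j k :: int where I: "I = {of_int j * 2 powi k ..< (of_int j + 1) * 2 powi k}"
    using assms by (auto simp: dyadic_interval_def)
  have "of_int j * (2::real) powi k < (of_int j + 1) * 2 powi k"
    by (intro mult_strict_right_mono) auto
  with I that show ?thesis by blast
qed

lemma dyadic_halves:
  assumes "dyadic_interval I"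
  shows "dyadic_interval (left_half I)" "dyadic_interval (right_half I)"
proof -
  obtain j k :: int where I: "I = {of_int j * 2 powi k ..< (of_int j + 1) * 2 powi k}"
    using assms by (auto simp: dyadic_interval_def)
  have lt: "of_int j * (2::real) powi k < (of_int j + 1) * 2 powi k"
    by (intro mult_strict_right_mono) auto
  have k: "(2::real) powi k = 2 * 2 powi (k - 1)"
    by (simp add: power_int_diff)
  have "left_half I = {of_int (2 * j) * 2 powi (k - 1) ..< (of_int (2 * j) + 1) * 2 powi (k - 1)}"
    unfolding I halves_atLeastLessThan(1)[OF lt] by (rule arg_cong2[where f = atLeastLessThan]) (simp_all add: k field_simps)
  then show "dyadic_interval (left_half I)"
    unfolding dyadic_interval_def by blast
  have "right_half I =
      {of_int (2 * j + 1) * 2 powi (k - 1) ..< (of_int (2 * j + 1) + 1) * 2 powi (k - 1)}"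
    unfolding I halves_atLeastLessThan(2)[OF lt] by (rule arg_cong2[where f = atLeastLessThan]) (simp_all add: k field_simps)
  then show "dyadic_interval (right_half I)"
    unfolding dyadic_interval_def by blast
qed

lemma side_box:
  assumes "\<And>j. I j \<noteq> {}"
  shows "side {x :: real ^ 'd. \<forall>j. x $ j \<in> I j} i = I i"
proof
  show "I i \<subseteq> side {x :: real ^ 'd. \<forall>j. x $ j \<in> I j} i"
  proof
    fix t assume t: "t \<in> I i"
    define y :: "real ^ 'd" where "y = (\<chi> j. if j = i then t else SOME s. s \<in> I j)"
    have "\<forall>j. y $ j \<in> I j"
      using t assms by (auto simp: y_def some_in_eq)
    moreover have "t = y $ i"
      by (simp add: y_def)
    ultimately show "t \<in> side {x. \<forall>j. x $ j \<in> I j} i"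
      unfolding side_def by blast
  qed
qed (auto simp: side_def)

lemma borel_measurable_haar:
  assumes "dyadic_rectangle R"
  shows "haar R \<in> borel_measurable borel"
proof -
  obtain I where I: "\<And>j. dyadic_interval (I j)" and R: "R = {x. \<forall>j. x $ j \<in> I j}"
    using assms by (auto simp: dyadic_rectangle_def)
  have ne: "I j \<noteq> {}" for j
    using dyadic_intervalE[OF I[of j]] by (metis atLeastLessThan_empty_iff not_le)
  have 1: "haar_interval (I j) \<in> borel_measurable borel" for j
  proof -
    obtain a b where "a < b" "I j = {a..<b}"
      using dyadic_intervalE[OF I[of j]] by blast
    then show ?thesis
      by (simp add: haar_interval_def[abs_def] halves_atLeastLessThan)
  qed
  have 2: "(\<lambda>x :: real ^ 'a. x $ j) \<in> borel_measurable borel" for j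
    by (intro borel_measurable_continuous_onI continuous_intros)
  have "(\<lambda>x. \<Prod>j\<in>UNIV. haar_interval (I j) (x $ j)) \<in> borel_measurable borel"
    by (intro borel_measurable_prod measurable_compose[OF 2 1])
  then show ?thesis
    unfolding haar_def[abs_def] R side_box[OF ne] .
qed

end

theory Submission
  imports Defs "HOL-Real_Asymp.Real_Asymp"
begin

text \<open>On a fine dyadic grid the function is a sum of \<open>f r\<close> over the side exponents \<open>r\<close> with
  \<open>\<Sum>j. r j = n\<close>, where \<open>f r\<close> takes the values \<open>\<plusminus>1\<close> and changes sign when the bit number \<open>r j\<close> of
  the \<open>j\<close>-th coordinate is flipped. Averaging over fine bits restricts the first \<open>d - 1\<close> exponents to
  \<open>{0..<m}\<close> with \<open>m\<close> comparable to \<open>n\<close>.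

  In the first coordinate the sum is a martingale with quadratic variation
  \<open>V = \<Sum>t. (\<Sum>r | r 1 = t. f r)\<^sup>2\<close>. Because the coefficients are signs, the diagonal of \<open>V\<close> is the
  constant \<open>m ^ (d - 1)\<close>. The off-diagonal part consists of products \<open>f r * f s\<close> with \<open>r 1 = s 1\<close>, and
  it is shown to be at most \<open>m ^ (d - 1) * m powr (-1/4) * p ^ (d - 1)\<close> up to logarithms outside a set of
  measure about \<open>exp (- p)\<close>, by iterating Azuma's inequality in the coordinates where \<open>r\<close> and \<open>s\<close>
  differ. So for \<open>p = m powr \<kappa>\<close> with \<open>\<kappa> < 1 / (4 * d)\<close> the quadratic variation is of its full size
  outside that set, and the exponential martingale then shows that the supremum of the sum is at least
  of order \<open>sqrt p * sqrt (m ^ (d - 1))\<close>.\<close>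

section \<open>Hyperbolic cosine estimates\<close>

text \<open>The obstacle: \<open>f r * f s\<close> is a martingale difference only in coordinates
  where \<open>r\<close> and \<open>s\<close> differ; where they agree the two sign changes cancel.
  The volume constraint repairs this. If all free exponents agree but the prescribed sums differ,
  then the dependent exponents in coordinate \<open>lc\<close> differ, and cancellation there saves
  \<open>m powr (-1/2)\<close>. Differing sums arise after squaring, when a shared exponent is
  frozen at two values t \<noteq> t'. The gain \<open>m powr (-1/4)\<close> is the one that
  reproduces itself: squaring a form gives products of two forms of the same kind, two gains
  multiply to \<open>m powr (-1/2)\<close>, and the square root returns
  \<open>m powr (-1/4)\<close>. The iterated Azuma inequalities cost about one factor
  \<open>p\<close> per coordinate, up to logarithms, so \<open>p ^ (d - 1)\<close> has to stay below
  \<open>m powr (1/4)\<close>. This permits \<open>p = m powr \<kappa>\<close> with \<kappa> < 1 /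
  (4 * d); the factor \<open>sqrt p\<close> in the supremum then adds \<kappa> / 2 to the exponent
  (d - 1) / 2, which is the origin of 1 / (8 * d).\<close>

lemma sinh_le_mult_cosh:
  fixes y :: real
  assumes "y \<ge> 0"
  shows "sinh y \<le> y * cosh y"
proof -
  have "(\<lambda>y::real. y * cosh y - sinh y) 0 \<le> (\<lambda>y. y * cosh y - sinh y) y"
  proof (rule DERIV_nonneg_imp_nondecreasing[OF assms])
    fix x :: real assume "0 \<le> x" "x \<le> y"
    have "((\<lambda>y. y * cosh y - sinh y) has_real_derivative x * sinh x) (at x)"
      by (auto intro!: derivative_eq_intros)
    with \<open>0 \<le> x\<close> show "\<exists>z. ((\<lambda>y. y * cosh y - sinh y) has_real_derivative z) (at x) \<and> 0 \<le> z"
      by (intro exI[of _ "x * sinh x"]) simp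
  qed
  then show ?thesis by simp
qed

text \<open>The inequality \<open>tanh x \<le> x\<close>, integrated from 0; this is the
  sub-Gaussian bound behind Azuma's inequality.\<close>

lemma cosh_le_exp_square:
  fixes y :: real
  shows "cosh y \<le> exp (y\<^sup>2 / 2)"
proof -
  have *: "cosh z \<le> exp (z\<^sup>2 / 2)" if "z \<ge> 0" for z :: real
  proof -
    have "(\<lambda>y::real. y\<^sup>2 / 2 - ln (cosh y)) 0 \<le> (\<lambda>y. y\<^sup>2 / 2 - ln (cosh y)) z"
    proof (rule DERIV_nonneg_imp_nondecreasing[OF that])
      fix x :: real assume "0 \<le> x" "x \<le> z"
      have "((\<lambda>y. y\<^sup>2 / 2 - ln (cosh y)) has_real_derivative x - sinh x / cosh x) (at x)"
        by (auto intro!: derivative_eq_intros simp: field_simps)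
      moreover have "0 \<le> x - sinh x / cosh x"
        using sinh_le_mult_cosh[OF \<open>0 \<le> x\<close>] by (simp add: field_simps)
      ultimately show "\<exists>w. ((\<lambda>y. y\<^sup>2 / 2 - ln (cosh y)) has_real_derivative w) (at x) \<and> 0 \<le> w"
        by blast
    qed
    then have "ln (cosh z) \<le> z\<^sup>2 / 2" by simp
    then show ?thesis
      using exp_le_cancel_iff[of "ln (cosh z)" "z\<^sup>2 / 2"] by simp
  qed
  show ?thesis
    using *[of "\<bar>y\<bar>"] by (cases "y \<ge> 0") auto
qed

text \<open>Reverse of the sub-Gaussian bound, used to make a product of \<open>cosh\<close> large.
  As \<open>cosh\<close> grows only exponentially, a Gaussian can lie below it only for bounded
  \<open>y\<close>; hence increments must later be bounded by 1 after scaling.\<close>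

lemma exp_le_cosh:
  fixes y :: real
  assumes "\<bar>y\<bar> \<le> 1"
  shows "exp (y\<^sup>2 / 4) \<le> cosh y"
proof -
  have "exp (y\<^sup>2 / 4) \<le> 1 + 2 * (y\<^sup>2 / 4)"
    using exp_bound_lemma[of "y\<^sup>2 / 4"] assms abs_square_le_1[of y] by simp
  also have "1 + 2 * (y\<^sup>2 / 4) = 1 + y\<^sup>2 / 2" by simp
  also have "\<dots> \<le> cosh y"
  proof -
    have cosh2: "cosh y = 1 + 2 * (sinh (y/2))\<^sup>2"
      using cosh_double[of "y/2"] cosh_square_eq[of "y/2"] by simp
    have s: "\<bar>z\<bar> \<le> \<bar>sinh z\<bar>" for z :: real
    proof -
      have "z \<le> sinh z" if "z \<ge> 0" for z :: real
      proof -
        have "(\<lambda>y::real. sinh y - y) 0 \<le> (\<lambda>y. sinh y - y) z"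
        proof (rule DERIV_nonneg_imp_nondecreasing[OF that])
          fix x :: real
          have "((\<lambda>y. sinh y - y) has_real_derivative cosh x - 1) (at x)"
            by (auto intro!: derivative_eq_intros)
          then show "\<exists>w. ((\<lambda>y. sinh y - y) has_real_derivative w) (at x) \<and> 0 \<le> w"
            using cosh_real_ge_1[of x] by (intro exI[of _ "cosh x - 1"]) simp
        qed
        then show ?thesis by simp
      qed
      from this[of "\<bar>z\<bar>"] show ?thesis by (cases "z \<ge> 0") auto
    qed
    have "(y/2)\<^sup>2 \<le> (sinh (y/2))\<^sup>2"
      using s[of "y/2"] abs_le_square_iff by blast
    then show ?thesis unfolding cosh2 by (simp add: power2_eq_square)
  qed
  finally show ?thesis .
qed

section \<open>Martingale differences under bit flips\<close>

text \<open>Abstracts the dyadic grid: \<open>fl i j\<close> stands for changing the bit of level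
  \<open>j\<close> in coordinate \<open>i\<close>. Averages over a point and its image under an
  involution take the place of conditional expectations. \<open>lc\<close> becomes the coordinate
  whose exponent is determined by the others.\<close>

locale flip_space =
  fixes \<Omega> :: "'a set" and fl :: "nat \<Rightarrow> nat \<Rightarrow> 'a \<Rightarrow> 'a" and L :: nat and p :: real and lc :: nat
  assumes finite_Omega: "finite \<Omega>" and Omega_ne: "\<Omega> \<noteq> {}"
    and fl_in: "x \<in> \<Omega> \<Longrightarrow> fl i j x \<in> \<Omega>"
    and fl_fl: "x \<in> \<Omega> \<Longrightarrow> fl i j (fl i j x) = x"
    and L_pos: "L \<ge> 1" and p_ge: "p \<ge> 1"
begin

text \<open>The functions that occur in level \<open>u\<close> of the dyadic martingale in coordinate \<open>i\<close>, i.e. the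
  finite combinations of Haar functions whose \<open>i\<close>-th side has length \<open>2 powi (-u)\<close>.\<close>

definition martingale_diff :: "nat \<Rightarrow> nat \<Rightarrow> ('a \<Rightarrow> real) \<Rightarrow> bool" where
  "martingale_diff i u Y \<longleftrightarrow> (\<forall>x\<in>\<Omega>. Y (fl i u x) = - Y x) \<and> (\<forall>x\<in>\<Omega>. \<forall>j>u. Y (fl i j x) = Y x)"

text \<open>The predictable factors for level \<open>u\<close>: no bit of level \<open>u\<close> or
  finer in coordinate \<open>i\<close> matters. Multiplication by one preserves martingale
  differences of that level, which is how products of functions with different sides are
  handled.\<close>

definition inv_from :: "nat \<Rightarrow> nat \<Rightarrow> ('a \<Rightarrow> real) \<Rightarrow> bool" where
  "inv_from i u Y \<longleftrightarrow> (\<forall>x\<in>\<Omega>. \<forall>j\<ge>u. Y (fl i j x) = Y x)"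

lemma martingale_diff_imp_inv_from: "martingale_diff i u Y \<Longrightarrow> u < v \<Longrightarrow> inv_from i v Y"
  by (auto simp: martingale_diff_def inv_from_def)

lemma martingale_diff_sum: "(\<And>t. t \<in> I \<Longrightarrow> martingale_diff i u (Y t)) \<Longrightarrow> martingale_diff i u (\<lambda>x. \<Sum>t\<in>I. Y t x)"
  by (auto simp: martingale_diff_def sum_negf[symmetric] intro!: sum.cong)

lemma martingale_diff_mult_inv: "inv_from i u Z \<Longrightarrow> martingale_diff i u Y \<Longrightarrow> martingale_diff i u (\<lambda>x. Z x * Y x)"
  by (auto simp: martingale_diff_def inv_from_def)

lemma martingale_diff_cmult: "martingale_diff i u Y \<Longrightarrow> martingale_diff i u (\<lambda>x. a * Y x)"
  by (auto simp: martingale_diff_def)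

lemma bij_fl: "bij_betw (fl i j) \<Omega> \<Omega>"
  by (rule bij_betwI[where g = "fl i j"]) (auto simp: fl_in fl_fl)

lemma sum_fl: "(\<Sum>x\<in>\<Omega>. h (fl i j x)) = (\<Sum>x\<in>\<Omega>. h x)"
  using sum.reindex_bij_betw[OF bij_fl] .

text \<open>The ranking induction adds the term of finest level last. Flipping its bit fixes all
  other factors and changes the sign of \<open>Y t\<close>. As \<open>cosh\<close> is even, the two
  values of the new factor add up to exactly 2, so its average is 1.\<close>

lemma exp_martingale:
  fixes \<theta> :: real
  assumes "finite I" "inj_on s I" "\<And>t. t \<in> I \<Longrightarrow> martingale_diff i (s t) (Y t)"
  shows "(\<Sum>x\<in>\<Omega>. \<Prod>t\<in>I. exp (\<theta> * Y t x) / cosh (\<theta> * Y t x)) = card \<Omega>"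
  using assms
proof (induction I rule: finite_ranking_induct[where f = s])
  case empty
  then show ?case by simp
next
  case (insert t I)
  show ?case
  proof (cases "t \<in> I")
    case True
    with insert show ?thesis by (simp add: insert_absorb)
  next
    case False
    let ?g = "\<lambda>x. \<Prod>t\<in>I. exp (\<theta> * Y t x) / cosh (\<theta> * Y t x)"
    let ?h = "\<lambda>x. exp (\<theta> * Y t x) / cosh (\<theta> * Y t x)"
    have lt: "s r < s t" if "r \<in> I" for r
      using insert.hyps(2)[OF that] insert.prems(1) that False
      by (metis inj_onD insertCI le_neq_implies_less)
    have g: "?g (fl i (s t) x) = ?g x" if "x \<in> \<Omega>" for x
      using insert.prems(2) lt that by (intro prod.cong) (auto simp: martingale_diff_def)
    have h: "?h (fl i (s t) x) = exp (- (\<theta> * Y t x)) / cosh (\<theta> * Y t x)" if "x \<in> \<Omega>" for x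
      using insert.prems(2)[of t] that by (auto simp: martingale_diff_def)
    have two: "?h x + ?h (fl i (s t) x) = 2" if "x \<in> \<Omega>" for x
    proof -
      have "exp (\<theta> * Y t x) + exp (- (\<theta> * Y t x)) = 2 * cosh (\<theta> * Y t x)"
        by (simp add: cosh_field_def)
      then show ?thesis
        unfolding h[OF that] add_divide_distrib[symmetric] by simp
    qed
    have "2 * (\<Sum>x\<in>\<Omega>. ?g x * ?h x)
        = (\<Sum>x\<in>\<Omega>. ?g x * ?h x) + (\<Sum>x\<in>\<Omega>. ?g (fl i (s t) x) * ?h (fl i (s t) x))"
      by (subst sum_fl[of "\<lambda>x. ?g x * ?h x"]) simp
    also have "\<dots> = (\<Sum>x\<in>\<Omega>. ?g x * (?h x + ?h (fl i (s t) x)))"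
      unfolding sum.distrib[symmetric]
      by (intro sum.cong refl) (simp add: g algebra_simps del: times_divide_eq_right)
    also have "\<dots> = (\<Sum>x\<in>\<Omega>. ?g x * 2)"
      by (intro sum.cong refl arg_cong2[where f = times] two)
    also have "\<dots> = 2 * (\<Sum>x\<in>\<Omega>. ?g x)"
      by (simp add: sum_distrib_left mult.commute)
    finally have "(\<Sum>x\<in>\<Omega>. ?g x * ?h x) = (\<Sum>x\<in>\<Omega>. ?g x)" by simp
    also have "\<dots> = card \<Omega>"
      using insert.prems by (intro insert.IH) auto
    finally show ?thesis
      using False insert.hyps by (simp add: mult.commute)
  qed
qed

text \<open>A power of two, so that the binary decomposition of the order relation fits the index
  range \<open>{..<m}\<close> and its total weight \<open>L\<close> is the logarithm of
  \<open>m\<close>.\<close>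

definition m :: nat where "m = 2 ^ L"

lemma m_ge: "m \<ge> 2"
  using L_pos power_increasing[of 1 L "2::nat"] by (simp add: m_def)

text \<open>The exponent \<open>r\<close> only counts how many exceptional sets were united; \<open>p\<close> will be a small power of \<open>m\<close>, so
  that \<open>exp (- p)\<close> beats every fixed power of \<open>m\<close>.\<close>

definition small :: "nat \<Rightarrow> ('a \<Rightarrow> bool) \<Rightarrow> bool" where
  "small r E \<longleftrightarrow> real (card {x\<in>\<Omega>. E x}) \<le> real m ^ r * exp (- p) * card \<Omega>"

lemma small_mono:
  assumes "small a E'" "\<And>x. x \<in> \<Omega> \<Longrightarrow> E x \<Longrightarrow> E' x" "a \<le> b"
  shows "small b E"
proof -
  have "real (card {x\<in>\<Omega>. E x}) \<le> real (card {x\<in>\<Omega>. E' x})"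
    using assms(2) finite_Omega by (intro of_nat_mono card_mono) auto
  also have "\<dots> \<le> real m ^ a * exp (- p) * card \<Omega>"
    using assms(1) by (simp add: small_def)
  also have "\<dots> \<le> real m ^ b * exp (- p) * card \<Omega>"
    using m_ge assms(3) by (intro mult_right_mono power_increasing) auto
  finally show ?thesis by (simp add: small_def)
qed

lemma small_False: "(\<And>x. x \<in> \<Omega> \<Longrightarrow> \<not> E x) \<Longrightarrow> small a E"
  by (simp add: small_def cong: conj_cong)

lemma small_UN:
  assumes "finite I" "card I \<le> m ^ b" "\<And>i. i \<in> I \<Longrightarrow> small a (E i)"
  shows "small (a + b) (\<lambda>x. \<exists>i\<in>I. E i x)"
proof -
  have "{x\<in>\<Omega>. \<exists>i\<in>I. E i x} = (\<Union>i\<in>I. {x\<in>\<Omega>. E i x})" by auto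
  then have "real (card {x\<in>\<Omega>. \<exists>i\<in>I. E i x}) \<le> real (\<Sum>i\<in>I. card {x\<in>\<Omega>. E i x})"
    using card_UN_le[OF assms(1), of "\<lambda>i. {x\<in>\<Omega>. E i x}"] by (simp only: of_nat_le_iff)
  also have "\<dots> = (\<Sum>i\<in>I. real (card {x\<in>\<Omega>. E i x}))" by simp
  also have "\<dots> \<le> (\<Sum>i\<in>I. real m ^ a * exp (- p) * card \<Omega>)"
    using assms(3) by (intro sum_mono) (auto simp: small_def)
  also have "\<dots> = real (card I) * (real m ^ a * exp (- p) * card \<Omega>)" by simp
  also have "\<dots> \<le> real m ^ b * (real m ^ a * exp (- p) * card \<Omega>)"
  proof (rule mult_right_mono)
    have "real (card I) \<le> real (m ^ b)" using assms(2) by (rule of_nat_mono)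
    then show "real (card I) \<le> real m ^ b" by simp
  qed simp
  finally show ?thesis by (simp add: small_def power_add mult_ac)
qed

lemma small_lift:
  assumes "small a E" "a \<le> b" shows "small b E"
  using small_mono[OF assms(1) _ assms(2)] by blast

lemma small_disj:
  assumes "small a E" "small b E'"
  shows "small (Suc (max a b)) (\<lambda>x. E x \<or> E' x)"
proof -
  let ?E = "\<lambda>i::nat. if i = 0 then E else E'"
  have "small (max a b + 1) (\<lambda>x. \<exists>i\<in>{0,1}. ?E i x)"
  proof (rule small_UN)
    show "card {0, 1::nat} \<le> m ^ 1" using m_ge by simp
    show "small (max a b) (?E i)" if "i \<in> {0, 1}" for i
      using small_lift[OF assms(1), of "max a b"] small_lift[OF assms(2), of "max a b"] by simp
  qed simp
  then show ?thesis by (rule small_mono) auto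
qed

section \<open>Azuma's inequality in one coordinate\<close>

lemma azuma_one_sided:
  assumes "finite I" "inj_on s I" "\<And>t. t \<in> I \<Longrightarrow> martingale_diff i (s t) (Y t)" and b: "b > 0"
  shows "small 0 (\<lambda>x. (\<Sum>t\<in>I. Y t x) > sqrt (2 * p * b) \<and> (\<Sum>t\<in>I. (Y t x)\<^sup>2) \<le> b)"
proof -
  \<comment> \<open>The optimal Chernoff parameter: the exponent
    \<open>\<theta> * sqrt (2 * p * b) - \<theta>\<^sup>2 * b / 2\<close> equals
    \<open>2 * p - p = p\<close>.\<close>
  define \<theta> where "\<theta> = sqrt (2 * p / b)"
  have th: "\<theta> > 0" using b p_ge by (simp add: \<theta>_def)
  have th1: "\<theta> * sqrt (2 * p * b) = 2 * p"
  proof -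
    have "\<theta> * sqrt (2 * p * b) = sqrt ((2 * p)\<^sup>2)"
      unfolding \<theta>_def real_sqrt_mult[symmetric] using b by (simp add: power2_eq_square)
    then show ?thesis using p_ge by (simp only: real_sqrt_abs)
  qed
  have th2: "\<theta>\<^sup>2 * b = 2 * p" using b p_ge by (simp add: \<theta>_def)
  let ?B = "{x\<in>\<Omega>. (\<Sum>t\<in>I. Y t x) > sqrt (2 * p * b) \<and> (\<Sum>t\<in>I. (Y t x)\<^sup>2) \<le> b}"
  let ?h = "\<lambda>x. \<Prod>t\<in>I. exp (\<theta> * Y t x) / cosh (\<theta> * Y t x)"
  have *: "exp p \<le> ?h x" if "x \<in> ?B" for x
  proof -
    let ?M = "\<Sum>t\<in>I. Y t x" and ?Q = "\<Sum>t\<in>I. (Y t x)\<^sup>2"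
    have "\<theta> * sqrt (2 * p * b) \<le> \<theta> * ?M" using that th by (intro mult_left_mono) auto
    moreover have "\<theta>\<^sup>2 * ?Q \<le> \<theta>\<^sup>2 * b" using that by (intro mult_left_mono) auto
    ultimately have "p \<le> \<theta> * ?M - \<theta>\<^sup>2 * ?Q / 2" using th1 th2 by linarith
    also have "\<dots> = (\<Sum>t\<in>I. \<theta> * Y t x - (\<theta> * Y t x)\<^sup>2 / 2)"
      by (simp add: sum_subtractf sum_distrib_left sum_divide_distrib power_mult_distrib)
    finally have "exp p \<le> exp (\<Sum>t\<in>I. \<theta> * Y t x - (\<theta> * Y t x)\<^sup>2 / 2)" by simp
    also have "\<dots> = (\<Prod>t\<in>I. exp (\<theta> * Y t x - (\<theta> * Y t x)\<^sup>2 / 2))"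
      by (rule exp_sum[OF assms(1)])
    also have "\<dots> \<le> ?h x"
    proof (rule prod_mono)
      fix t assume "t \<in> I"
      have "exp (\<theta> * Y t x - (\<theta> * Y t x)\<^sup>2 / 2) = exp (\<theta> * Y t x) / exp ((\<theta> * Y t x)\<^sup>2 / 2)"
        by (rule exp_diff)
      also have "\<dots> \<le> exp (\<theta> * Y t x) / cosh (\<theta> * Y t x)"
        by (rule divide_left_mono) (auto simp: cosh_le_exp_square)
      finally show "0 \<le> exp (\<theta> * Y t x - (\<theta> * Y t x)\<^sup>2 / 2) \<and>
         exp (\<theta> * Y t x - (\<theta> * Y t x)\<^sup>2 / 2) \<le> exp (\<theta> * Y t x) / cosh (\<theta> * Y t x)" by simp
    qed
    finally show ?thesis .
  qed
  have "real (card ?B) * exp p = (\<Sum>x\<in>?B. exp p)" by simp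
  also have "\<dots> \<le> (\<Sum>x\<in>?B. ?h x)" by (rule sum_mono[OF *])
  also have "\<dots> \<le> (\<Sum>x\<in>\<Omega>. ?h x)"
    by (rule sum_mono2[OF finite_Omega]) (auto intro!: prod_nonneg)
  also have "\<dots> = card \<Omega>" by (rule exp_martingale[OF assms(1-3)])
  finally have "real (card ?B) \<le> exp (-p) * card \<Omega>"
    by (simp add: exp_minus field_simps)
  then show ?thesis by (simp add: small_def)
qed

lemma azuma:
  assumes "finite I" "inj_on s I" "\<And>t. t \<in> I \<Longrightarrow> martingale_diff i (s t) (Y t)" and b: "b > 0"
  shows "small 1 (\<lambda>x. \<bar>\<Sum>t\<in>I. Y t x\<bar> > sqrt (2 * p * b) \<and> (\<Sum>t\<in>I. (Y t x)\<^sup>2) \<le> b)"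
proof -
  have "martingale_diff i (s t) (\<lambda>x. - Y t x)" if "t \<in> I" for t
    using martingale_diff_cmult[OF assms(3)[OF that], of "-1"] by simp
  then have *: "small 0 (\<lambda>x. (\<Sum>t\<in>I. - Y t x) > sqrt (2 * p * b) \<and> (\<Sum>t\<in>I. (- Y t x)\<^sup>2) \<le> b)"
    by (intro azuma_one_sided[OF assms(1,2) _ b])
  show ?thesis
  proof (rule small_mono[OF small_disj[OF azuma_one_sided[OF assms] *]])
    fix x
    assume "\<bar>\<Sum>t\<in>I. Y t x\<bar> > sqrt (2 * p * b) \<and> (\<Sum>t\<in>I. (Y t x)\<^sup>2) \<le> b"
    then show "((\<Sum>t\<in>I. Y t x) > sqrt (2 * p * b) \<and> (\<Sum>t\<in>I. (Y t x)\<^sup>2) \<le> b) \<or>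
       ((\<Sum>t\<in>I. - Y t x) > sqrt (2 * p * b) \<and> (\<Sum>t\<in>I. (- Y t x)\<^sup>2) \<le> b)"
      unfolding sum_negf power2_minus by linarith
  qed (auto simp: max_def)
qed

text \<open>Unlike the bound \<open>b\<close> above, the square function is random here; a union bound over its
  dyadic size costs only a power of \<open>m\<close>.\<close>

lemma azuma_self_normalized:
  assumes "finite I" "inj_on s I" "\<And>t. t \<in> I \<Longrightarrow> martingale_diff i (s t) (Y t)"
    and Q: "\<And>x. x \<in> \<Omega> \<Longrightarrow> (\<Sum>t\<in>I. (Y t x)\<^sup>2) + 1 \<le> real m ^ A"
  shows "small (A + 3) (\<lambda>x. (\<Sum>t\<in>I. Y t x)\<^sup>2 > 4 * p * ((\<Sum>t\<in>I. (Y t x)\<^sup>2) + 1))"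
proof -
  let ?J = "{0..L * A}"
  have "A < 2 ^ A" by (rule less_exp)
  also have "(2::nat) ^ A \<le> m ^ A" using m_ge by (intro power_mono) auto
  finally have A: "A \<le> m ^ A" by simp
  have Lm: "L \<le> m" unfolding m_def using less_exp[of L] by simp
  have "card ?J = L * A + 1" by simp
  also have "\<dots> \<le> m * m ^ A + m ^ A"
    using A Lm m_ge by (intro add_mono mult_mono) (auto simp: Suc_le_eq)
  also have "\<dots> \<le> m * m ^ A + m * m ^ A" using m_ge by simp
  also have "\<dots> = 2 * m ^ (A + 1)" by simp
  also have "\<dots> \<le> m * m ^ (A + 1)" using m_ge by (intro mult_right_mono) auto
  finally have J: "card ?J \<le> m ^ (A + 2)" by simp
  have "small (1 + (A + 2)) (\<lambda>x. \<exists>j\<in>?J. \<bar>\<Sum>t\<in>I. Y t x\<bar> > sqrt (2 * p * 2 ^ j) \<and> (\<Sum>t\<in>I. (Y t x)\<^sup>2) \<le> 2 ^ j)"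
    by (rule small_UN[OF _ J azuma[OF assms(1-3)]]) simp_all
  then show ?thesis
  proof (rule small_mono)
    fix x assume x: "x \<in> \<Omega>"
    let ?M = "\<Sum>t\<in>I. Y t x" and ?Q = "\<Sum>t\<in>I. (Y t x)\<^sup>2"
    assume big: "?M\<^sup>2 > 4 * p * (?Q + 1)"
    \<comment> \<open>The smallest dyadic upper bound overshoots by a factor of at most 2, which
      turns the \<open>2 * p\<close> of \<open>azuma\<close> into \<open>4 * p\<close>. The summand
      1 covers square functions below the smallest dyadic size.\<close>
    define j where "j = (LEAST j. ?Q + 1 \<le> 2 ^ j)"
    have ex: "?Q + 1 \<le> 2 ^ (L * A)" using Q[OF x] by (simp add: m_def power_mult)
    have j1: "?Q + 1 \<le> 2 ^ j" unfolding j_def by (rule LeastI[where P = "\<lambda>j. ?Q + 1 \<le> 2 ^ j", OF ex])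
    have j2: "j \<le> L * A" unfolding j_def by (rule Least_le[where P = "\<lambda>j. ?Q + 1 \<le> 2 ^ j", OF ex])
    have Q0: "?Q \<ge> 0" by (intro sum_nonneg) auto
    have j3: "2 ^ j \<le> 2 * (?Q + 1)"
    proof (cases j)
      case 0 then show ?thesis using Q0 by simp
    next
      case (Suc k)
      then have "\<not> ?Q + 1 \<le> 2 ^ k" unfolding j_def using not_less_Least[where P = "\<lambda>j. ?Q + 1 \<le> 2 ^ j" and k = k] by simp
      then show ?thesis using Suc by simp
    qed
    have "2 * p * 2 ^ j \<le> 2 * p * (2 * (?Q + 1))" using p_ge j3 by (intro mult_left_mono) auto
    with big have "2 * p * 2 ^ j < ?M\<^sup>2" by (simp add: mult_ac)
    then have "sqrt (2 * p * 2 ^ j) < \<bar>?M\<bar>"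
      using real_sqrt_less_mono[of "2 * p * 2 ^ j" "?M\<^sup>2"] by (simp only: real_sqrt_abs)
    moreover have "?Q \<le> 2 ^ j" using j1 by simp
    ultimately show "\<exists>j\<in>?J. \<bar>?M\<bar> > sqrt (2 * p * 2 ^ j) \<and> ?Q \<le> 2 ^ j"
      using j2 by (intro bexI[of _ j]) auto
  qed simp
qed

end

text \<open>The indicator of \<open>a < b\<close> as a combination of products \<open>g a * h b\<close> whose total weight is only
  logarithmic in the size of the range: compare the leading binary digits and, where they agree,
  recurse, the agreement of two signs being \<open>(1 + sg a * sg b) / 2\<close>.\<close>

lemma less_decomposition_list:
  "\<exists>xs :: (real \<times> (nat \<Rightarrow> real) \<times> (nat \<Rightarrow> real)) list. length xs < 2 ^ L \<and>
     (\<forall>(c, g, h) \<in> set xs. c \<ge> 0 \<and> (\<forall>a. \<bar>g a\<bar> \<le> 1) \<and> (\<forall>b. \<bar>h b\<bar> \<le> 1)) \<and>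
     (\<Sum>(c, g, h)\<leftarrow>xs. c) = L \<and>
     (\<forall>a<2 ^ L. \<forall>b<2 ^ L. of_bool (a < b) = (\<Sum>(c, g, h)\<leftarrow>xs. c * g a * h b))"
proof (induction L)
  case 0
  show ?case by (intro exI[of _ "[]"]) auto
next
  case (Suc L)
  then obtain xs :: "(real \<times> (nat \<Rightarrow> real) \<times> (nat \<Rightarrow> real)) list" where xs: "length xs < 2 ^ L"
     "\<And>c g h. (c, g, h) \<in> set xs \<Longrightarrow> c \<ge> 0 \<and> (\<forall>a. \<bar>g a\<bar> \<le> 1) \<and> (\<forall>b. \<bar>h b\<bar> \<le> 1)"
     "(\<Sum>(c, g, h)\<leftarrow>xs. c) = L"
     "\<And>a b. a < 2 ^ L \<Longrightarrow> b < 2 ^ L \<Longrightarrow> of_bool (a < b) = (\<Sum>(c, g, h)\<leftarrow>xs. c * g a * h b)"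
    by fast
  define sg :: "nat \<Rightarrow> real" where "sg a = (if a < 2 ^ L then 1 else -1)" for a
  define F1 :: "real \<times> (nat \<Rightarrow> real) \<times> (nat \<Rightarrow> real) \<Rightarrow> real \<times> (nat \<Rightarrow> real) \<times> (nat \<Rightarrow> real)"
    where "F1 = (\<lambda>(c, g, h). (c / 2, \<lambda>a. g (a mod 2 ^ L), \<lambda>b. h (b mod 2 ^ L)))"
  define F2 :: "real \<times> (nat \<Rightarrow> real) \<times> (nat \<Rightarrow> real) \<Rightarrow> real \<times> (nat \<Rightarrow> real) \<times> (nat \<Rightarrow> real)"
    where "F2 = (\<lambda>(c, g, h). (c / 2, \<lambda>a. sg a * g (a mod 2 ^ L), \<lambda>b. sg b * h (b mod 2 ^ L)))"
  \<comment> \<open>The new entry settles pairs with different leading bits and has weight 1.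
    \<open>F1\<close> and \<open>F2\<close> carry the two summands of
    \<open>(1 + sg a * sg b) / 2\<close>, each with half of the old weight, so the total weight
    grows by 1 per bit.\<close>
  define ys where "ys = (1, \<lambda>a. of_bool (a < 2 ^ L), \<lambda>b. of_bool (\<not> b < 2 ^ L)) # map F1 xs @ map F2 xs"
  have "length ys < 2 ^ Suc L" using xs(1) by (simp add: ys_def)
  moreover have "\<forall>(c, g, h) \<in> set ys. c \<ge> 0 \<and> (\<forall>a. \<bar>g a\<bar> \<le> 1) \<and> (\<forall>b. \<bar>h b\<bar> \<le> 1)"
  proof clarify
    fix c g h
    assume "(c, g, h) \<in> set ys"
    then consider "c = 1" "g = (\<lambda>a. of_bool (a < 2 ^ L))" "h = (\<lambda>b. of_bool (\<not> b < 2 ^ L))"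
      | c' g' h' where "(c', g', h') \<in> set xs" "c = c' / 2"
          "g = (\<lambda>a. g' (a mod 2 ^ L))" "h = (\<lambda>b. h' (b mod 2 ^ L))"
      | c' g' h' where "(c', g', h') \<in> set xs" "c = c' / 2"
          "g = (\<lambda>a. sg a * g' (a mod 2 ^ L))" "h = (\<lambda>b. sg b * h' (b mod 2 ^ L))"
      by (auto simp: ys_def F1_def F2_def)
    then show "0 \<le> c \<and> (\<forall>a. \<bar>g a\<bar> \<le> 1) \<and> (\<forall>b. \<bar>h b\<bar> \<le> 1)"
    proof cases
      case (2 c' g' h')
      with xs(2)[of c' g' h'] show ?thesis by simp
    next
      case (3 c' g' h')
      with xs(2)[of c' g' h'] show ?thesis by (simp add: sg_def)
    qed simp
  qed
  moreover have "(\<Sum>(c, g, h)\<leftarrow>ys. c) = Suc L"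
  proof -
    have "(\<Sum>(c, g, h)\<leftarrow>map F1 xs. c) = (\<Sum>(c, g, h)\<leftarrow>xs. c) / 2"
         "(\<Sum>(c, g, h)\<leftarrow>map F2 xs. c) = (\<Sum>(c, g, h)\<leftarrow>xs. c) / 2"
      by (induction xs) (auto simp: F1_def F2_def add_divide_distrib)
    then show ?thesis using xs(3) by (simp add: ys_def)
  qed
  moreover have "of_bool (a < b) = (\<Sum>(c, g, h)\<leftarrow>ys. c * g a * h b)"
    if "a < 2 ^ Suc L" "b < 2 ^ Suc L" for a b
  proof -
    let ?s = "\<Sum>(c, g, h)\<leftarrow>xs. c * g (a mod 2 ^ L) * h (b mod 2 ^ L)"
    have "(\<Sum>(c, g, h)\<leftarrow>map F1 xs. c * g a * h b) = ?s / 2"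
      by (induction xs) (auto simp: F1_def add_divide_distrib)
    moreover have "(\<Sum>(c, g, h)\<leftarrow>map F2 xs. c * g a * h b) = sg a * sg b * ?s / 2"
      by (induction xs) (auto simp: F2_def add_divide_distrib distrib_left mult_ac)
    moreover have "?s = of_bool (a mod 2 ^ L < b mod 2 ^ L)"
      by (rule xs(4)[symmetric]) auto
    ultimately have "(\<Sum>(c, g, h)\<leftarrow>ys. c * g a * h b) =
       of_bool (a < 2 ^ L) * of_bool (\<not> b < 2 ^ L) + (1 + sg a * sg b) / 2 * of_bool (a mod 2 ^ L < b mod 2 ^ L)"
      by (simp add: ys_def algebra_simps add_divide_distrib)
    moreover have "c mod 2 ^ L = (if c < 2 ^ L then c else c - 2 ^ L)" if "c < 2 ^ Suc L" for c :: nat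
      using that by (auto simp: le_mod_geq not_less)
    ultimately show ?thesis using that by (simp add: sg_def) arith
  qed
  ultimately show ?case by (intro exI[of _ ys]) blast
qed

lemma less_decomposition:
  obtains n :: nat and c :: "nat \<Rightarrow> real" and g h :: "nat \<Rightarrow> nat \<Rightarrow> real"
  where "n \<le> 2 ^ L" "\<And>j. j < n \<Longrightarrow> c j \<ge> 0" "(\<Sum>j<n. c j) = L"
    "\<And>j a. j < n \<Longrightarrow> \<bar>g j a\<bar> \<le> 1" "\<And>j b. j < n \<Longrightarrow> \<bar>h j b\<bar> \<le> 1"
    "\<And>a b. a < 2 ^ L \<Longrightarrow> b < 2 ^ L \<Longrightarrow> of_bool (a < b) = (\<Sum>j<n. c j * g j a * h j b)"
proof -
  obtain xs :: "(real \<times> (nat \<Rightarrow> real) \<times> (nat \<Rightarrow> real)) list" where xs: "length xs < 2 ^ L"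
     "\<forall>(c, g, h) \<in> set xs. c \<ge> 0 \<and> (\<forall>a. \<bar>g a\<bar> \<le> 1) \<and> (\<forall>b. \<bar>h b\<bar> \<le> 1)"
     "(\<Sum>(c, g, h)\<leftarrow>xs. c) = L"
     "\<forall>a<2 ^ L. \<forall>b<2 ^ L. of_bool (a < b) = (\<Sum>(c, g, h)\<leftarrow>xs. c * g a * h b)"
    using less_decomposition_list by blast
  have bounds: "fst (xs ! j) \<ge> 0 \<and> (\<forall>a. \<bar>fst (snd (xs ! j)) a\<bar> \<le> 1) \<and> (\<forall>b. \<bar>snd (snd (xs ! j)) b\<bar> \<le> 1)"
    if "j < length xs" for j
    using bspec[OF xs(2) nth_mem[OF that]] by (simp add: case_prod_unfold)
  show ?thesis
  proof (rule that[of "length xs" "\<lambda>j. fst (xs ! j)" "\<lambda>j. fst (snd (xs ! j))" "\<lambda>j. snd (snd (xs ! j))"])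
    show "(\<Sum>j<length xs. fst (xs ! j)) = L"
      using xs(3) by (simp add: sum_list_sum_nth lessThan_atLeast0 case_prod_unfold)
    show "of_bool (a < b) = (\<Sum>j<length xs. fst (xs ! j) * fst (snd (xs ! j)) a * snd (snd (xs ! j)) b)"
      if "a < 2 ^ L" "b < 2 ^ L" for a b
      using xs(4) that by (simp add: sum_list_sum_nth lessThan_atLeast0 case_prod_unfold)
  qed (use xs(1) bounds in auto)
qed

section \<open>Bilinear forms with coincidences\<close>

text \<open>In a bilinear sum over pairs of multi-indices each coordinate carries a relation between its two
  indices. \<open>Tied\<close> coordinates are the coincidences that destroy orthogonality.\<close>

datatype pattern = Tied | Free | Below | Above

primrec ker :: "pattern \<Rightarrow> nat \<Rightarrow> nat \<Rightarrow> real" where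
  "ker Tied a b = of_bool (a = b)"
| "ker Free a b = 1"
| "ker Below a b = of_bool (a < b)"
| "ker Above a b = of_bool (b < a)"

lemma ker_Free_split: "ker Free a b = ker Tied a b + ker Below a b + ker Above a b"
  by auto

definition kerprod :: "nat set \<Rightarrow> (nat \<Rightarrow> pattern) \<Rightarrow> (nat \<Rightarrow> nat) \<Rightarrow> (nat \<Rightarrow> nat) \<Rightarrow> real" where
  "kerprod S \<pi> q q' = (\<Prod>i\<in>S. ker (\<pi> i) (q i) (q' i))"

lemma kerprod_insert:
  "finite S \<Longrightarrow> i \<notin> S \<Longrightarrow> kerprod (insert i S) \<pi> q q' = ker (\<pi> i) (q i) (q' i) * kerprod S \<pi> q q'"
  by (simp add: kerprod_def)

lemma kerprod_upd: "i \<notin> S \<Longrightarrow> kerprod S \<pi> (q(i := t)) (q'(i := t')) = kerprod S \<pi> q q'"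
  unfolding kerprod_def by (intro prod.cong refl) auto

definition freeze :: "nat \<Rightarrow> nat \<Rightarrow> ((nat \<Rightarrow> nat) \<Rightarrow> 'b) \<Rightarrow> (nat \<Rightarrow> nat) \<Rightarrow> 'b" where
  "freeze i t f = (\<lambda>q. f (q(i := t)))"

context flip_space
begin

section \<open>Multi-index sums and Azuma's inequality in several coordinates\<close>

definition box :: "nat set \<Rightarrow> (nat \<Rightarrow> nat) set" where
  "box S = (\<Pi>\<^sub>E i\<in>S. {..<m})"

lemma finite_box: "finite S \<Longrightarrow> finite (box S)"
  unfolding box_def by (intro finite_PiE) auto

lemma card_box: "finite S \<Longrightarrow> card (box S) = m ^ card S"
  unfolding box_def by (simp add: card_PiE)

lemma box_lt: "q \<in> box S \<Longrightarrow> i \<in> S \<Longrightarrow> q i < m"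
  unfolding box_def by auto

lemma box_upd: "q \<in> box S \<Longrightarrow> t < m \<Longrightarrow> q(i := t) \<in> box (insert i S)"
  unfolding box_def by (auto simp: PiE_def extensional_def)

lemma sum_box_insert:
  assumes "i \<notin> S"
  shows "(\<Sum>q\<in>box (insert i S). \<phi> q) = (\<Sum>t<m. \<Sum>q\<in>box S. \<phi> (q(i := t)))"
proof -
  have "(\<Sum>q\<in>box (insert i S). \<phi> q) = (\<Sum>(t, q)\<in>{..<m} \<times> box S. \<phi> (q(i := t)))"
    unfolding box_def PiE_insert_eq
    by (subst sum.reindex[OF inj_combinator[OF assms]]) (simp add: case_prod_unfold comp_def)
  then show ?thesis by (simp add: sum.cartesian_product)
qed

text \<open>With the exponent in one coordinate fixed, the partial sums are martingale differences
  in that coordinate, so the self-normalized inequality applies once per coordinate and costs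
  \<open>4 * p\<close> each time. The term \<open>real m ^ card R - 1\<close> vanishes for empty
  \<open>R\<close>, where the bound is an equality, and grows fast enough to absorb the
  \<open>+ 1\<close> of each application. The bound \<open>real m ^ B\<close> only limits the number
  of dyadic sizes in the union bounds.\<close>

lemma multi_azuma:
  assumes "finite R" "\<And>u i. u \<in> box R \<Longrightarrow> i \<in> R \<Longrightarrow> martingale_diff i (u i) (X u)"
    and "\<And>u x. u \<in> box R \<Longrightarrow> x \<in> \<Omega> \<Longrightarrow> \<bar>X u x\<bar> \<le> real m ^ B"
  shows "small (3 * card R + 2 * B + 5) (\<lambda>x. (\<Sum>u\<in>box R. X u x)\<^sup>2 >
           (4 * p) ^ card R * ((\<Sum>u\<in>box R. (X u x)\<^sup>2) + real m ^ card R - 1))"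
  using assms
proof (induction R arbitrary: X rule: finite_induct)
  case empty
  show ?case by (rule small_False) (simp add: box_def)
next
  case (insert i R)
  define k where "k = card R"
  define Y where "Y t x = (\<Sum>u\<in>box R. X (u(i := t)) x)" for t x
  define Z where "Z t x = (\<Sum>u\<in>box R. (X (u(i := t)) x)\<^sup>2)" for t x
  have upd: "u(i := t) \<in> box (insert i R)" if "u \<in> box R" "t < m" for u t
    using box_upd that by blast
  have Ymd: "martingale_diff i t (Y t)" if "t \<in> {..<m}" for t
    unfolding Y_def using insert.prems(1)[OF upd, of _ t i] that
    by (intro martingale_diff_sum) (auto simp: fun_upd_def)
  have Yb: "\<bar>Y t x\<bar> \<le> real m ^ (k + B)" if "t < m" "x \<in> \<Omega>" for t x
  proof -
    have "\<bar>Y t x\<bar> \<le> (\<Sum>u\<in>box R. \<bar>X (u(i := t)) x\<bar>)" unfolding Y_def by (rule sum_abs)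
    also have "\<dots> \<le> real (card (box R)) * real m ^ B"
      by (rule sum_bounded_above) (use insert.prems(2) upd that in auto)
    also have "\<dots> = real m ^ (k + B)"
      using card_box[OF insert.hyps(1)] by (simp add: power_add k_def)
    finally show ?thesis .
  qed
  have small1: "small (2 + 2 * k + 2 * B + 3) (\<lambda>x. (\<Sum>t<m. Y t x)\<^sup>2 > 4 * p * ((\<Sum>t<m. (Y t x)\<^sup>2) + 1))"
  proof (rule azuma_self_normalized[where s = id and i = i])
    fix x assume x: "x \<in> \<Omega>"
    have "(\<Sum>t<m. (Y t x)\<^sup>2) \<le> real (card {..<m}) * (real m ^ (k + B))\<^sup>2"
      by (rule sum_bounded_above) (use Yb x in \<open>auto intro: power2_le_iff_abs_le[THEN iffD2]\<close>)
    then have "(\<Sum>t<m. (Y t x)\<^sup>2) + 1 \<le> real m * (real m ^ (k + B))\<^sup>2 + 1" by simp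
    also have "\<dots> = real m ^ (2 * k + 2 * B + 1) + 1"
      by (simp add: power_add power_mult power2_eq_square mult_ac)
    also have "\<dots> \<le> real m ^ (2 * k + 2 * B + 1) + real m ^ (2 * k + 2 * B + 1)"
      using m_ge one_le_power[of "real m" "2 * k + 2 * B + 1"] by linarith
    also have "\<dots> = 2 * real m ^ (2 * k + 2 * B + 1)" by simp
    also have "\<dots> \<le> real m * real m ^ (2 * k + 2 * B + 1)"
      using m_ge by (intro mult_right_mono) auto
    finally show "(\<Sum>t<m. (Y t x)\<^sup>2) + 1 \<le> real m ^ (2 + 2 * k + 2 * B)"
      by (simp add: power_add mult_ac power2_eq_square)
  qed (use Ymd in auto)
  have small2: "small ((3 * k + 2 * B + 5) + 1) (\<lambda>x. \<exists>t\<in>{..<m}. (Y t x)\<^sup>2 > (4 * p) ^ k * (Z t x + real m ^ k - 1))"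
  proof (rule small_UN)
    fix t assume t: "t \<in> {..<m}"
    show "small (3 * k + 2 * B + 5) (\<lambda>x. (Y t x)\<^sup>2 > (4 * p) ^ k * (Z t x + real m ^ k - 1))"
      unfolding k_def Y_def Z_def
    proof (rule insert.IH)
      show "martingale_diff j (u j) (X (u(i := t)))" if "u \<in> box R" "j \<in> R" for u j
      proof -
        have "martingale_diff j ((u(i := t)) j) (X (u(i := t)))"
          using that t by (intro insert.prems(1) upd) auto
        moreover have "j \<noteq> i" using that insert.hyps(2) by auto
        ultimately show ?thesis by (simp only: fun_upd_other not_False_eq_True)
      qed
      show "\<bar>X (u(i := t)) x\<bar> \<le> real m ^ B" if "u \<in> box R" "x \<in> \<Omega>" for u x
        using t that by (intro insert.prems(2) upd) auto
    qed
  qed auto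
  show ?case
  proof (rule small_mono[OF small_disj[OF small1 small2]])
    fix x assume x: "x \<in> \<Omega>"
    let ?k = "card (insert i R)"
    assume big: "(\<Sum>u\<in>box (insert i R). X u x)\<^sup>2 >
           (4 * p) ^ ?k * ((\<Sum>u\<in>box (insert i R). (X u x)\<^sup>2) + real m ^ ?k - 1)"
    have k: "?k = Suc k" using insert.hyps by (simp add: k_def)
    have s1: "(\<Sum>u\<in>box (insert i R). X u x) = (\<Sum>t<m. Y t x)"
      and s2: "(\<Sum>u\<in>box (insert i R). (X u x)\<^sup>2) = (\<Sum>t<m. Z t x)"
      unfolding Y_def Z_def using insert.hyps by (simp_all add: sum_box_insert)
    show "(\<Sum>t<m. Y t x)\<^sup>2 > 4 * p * ((\<Sum>t<m. (Y t x)\<^sup>2) + 1) \<or>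
        (\<exists>t\<in>{..<m}. (Y t x)\<^sup>2 > (4 * p) ^ k * (Z t x + real m ^ k - 1))"
    proof (rule ccontr)
      assume "\<not> ?thesis"
      then have h1: "(\<Sum>t<m. Y t x)\<^sup>2 \<le> 4 * p * ((\<Sum>t<m. (Y t x)\<^sup>2) + 1)"
        and h2: "\<And>t. t < m \<Longrightarrow> (Y t x)\<^sup>2 \<le> (4 * p) ^ k * (Z t x + real m ^ k - 1)"
        by (meson lessThan_iff not_less)+
      have p1: "1 \<le> (4 * p) ^ k" using p_ge by (intro one_le_power) simp
      have mk: "1 \<le> real m ^ k" using m_ge by simp
      have "(\<Sum>t<m. (Y t x)\<^sup>2) \<le> (\<Sum>t<m. (4 * p) ^ k * (Z t x + real m ^ k - 1))"
        by (rule sum_mono) (use h2 in auto)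
      also have "\<dots> = (4 * p) ^ k * ((\<Sum>t<m. Z t x) + real m * real m ^ k - real m)"
        by (simp add: sum_distrib_left[symmetric] sum.distrib sum_subtractf)
      finally have "(\<Sum>t<m. (Y t x)\<^sup>2) + 1
          \<le> (4 * p) ^ k * ((\<Sum>t<m. Z t x) + real m * real m ^ k - real m) + (4 * p) ^ k"
        using p1 by linarith
      also have "\<dots> = (4 * p) ^ k * ((\<Sum>t<m. Z t x) + real m * real m ^ k - (real m - 1))"
        by (simp add: algebra_simps)
      also have "\<dots> \<le> (4 * p) ^ k * ((\<Sum>t<m. Z t x) + real m * real m ^ k - 1)"
        using p1 m_ge by (intro mult_left_mono) auto
      finally have "4 * p * ((\<Sum>t<m. (Y t x)\<^sup>2) + 1)
          \<le> 4 * p * ((4 * p) ^ k * ((\<Sum>t<m. Z t x) + real m * real m ^ k - 1))"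
        using p_ge by (intro mult_left_mono) auto
      with h1 big show False unfolding k s1 s2 by (simp add: mult.assoc)
    qed
  qed (use insert.hyps in \<open>auto simp: k_def\<close>)
qed

text \<open>The tensor power of the one-dimensional decomposition; its total weight is still only a
  power of the logarithm of \<open>m\<close>. Since \<open>G j l i\<close> depends on
  \<open>l\<close> through \<open>l i\<close> alone, its factors can later be shared out between two
  functions evaluated at different splices of \<open>l\<close> and \<open>u\<close>.\<close>

lemma multi_less_decomposition:
  assumes "finite R"
  obtains J :: "(nat \<Rightarrow> nat) set" and c :: "(nat \<Rightarrow> nat) \<Rightarrow> real"
    and G H :: "(nat \<Rightarrow> nat) \<Rightarrow> (nat \<Rightarrow> nat) \<Rightarrow> (nat \<Rightarrow> real)"
  where "finite J" "card J \<le> m ^ card R" "\<And>j. j \<in> J \<Longrightarrow> c j \<ge> 0" "(\<Sum>j\<in>J. c j) = real L ^ card R"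
    "\<And>j l i. j \<in> J \<Longrightarrow> i \<in> R \<Longrightarrow> \<bar>G j l i\<bar> \<le> 1" "\<And>j u i. j \<in> J \<Longrightarrow> i \<in> R \<Longrightarrow> \<bar>H j u i\<bar> \<le> 1"
    "\<And>j l l' i. l i = l' i \<Longrightarrow> G j l i = G j l' i"
    "\<And>l u. l \<in> box R \<Longrightarrow> u \<in> box R \<Longrightarrow>
       of_bool (\<forall>i\<in>R. l i < u i) = (\<Sum>j\<in>J. c j * (\<Prod>i\<in>R. G j l i) * (\<Prod>i\<in>R. H j u i))"
proof -
  obtain n c g h where d: "n \<le> m" "\<And>j. j < n \<Longrightarrow> c j \<ge> 0" "(\<Sum>j<n. c j) = real L"
    "\<And>j a. j < n \<Longrightarrow> \<bar>g j a\<bar> \<le> 1" "\<And>j b. j < n \<Longrightarrow> \<bar>h j b\<bar> \<le> 1"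
    "\<And>a b. a < m \<Longrightarrow> b < m \<Longrightarrow> of_bool (a < b) = (\<Sum>j<n. c j * g j a * h j b)"
    by (rule less_decomposition[of L, folded m_def]) (rule that)
  let ?J = "\<Pi>\<^sub>E i\<in>R. {..<n}"
  show ?thesis
  proof (rule that[of ?J "\<lambda>j. \<Prod>i\<in>R. c (j i)" "\<lambda>j l i. g (j i) (l i)" "\<lambda>j u i. h (j i) (u i)"])
    show "card ?J \<le> m ^ card R" using assms d(1) by (simp add: card_PiE power_mono)
    have "(\<Sum>j\<in>?J. \<Prod>i\<in>R. c (j i)) = (\<Prod>i\<in>R. \<Sum>j<n. c j)"
      using assms by (intro prod_sum_PiE[symmetric]) auto
    then show "(\<Sum>j\<in>?J. \<Prod>i\<in>R. c (j i)) = real L ^ card R" using d(3) by simp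
    fix l u assume lu: "l \<in> box R" "u \<in> box R"
    have "of_bool (\<forall>i\<in>R. l i < u i) = (\<Prod>i\<in>R. of_bool (l i < u i) :: real)"
      using assms by (induction R rule: finite_induct) auto
    also have "\<dots> = (\<Prod>i\<in>R. \<Sum>j<n. c j * g j (l i) * h j (u i))"
      using lu by (intro prod.cong refl d(6)) (auto simp: box_lt)
    also have "\<dots> = (\<Sum>j\<in>?J. \<Prod>i\<in>R. c (j i) * g (j i) (l i) * h (j i) (u i))"
      using assms by (intro prod_sum_PiE) auto
    finally show "of_bool (\<forall>i\<in>R. l i < u i) =
        (\<Sum>j\<in>?J. (\<Prod>i\<in>R. c (j i)) * (\<Prod>i\<in>R. g (j i) (l i)) * (\<Prod>i\<in>R. h (j i) (u i)))"
      by (simp add: prod.distrib)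
  next
    show "\<And>j. j \<in> ?J \<Longrightarrow> 0 \<le> (\<Prod>i\<in>R. c (j i))"
      by (intro prod_nonneg) (use d(2) in \<open>auto simp: PiE_iff\<close>)
  qed (use assms d(4,5) in \<open>auto intro!: finite_PiE simp: PiE_iff\<close>)
qed

definition form :: "nat set \<Rightarrow> (nat \<Rightarrow> pattern) \<Rightarrow> ((nat \<Rightarrow> nat) \<Rightarrow> 'a \<Rightarrow> real) \<Rightarrow>
    ((nat \<Rightarrow> nat) \<Rightarrow> 'a \<Rightarrow> real) \<Rightarrow> 'a \<Rightarrow> real" where
  "form S \<pi> f g x = (\<Sum>q\<in>box S. \<Sum>q'\<in>box S. kerprod S \<pi> q q' * f q x * g q' x)"

lemma form_insert:
  assumes "finite S" "i \<notin> S"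
  shows "form (insert i S) \<pi> f g x =
     (\<Sum>t<m. \<Sum>t'<m. ker (\<pi> i) t t' * form S \<pi> (freeze i t f) (freeze i t' g) x)"
proof -
  have "form (insert i S) \<pi> f g x = (\<Sum>t<m. \<Sum>q\<in>box S. \<Sum>t'<m. \<Sum>q'\<in>box S.
     ker (\<pi> i) t t' * (kerprod S \<pi> q q' * freeze i t f q x * freeze i t' g q' x))"
    unfolding form_def sum_box_insert[OF assms(2)] kerprod_insert[OF assms] kerprod_upd[OF assms(2)]
    by (simp add: freeze_def mult_ac)
  also have "\<dots> = (\<Sum>t<m. \<Sum>t'<m. \<Sum>q\<in>box S. \<Sum>q'\<in>box S.
     ker (\<pi> i) t t' * (kerprod S \<pi> q q' * freeze i t f q x * freeze i t' g q' x))"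
    by (intro sum.cong refl sum.swap)
  finally show ?thesis by (simp add: form_def sum_distrib_left)
qed

lemma form_insert_Tied:
  assumes "finite S" "i \<notin> S" "\<pi> i = Tied"
  shows "form (insert i S) \<pi> f g x = (\<Sum>t<m. form S \<pi> (freeze i t f) (freeze i t g) x)"
  unfolding form_insert[OF assms(1,2)] assms(3)
  by (intro sum.cong refl) (simp add: of_bool_def mult_delta_left)

end

definition mix :: "nat set \<Rightarrow> (nat \<Rightarrow> nat) \<Rightarrow> (nat \<Rightarrow> nat) \<Rightarrow> nat \<Rightarrow> nat" where
  "mix P a b = (\<lambda>i. if i \<in> P then a i else b i)"

lemma mix_mix [simp]:
  "mix P (mix P a b) (mix P a' b') = mix P a b'"
  "mix P a a = a"
  by (auto simp: mix_def)

lemma mix_in [simp]: "i \<in> P \<Longrightarrow> mix P a b i = a i"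
  and mix_notin [simp]: "i \<notin> P \<Longrightarrow> mix P a b i = b i"
  by (auto simp: mix_def)

text \<open>Cauchy-Schwarz with respect to the weights \<open>c\<close>: the loss is the total
  weight, here a power of a logarithm, instead of the number of terms.\<close>

lemma sum_square_weighted_le:
  fixes c a :: "'b \<Rightarrow> real"
  assumes "\<And>j. j \<in> J \<Longrightarrow> c j \<ge> 0"
  shows "(\<Sum>j\<in>J. c j * a j)\<^sup>2 \<le> (\<Sum>j\<in>J. c j) * (\<Sum>j\<in>J. c j * (a j)\<^sup>2)"
proof -
  have "(\<Sum>j\<in>J. c j * a j) = (\<Sum>j\<in>J. sqrt (c j) * (sqrt (c j) * a j))"
    using assms by (intro sum.cong) (auto simp flip: mult.assoc)
  then have "(\<Sum>j\<in>J. c j * a j)\<^sup>2 \<le> (\<Sum>j\<in>J. (sqrt (c j))\<^sup>2) * (\<Sum>j\<in>J. (sqrt (c j) * a j)\<^sup>2)"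
    using Cauchy_Schwarz_ineq_sum[of "\<lambda>j. sqrt (c j)" "\<lambda>j. sqrt (c j) * a j" J] by simp
  also have "(\<Sum>j\<in>J. (sqrt (c j))\<^sup>2) = (\<Sum>j\<in>J. c j)"
    using assms by (intro sum.cong) auto
  also have "(\<Sum>j\<in>J. (sqrt (c j) * a j)\<^sup>2) = (\<Sum>j\<in>J. c j * (a j)\<^sup>2)"
    using assms by (intro sum.cong) (auto simp: power_mult_distrib)
  finally show ?thesis .
qed

lemma prod_of_bool: "finite A \<Longrightarrow> (\<Prod>i\<in>A. of_bool (Q i) :: real) = of_bool (\<forall>i\<in>A. Q i)"
  by (induction A rule: finite_induct) auto

context flip_space
begin

text \<open>Families indexed by the free sides of rectangles of fixed volume: the side in the distinguished
  coordinate \<open>lc\<close> is determined by the others. The bound on \<open>c\<close> keeps the subtraction from truncating.\<close>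

definition admissible :: "nat set \<Rightarrow> nat \<Rightarrow> ((nat \<Rightarrow> nat) \<Rightarrow> 'a \<Rightarrow> real) \<Rightarrow> bool" where
  "admissible S c f \<longleftrightarrow> card S * m \<le> c \<and> (\<forall>q\<in>box S. (\<forall>x\<in>\<Omega>. \<bar>f q x\<bar> \<le> 1) \<and>
     (\<forall>i\<in>S. martingale_diff i (q i) (f q)) \<and> martingale_diff lc (c - (\<Sum>i\<in>S. q i)) (f q))"

lemma admissible_le: "admissible S c f \<Longrightarrow> q \<in> box S \<Longrightarrow> x \<in> \<Omega> \<Longrightarrow> \<bar>f q x\<bar> \<le> 1"
  by (simp add: admissible_def)

lemma admissible_md: "admissible S c f \<Longrightarrow> q \<in> box S \<Longrightarrow> i \<in> S \<Longrightarrow> martingale_diff i (q i) (f q)"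
  by (simp add: admissible_def)

text \<open>A frozen exponent \<open>t\<close> uses up \<open>t\<close> of the prescribed sum
  \<open>c\<close>. Different values of \<open>t\<close> leave different sums, and this is how the
  offsets \<open>c \<noteq> c'\<close> of the later lemmas come about.\<close>

lemma admissible_freeze:
  assumes "finite S" "i \<notin> S" "admissible (insert i S) c f" "t < m"
  shows "admissible S (c - t) (freeze i t f)"
proof -
  have c: "card S * m + m \<le> c" using assms by (simp add: admissible_def add.commute)
  show ?thesis
    unfolding admissible_def freeze_def
  proof (intro conjI ballI)
    show "card S * m \<le> c - t" using c assms(4) by linarith
    fix q assume "q \<in> box S"
    then have q: "q(i := t) \<in> box (insert i S)" using assms(4) by (rule box_upd)
    show "\<And>x. x \<in> \<Omega> \<Longrightarrow> \<bar>f (q(i := t)) x\<bar> \<le> 1" using admissible_le[OF assms(3) q] .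
    show "martingale_diff j (q j) (f (q(i := t)))" if "j \<in> S" for j
    proof -
      have "martingale_diff j ((q(i := t)) j) (f (q(i := t)))" using admissible_md[OF assms(3) q, of j] that by simp
      moreover have "j \<noteq> i" using that assms(2) by auto
      ultimately show ?thesis by (simp only: fun_upd_other not_False_eq_True)
    qed
    have "(\<Sum>j\<in>insert i S. (q(i := t)) j) = t + (\<Sum>j\<in>S. q j)"
    proof -
      have "(\<Sum>j\<in>S. (q(i := t)) j) = (\<Sum>j\<in>S. q j)" using assms(2) by (intro sum.cong) auto
      then show ?thesis using assms(1,2) by simp
    qed
    moreover have "martingale_diff lc (c - (\<Sum>j\<in>insert i S. (q(i := t)) j)) (f (q(i := t)))"
      using assms(3) q unfolding admissible_def by blast
    ultimately show "martingale_diff lc (c - t - (\<Sum>j\<in>S. q j)) (f (q(i := t)))"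
      by simp
  qed
qed

lemma admissible_scale:
  assumes "admissible S c f" "\<And>q. q \<in> box S \<Longrightarrow> \<bar>w q\<bar> \<le> 1"
  shows "admissible S c (\<lambda>q x. w q * f q x)"
  using assms unfolding admissible_def by (auto simp: abs_mult intro!: martingale_diff_cmult mult_le_one)

text \<open>All free sides coincide, but the volumes differ, hence so do the sides in direction \<open>lc\<close>; this is
  where the square root gain comes from.\<close>

lemma offset_tied_bound:
  assumes "finite S" "S \<noteq> {}" "admissible S c f" "admissible S c' g" "c \<noteq> c'"
  shows "small (card S) (\<lambda>x. \<bar>\<Sum>q\<in>box S. f q x * g q x\<bar> > sqrt (2 * p * m) * real m ^ (card S - 1))"
  using assms
proof (induction S arbitrary: c c' f g rule: finite_ne_induct)
  case (singleton i)
  define Y where "Y t x = (\<Sum>q\<in>box {}. f (q(i := t)) x * g (q(i := t)) x)" for t x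
  have box0: "box {} = {\<lambda>_. undefined}" by (simp add: box_def)
  have Yeq: "Y t = (\<lambda>x. f ((\<lambda>_. undefined)(i := t)) x * g ((\<lambda>_. undefined)(i := t)) x)" for t
    by (rule ext) (simp add: Y_def box0 fun_upd_def)
  have inb: "(\<lambda>_. undefined)(i := t) \<in> box {i}" if "t < m" for t
    using box_upd[of "\<lambda>_. undefined" "{}" t i] that by (simp add: box0)
  have cm: "m \<le> c" "m \<le> c'" using singleton by (auto simp: admissible_def)
  have mdf: "martingale_diff lc (c - t) (f ((\<lambda>_. undefined)(i := t)))" if "t < m" for t
    using singleton(1) inb[OF that] by (auto simp: admissible_def)
  have mdg: "martingale_diff lc (c' - t) (g ((\<lambda>_. undefined)(i := t)))" if "t < m" for t
    using singleton(2) inb[OF that] by (auto simp: admissible_def)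
  \<comment> \<open>The product has in direction \<open>lc\<close> the finer of the two levels, the
    factor with the coarser one being predictable. Since \<open>m \<le> c\<close> and
    \<open>m \<le> c'\<close>, no subtraction truncates, and these levels are distinct for distinct
    \<open>t\<close>.\<close>
  have Y: "martingale_diff lc (max c c' - t) (Y t)" if "t \<in> {..<m}" for t
  proof (cases "c' < c")
    case True
    then have "inv_from lc (c - t) (g ((\<lambda>_. undefined)(i := t)))"
      using mdg[of t] cm that by (intro martingale_diff_imp_inv_from) auto
    from martingale_diff_mult_inv[OF this mdf] that True show ?thesis unfolding Yeq by (simp add: mult.commute max_def)
  next
    case False
    then have "inv_from lc (c' - t) (f ((\<lambda>_. undefined)(i := t)))"
      using mdf[of t] cm that singleton(3) by (intro martingale_diff_imp_inv_from[of _ "c - t"]) auto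
    from martingale_diff_mult_inv[OF this mdg] that False show ?thesis unfolding Yeq by (simp add: max_def)
  qed
  have Yle: "(Y t x)\<^sup>2 \<le> 1" if "t < m" "x \<in> \<Omega>" for t x
  proof -
    have "\<bar>Y t x\<bar> \<le> 1"
      using admissible_le[OF singleton(1) inb[OF that(1)] that(2)] admissible_le[OF singleton(2) inb[OF that(1)] that(2)]
      by (simp add: Y_def box0 abs_mult mult_le_one)
    then show ?thesis by (simp add: abs_square_le_1)
  qed
  have "inj_on (\<lambda>t. max c c' - t) {..<m}" using cm by (auto simp: inj_on_def)
  then have "small 1 (\<lambda>x. \<bar>\<Sum>t<m. Y t x\<bar> > sqrt (2 * p * m) \<and> (\<Sum>t<m. (Y t x)\<^sup>2) \<le> m)"
    using m_ge by (intro azuma[where i = lc and s = "\<lambda>t. max c c' - t"] Y) auto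
  then show ?case
  proof (rule small_mono)
    fix x assume x: "x \<in> \<Omega>"
      and big: "\<bar>\<Sum>q\<in>box {i}. f q x * g q x\<bar> > sqrt (2 * p * m) * real m ^ (card {i} - 1)"
    have "(\<Sum>q\<in>box {i}. f q x * g q x) = (\<Sum>t<m. Y t x)"
      unfolding Y_def by (rule sum_box_insert) simp
    moreover have "(\<Sum>t<m. (Y t x)\<^sup>2) \<le> real (card {..<m}) * 1"
      by (rule sum_bounded_above) (use Yle x in auto)
    ultimately show "\<bar>\<Sum>t<m. Y t x\<bar> > sqrt (2 * p * m) \<and> (\<Sum>t<m. (Y t x)\<^sup>2) \<le> m"
      using big by simp
  qed simp
next
  case (insert i S)
  let ?b = "sqrt (2 * p * m) * real m ^ (card S - 1)"
  let ?s = "\<lambda>t x. \<Sum>q\<in>box S. freeze i t f q x * freeze i t g q x"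
  have cm: "m \<le> c" "m \<le> c'" using insert by (auto simp: admissible_def)
  \<comment> \<open>One coordinate suffices for the cancellation; every further one is summed by the
    triangle inequality at the cost of a factor \<open>m\<close>.\<close>
  have "small (card S + 1) (\<lambda>x. \<exists>t\<in>{..<m}. \<bar>?s t x\<bar> > ?b)"
  proof (rule small_UN)
    fix t assume t: "t \<in> {..<m}"
    show "small (card S) (\<lambda>x. \<bar>?s t x\<bar> > ?b)"
      by (rule insert.IH[of "c - t" _ "c' - t"]) (use insert t cm in \<open>auto intro: admissible_freeze\<close>)
  qed auto
  then show ?case
  proof (rule small_mono)
    fix x assume x: "x \<in> \<Omega>"
      and big: "\<bar>\<Sum>q\<in>box (insert i S). f q x * g q x\<bar> > sqrt (2 * p * m) * real m ^ (card (insert i S) - 1)"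
    have e: "(\<Sum>q\<in>box (insert i S). f q x * g q x) = (\<Sum>t<m. ?s t x)"
      unfolding freeze_def using insert.hyps by (intro sum_box_insert)
    show "\<exists>t\<in>{..<m}. \<bar>?s t x\<bar> > ?b"
    proof (rule ccontr)
      assume "\<not> ?thesis"
      then have bd: "\<bar>?s t x\<bar> \<le> ?b" if "t \<in> {..<m}" for t using that by (meson not_less)
      have "\<bar>\<Sum>t<m. ?s t x\<bar> \<le> (\<Sum>t<m. \<bar>?s t x\<bar>)" by (rule sum_abs)
      also have "\<dots> \<le> real (card {..<m}) * ?b" by (rule sum_bounded_above[OF bd])
      also have "\<dots> = real m * ?b" by simp
      also have "\<dots> = sqrt (2 * p * m) * real m ^ (card (insert i S) - 1)"
      proof -
        have "card S \<noteq> 0" using insert.hyps by simp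
        then have "real m * real m ^ (card S - 1) = real m ^ card S" by (metis power_eq_if)
        then show ?thesis using insert.hyps by (simp add: mult_ac)
      qed
      finally show False using big e by simp
    qed
  qed (use insert.hyps in simp)
qed

lemma form_Free:
  assumes "\<And>i. i \<in> S \<Longrightarrow> \<pi> i = Free"
  shows "form S \<pi> f g x = (\<Sum>q\<in>box S. f q x) * (\<Sum>q\<in>box S. g q x)"
proof -
  have "kerprod S \<pi> q q' = 1" for q q' unfolding kerprod_def using assms by (intro prod.neutral) auto
  then show ?thesis by (simp add: form_def sum_product)
qed

text \<open>For equal functions, tied coordinates give a sum of squares without cancellation, a
  factor \<open>m\<close> each. In the free coordinates the form is the square of a sum, for which
  \<open>multi_azuma\<close> gives \<open>4 * p * m\<close> per coordinate in place of the trivial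
  \<open>m\<^sup>2\<close>. The constant 2 adds up the square function and the additive term of
  \<open>multi_azuma\<close>, each at most \<open>m ^ card Q\<close>.\<close>

lemma diagonal_bound:
  assumes "finite T" "finite Q" "T \<inter> Q = {}" "\<And>i. i \<in> T \<Longrightarrow> \<pi> i = Tied" "\<And>i. i \<in> Q \<Longrightarrow> \<pi> i = Free"
    and "admissible (T \<union> Q) c f"
  shows "small (3 * card Q + 5 + card T)
           (\<lambda>x. \<bar>form (T \<union> Q) \<pi> f f x\<bar> > 2 * real m ^ card T * (4 * p * m) ^ card Q)"
  using assms(1,3,4,6)
proof (induction T arbitrary: c f rule: finite_induct)
  case empty
  let ?k = "card Q"
  have a: "admissible Q c f" using empty by simp
  have "small (3 * ?k + 2 * 0 + 5) (\<lambda>x. (\<Sum>u\<in>box Q. f u x)\<^sup>2 >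
           (4 * p) ^ ?k * ((\<Sum>u\<in>box Q. (f u x)\<^sup>2) + real m ^ ?k - 1))"
    by (rule multi_azuma[OF assms(2)]) (use admissible_md[OF a] admissible_le[OF a] in auto)
  then show ?case
  proof (rule small_mono)
    fix x assume x: "x \<in> \<Omega>" and big: "\<bar>form ({} \<union> Q) \<pi> f f x\<bar> > 2 * real m ^ card ({} :: nat set) * (4 * p * m) ^ ?k"
    have f: "form ({} \<union> Q) \<pi> f f x = (\<Sum>u\<in>box Q. f u x)\<^sup>2"
      using form_Free[of Q \<pi> f f x] assms(5) by (simp add: power2_eq_square)
    have "(\<Sum>u\<in>box Q. (f u x)\<^sup>2) \<le> real (card (box Q)) * 1"
      by (rule sum_bounded_above) (use admissible_le[OF a _ x] in \<open>simp add: abs_square_le_1\<close>)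
    then have "(\<Sum>u\<in>box Q. (f u x)\<^sup>2) + real m ^ ?k - 1 \<le> 2 * real m ^ ?k"
      using card_box[OF assms(2)] by simp
    then have "(4 * p) ^ ?k * ((\<Sum>u\<in>box Q. (f u x)\<^sup>2) + real m ^ ?k - 1) \<le> (4 * p) ^ ?k * (2 * real m ^ ?k)"
      using p_ge by (intro mult_left_mono) auto
    also have "\<dots> = 2 * real m ^ card ({} :: nat set) * (4 * p * m) ^ ?k" by (simp add: power_mult_distrib)
    also have "\<dots> < (\<Sum>u\<in>box Q. f u x)\<^sup>2" using big unfolding f by simp
    finally show "(\<Sum>u\<in>box Q. f u x)\<^sup>2 >
           (4 * p) ^ ?k * ((\<Sum>u\<in>box Q. (f u x)\<^sup>2) + real m ^ ?k - 1)" .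
  qed simp
next
  case (insert i T)
  let ?S = "T \<union> Q"
  let ?b = "2 * real m ^ card T * (4 * p * m) ^ card Q"
  have i: "i \<notin> ?S" using insert by auto
  have "small ((3 * card Q + 5 + card T) + 1) (\<lambda>x. \<exists>t\<in>{..<m}. \<bar>form ?S \<pi> (freeze i t f) (freeze i t f) x\<bar> > ?b)"
  proof (rule small_UN)
    fix t assume t: "t \<in> {..<m}"
    show "small (3 * card Q + 5 + card T) (\<lambda>x. \<bar>form ?S \<pi> (freeze i t f) (freeze i t f) x\<bar> > ?b)"
      by (rule insert.IH[of "c - t"]) (use insert t i assms(2) in \<open>auto intro: admissible_freeze\<close>)
  qed auto
  then show ?case
  proof (rule small_mono)
    fix x assume x: "x \<in> \<Omega>"
      and big: "\<bar>form (insert i T \<union> Q) \<pi> f f x\<bar> > 2 * real m ^ card (insert i T) * (4 * p * m) ^ card Q"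
    have e: "form (insert i T \<union> Q) \<pi> f f x = (\<Sum>t<m. form ?S \<pi> (freeze i t f) (freeze i t f) x)"
      using form_insert_Tied[of ?S i \<pi> f f x] insert i assms(2) by simp
    show "\<exists>t\<in>{..<m}. \<bar>form ?S \<pi> (freeze i t f) (freeze i t f) x\<bar> > ?b"
    proof (rule ccontr)
      assume "\<not> ?thesis"
      then have bd: "\<bar>form ?S \<pi> (freeze i t f) (freeze i t f) x\<bar> \<le> ?b" if "t \<in> {..<m}" for t
        using that by (meson not_less)
      have "\<bar>\<Sum>t<m. form ?S \<pi> (freeze i t f) (freeze i t f) x\<bar>
          \<le> (\<Sum>t<m. \<bar>form ?S \<pi> (freeze i t f) (freeze i t f) x\<bar>)"
        by (rule sum_abs)
      also have "\<dots> \<le> real (card {..<m}) * ?b" by (rule sum_bounded_above[OF bd])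
      also have "\<dots> = 2 * real m ^ card (insert i T) * (4 * p * m) ^ card Q"
        using insert.hyps by simp
      finally show False using big e by simp
    qed
  qed (use insert.hyps in simp)
qed

lemma mix_box: "a \<in> box R \<Longrightarrow> b \<in> box R \<Longrightarrow> mix P a b \<in> box R"
  by (auto simp: box_def mix_def PiE_iff extensional_def)

text \<open>Passing from the pair \<open>(q, q')\<close> to its coordinatewise maximum \<open>u\<close> and minimum \<open>l\<close>.\<close>

lemma form_ordered:
  assumes "finite R" "P \<subseteq> R" "\<And>i. i \<in> P \<Longrightarrow> \<pi> i = Below" "\<And>i. i \<in> R - P \<Longrightarrow> \<pi> i = Above"
  shows "form R \<pi> f g x = (\<Sum>u\<in>box R. \<Sum>l\<in>box R.
     of_bool (\<forall>i\<in>R. l i < u i) * (f (mix P l u) x * g (mix P u l) x))"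
proof -
  have k: "kerprod R \<pi> (mix P l u) (mix P u l) = of_bool (\<forall>i\<in>R. l i < u i)" for l u
  proof -
    have "kerprod R \<pi> (mix P l u) (mix P u l) = (\<Prod>i\<in>R. of_bool (l i < u i))"
      unfolding kerprod_def using assms(3,4) by (intro prod.cong refl) (auto simp: mix_def)
    also have "\<dots> = of_bool (\<forall>i\<in>R. l i < u i)"
      by (rule prod_of_bool[OF assms(1)])
    finally show ?thesis .
  qed
  have "form R \<pi> f g x = (\<Sum>(q, q')\<in>box R \<times> box R. kerprod R \<pi> q q' * f q x * g q' x)"
    unfolding form_def by (simp add: sum.cartesian_product)
  also have "\<dots> = (\<Sum>(u, l)\<in>box R \<times> box R. of_bool (\<forall>i\<in>R. l i < u i) * (f (mix P l u) x * g (mix P u l) x))"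
    \<comment> \<open>On \<open>P\<close> the first index is the smaller one, so
      \<open>q = mix P l u\<close> and \<open>q' = mix P u l\<close>.\<close>
    by (rule sum.reindex_bij_witness[where i = "\<lambda>(u, l). (mix P l u, mix P u l)"
          and j = "\<lambda>(q, q'). (mix P q' q, mix P q q')"])
       (auto simp: mix_box k[symmetric] mult.assoc)
  finally show ?thesis by (simp add: sum.cartesian_product)
qed

text \<open>The left side arises by squaring a sum over \<open>l\<close> and then summing over
  \<open>u\<close>. Both arguments of \<open>f\<close> and \<open>f'\<close> carry \<open>u\<close>
  off \<open>P\<close> and are independent on \<open>P\<close>; for \<open>g\<close> and
  \<open>g'\<close> it is the other way round. The triple \<open>(u, l, l')\<close> thus amounts to
  two independent pairs of indices, one pair agreeing off \<open>P\<close> and the other agreeing on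
  \<open>P\<close>; \<open>u\<close> is recovered from the second pair on \<open>P\<close> and from
  the first off \<open>P\<close>.\<close>

lemma form_product:
  fixes f f' g g' :: "(nat \<Rightarrow> nat) \<Rightarrow> 'a \<Rightarrow> real"
  assumes "finite R" "P \<subseteq> R"
    and "\<And>i. i \<in> P \<Longrightarrow> \<kappa> i = Free" "\<And>i. i \<in> R - P \<Longrightarrow> \<kappa> i = Tied"
    and "\<And>i. i \<in> P \<Longrightarrow> \<kappa>' i = Tied" "\<And>i. i \<in> R - P \<Longrightarrow> \<kappa>' i = Free"
  shows "(\<Sum>u\<in>box R. \<Sum>l\<in>box R. \<Sum>l'\<in>box R. f (mix P l u) x * g (mix P u l) x * (f' (mix P l' u) x * g' (mix P u l') x))
       = form R \<kappa> f f' x * form R \<kappa>' g g' x"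
proof -
  have k: "kerprod R \<kappa> q q' = of_bool (\<forall>i\<in>R. i \<notin> P \<longrightarrow> q i = q' i)" for q q'
  proof -
    have "kerprod R \<kappa> q q' = (\<Prod>i\<in>R. of_bool (i \<notin> P \<longrightarrow> q i = q' i))"
      unfolding kerprod_def
    proof (intro prod.cong refl)
      fix i assume "i \<in> R"
      then show "ker (\<kappa> i) (q i) (q' i) = of_bool (i \<notin> P \<longrightarrow> q i = q' i)"
        using assms(3,4)[of i] by (cases "i \<in> P") auto
    qed
    then show ?thesis using prod_of_bool[OF assms(1)] by simp
  qed
  have k': "kerprod R \<kappa>' s s' = of_bool (\<forall>i\<in>R. i \<in> P \<longrightarrow> s i = s' i)" for s s'
  proof -
    have "kerprod R \<kappa>' s s' = (\<Prod>i\<in>R. of_bool (i \<in> P \<longrightarrow> s i = s' i))"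
      unfolding kerprod_def
    proof (intro prod.cong refl)
      fix i assume "i \<in> R"
      then show "ker (\<kappa>' i) (s i) (s' i) = of_bool (i \<in> P \<longrightarrow> s i = s' i)"
        using assms(5,6)[of i] by (cases "i \<in> P") auto
    qed
    then show ?thesis using prod_of_bool[OF assms(1)] by simp
  qed
  let ?A = "box R"
  let ?C = "\<lambda>((q, q'), (s, s')). (\<forall>i\<in>R. i \<notin> P \<longrightarrow> q i = q' i) \<and> (\<forall>i\<in>R. i \<in> P \<longrightarrow> s i = s' i)"
  let ?h = "\<lambda>((q, q'), (s, s')). f q x * f' q' x * (g s x * g' s' x)"
  let ?Z = "{z \<in> (?A \<times> ?A) \<times> (?A \<times> ?A). ?C z}"
  have fin: "finite ((?A \<times> ?A) \<times> (?A \<times> ?A))" using finite_box[OF assms(1)] by simp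
  have agree1: "mix P q' q = q'" if "q \<in> ?A" "q' \<in> ?A" "\<forall>i\<in>R. i \<notin> P \<longrightarrow> q i = q' i" for q q'
  proof
    fix i show "mix P q' q i = q' i"
      using that by (cases "i \<in> R") (auto simp: mix_def box_def PiE_iff extensional_def)
  qed
  have agree2: "mix P s s' = s'" if "\<forall>i\<in>R. i \<in> P \<longrightarrow> s i = s' i" for s s' :: "nat \<Rightarrow> nat"
  proof
    fix i show "mix P s s' i = s' i" using that assms(2) by (cases "i \<in> P") auto
  qed
  have "form R \<kappa> f f' x * form R \<kappa>' g g' x
     = (\<Sum>z\<in>?A \<times> ?A. kerprod R \<kappa> (fst z) (snd z) * f (fst z) x * f' (snd z) x) *
       (\<Sum>z\<in>?A \<times> ?A. kerprod R \<kappa>' (fst z) (snd z) * g (fst z) x * g' (snd z) x)"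
    unfolding form_def by (simp add: sum.cartesian_product case_prod_unfold)
  also have "\<dots> = (\<Sum>w\<in>(?A \<times> ?A) \<times> (?A \<times> ?A).
       (kerprod R \<kappa> (fst (fst w)) (snd (fst w)) * f (fst (fst w)) x * f' (snd (fst w)) x) *
       (kerprod R \<kappa>' (fst (snd w)) (snd (snd w)) * g (fst (snd w)) x * g' (snd (snd w)) x))"
    by (simp add: sum_product sum.cartesian_product case_prod_unfold)
  also have "\<dots> = (\<Sum>w\<in>(?A \<times> ?A) \<times> (?A \<times> ?A). if ?C w then ?h w else 0)"
    by (intro sum.cong refl) (auto simp: k k' case_prod_unfold)
  also have "\<dots> = (\<Sum>w\<in>?Z. ?h w)"
    by (rule sum.inter_filter[symmetric, OF fin])
  also have "\<dots> = (\<Sum>(u, l, l')\<in>?A \<times> ?A \<times> ?A.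
      f (mix P l u) x * g (mix P u l) x * (f' (mix P l' u) x * g' (mix P u l') x))"
    by (rule sum.reindex_bij_witness[where i = "\<lambda>(u, l, l'). ((mix P l u, mix P l' u), (mix P u l, mix P u l'))"
          and j = "\<lambda>((q, q'), (s, s')). (mix P s q, mix P q s, mix P q' s')"])
       (auto simp: mix_box agree1 agree2 mult_ac)
  finally show ?thesis by (simp add: sum.cartesian_product)
qed

section \<open>Gain over the trivial bound\<close>

text \<open>The trivial bound for a form in \<open>n\<close> coordinates is \<open>m ^ n\<close>; the gain is the factor \<open>m powr (-1/4)\<close>.\<close>

definition D :: real where "D = 324 * p * real L ^ 2"

definition gain_bound :: "nat \<Rightarrow> nat \<Rightarrow> real" where
  "gain_bound k n = D ^ k * sqrt D * real m ^ n / sqrt (sqrt m)"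

lemma L_ge_real: "real L \<ge> 1" using L_pos by simp

lemma D_ge: "D \<ge> 324 * p" "D \<ge> 324"
proof -
  have "1 \<le> real L ^ 2" using L_ge_real by simp
  then show "D \<ge> 324 * p" using p_ge by (simp add: D_def)
  then show "D \<ge> 324" using p_ge by linarith
qed

text \<open>The statement proved by induction on the number \<open>k\<close> of free coordinates,
  named so that it can be handed as a hypothesis through the lemmas below. \<open>K\<close> bounds
  the number of coordinates uniformly, so one exponent \<open>r\<close> serves all index sets. The
  factor 2 leaves room for the diagonal \<open>q = q'\<close> beside the rest.\<close>

definition off_claim :: "nat \<Rightarrow> nat \<Rightarrow> nat \<Rightarrow> bool" where
  "off_claim K r k \<longleftrightarrow> (\<forall>S \<pi> f g c c'. finite S \<and> card S \<le> K \<and> (\<exists>i\<in>S. \<pi> i = Tied) \<and>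
     (\<forall>i\<in>S. \<pi> i = Tied \<or> \<pi> i = Free) \<and> card {i\<in>S. \<pi> i = Free} = k \<and>
     admissible S c f \<and> admissible S c' g \<and> c \<noteq> c' \<longrightarrow>
     small r (\<lambda>x. \<bar>form S \<pi> f g x\<bar> > 2 * gain_bound k (card S)))"

lemma off_claimD:
  assumes "off_claim K r k" "finite S" "card S \<le> K" "\<exists>i\<in>S. \<pi> i = Tied"
    "\<And>i. i \<in> S \<Longrightarrow> \<pi> i = Tied \<or> \<pi> i = Free" "card {i\<in>S. \<pi> i = Free} = k"
    "admissible S c f" "admissible S c' g" "c \<noteq> c'"
  shows "small r (\<lambda>x. \<bar>form S \<pi> f g x\<bar> > 2 * gain_bound k (card S))"
  by (rule assms(1)[unfolded off_claim_def, rule_format, of S \<pi> c f c' g])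
     (use assms(2-) in simp)

lemma kerprod_Tied:
  assumes "finite S" "\<And>i. i \<in> S \<Longrightarrow> \<pi> i = Tied" "q \<in> box S" "q' \<in> box S"
  shows "kerprod S \<pi> q q' = of_bool (q = q')"
proof -
  have "kerprod S \<pi> q q' = (\<Prod>i\<in>S. of_bool (q i = q' i))"
    unfolding kerprod_def using assms(2) by (intro prod.cong refl) auto
  also have "\<dots> = of_bool (\<forall>i\<in>S. q i = q' i)" by (rule prod_of_bool[OF assms(1)])
  also have "(\<forall>i\<in>S. q i = q' i) \<longleftrightarrow> q = q'"
    using assms(3,4) unfolding box_def by (auto intro: PiE_ext)
  finally show ?thesis .
qed

lemma form_Tied:
  assumes "finite S" "\<And>i. i \<in> S \<Longrightarrow> \<pi> i = Tied"
  shows "form S \<pi> f g x = (\<Sum>q\<in>box S. f q x * g q x)"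
proof -
  have "form S \<pi> f g x = (\<Sum>q\<in>box S. \<Sum>q'\<in>box S. if q = q' then f q x * g q' x else 0)"
    unfolding form_def by (intro sum.cong refl) (auto simp: kerprod_Tied[OF assms])
  then show ?thesis using finite_box[OF assms(1)] by simp
qed

text \<open>The free form is a product of two sums, so its square is the product of two free forms
  with equal arguments, each controlled by \<open>diagonal_bound\<close>. All of the saving
  \<open>m powr (-1/2)\<close> comes from the tied form through its offset
  \<open>e \<noteq> e'\<close>.\<close>

lemma free_tied_product:
  assumes "finite R" "R \<noteq> {}" "admissible R c F" "admissible R c' F'" "admissible R e G" "admissible R e' G'" "e \<noteq> e'"
    and "\<And>i. i \<in> R \<Longrightarrow> \<kappa> i = Free" "\<And>i. i \<in> R \<Longrightarrow> \<kappa>' i = Tied"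
  shows "small (3 * card R + 10) (\<lambda>x. \<bar>form R \<kappa> F F' x * form R \<kappa>' G G' x\<bar>
           > 4 * D ^ (card R + 1) * real m ^ (2 * card R) / sqrt m)"
proof -
  let ?k = "card R"
  let ?B = "2 * (4 * p * m) ^ ?k"
  have d: "small (3 * ?k + 5) (\<lambda>x. \<bar>form R \<kappa> f f x\<bar> > ?B)" if "admissible R c f" for c f
    using diagonal_bound[of "{}" R \<kappa> c f] assms(1,8) that by simp
  have t: "small ?k (\<lambda>x. \<bar>\<Sum>q\<in>box R. G q x * G' q x\<bar> > sqrt (2 * p * m) * real m ^ (?k - 1))"
    by (rule offset_tied_bound[OF assms(1,2,5,6,7)])
  show ?thesis
  proof (rule small_mono[OF small_disj[OF small_disj[OF d[OF assms(3)] d[OF assms(4)]] t]])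
    fix x
    assume big: "\<bar>form R \<kappa> F F' x * form R \<kappa>' G G' x\<bar> > 4 * D ^ (?k + 1) * real m ^ (2 * ?k) / sqrt m"
    show "(\<bar>form R \<kappa> F F x\<bar> > ?B \<or> \<bar>form R \<kappa> F' F' x\<bar> > ?B) \<or>
       \<bar>\<Sum>q\<in>box R. G q x * G' q x\<bar> > sqrt (2 * p * m) * real m ^ (?k - 1)"
    proof (rule ccontr)
      assume "\<not> ?thesis"
      then have h: "\<bar>form R \<kappa> F F x\<bar> \<le> ?B" "\<bar>form R \<kappa> F' F' x\<bar> \<le> ?B"
        "\<bar>form R \<kappa>' G G' x\<bar> \<le> sqrt (2 * p * m) * real m ^ (?k - 1)"
        using form_Tied[of R \<kappa>' G G' x] assms(1,9) by auto
      have B0: "?B \<ge> 0" using p_ge by simp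
      have sq: "(form R \<kappa> F F' x)\<^sup>2 = form R \<kappa> F F x * form R \<kappa> F' F' x"
        using form_Free[of R \<kappa>] assms(8) by (simp add: power2_eq_square)
      have "\<bar>form R \<kappa> F F x\<bar> * \<bar>form R \<kappa> F' F' x\<bar> \<le> ?B * ?B"
        using h B0 by (intro mult_mono) auto
      then have "(form R \<kappa> F F' x)\<^sup>2 \<le> ?B\<^sup>2"
        unfolding sq by (simp add: abs_mult[symmetric] power2_eq_square)
      then have hF: "\<bar>form R \<kappa> F F' x\<bar> \<le> ?B"
        using B0 power2_le_imp_le[of "\<bar>form R \<kappa> F F' x\<bar>" ?B] by (simp only: power2_abs)
      have k0: "?k \<noteq> 0" using assms(1,2) by simp
      have mk: "real m ^ ?k = real m * real m ^ (?k - 1)" using k0 by (metis power_eq_if)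
      have sm: "sqrt m > 0" "sqrt m * sqrt m = m" using m_ge by auto
      have sp: "sqrt (2 * p) \<le> D"
      proof -
        have "sqrt (2 * p) \<le> sqrt ((2 * p)\<^sup>2)"
          using p_ge by (intro real_sqrt_le_mono) (simp add: power2_eq_square)
        also have "\<dots> = 2 * p" using p_ge by (subst real_sqrt_abs) simp
        finally show ?thesis using D_ge p_ge by linarith
      qed
      have "\<bar>form R \<kappa> F F' x * form R \<kappa>' G G' x\<bar> \<le> ?B * (sqrt (2 * p * m) * real m ^ (?k - 1))"
        unfolding abs_mult using hF h(3) B0 by (intro mult_mono) auto
      also have "\<dots> = 2 * (4 * p) ^ ?k * sqrt (2 * p) * (real m ^ ?k * real m ^ ?k) / sqrt m"
      proof -
        have "sqrt m * real m ^ (?k - 1) = real m ^ ?k / sqrt m"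
          using sm unfolding mk by (simp add: field_simps)
        moreover have "?B * (sqrt (2 * p * m) * real m ^ (?k - 1))
            = 2 * (4 * p) ^ ?k * sqrt (2 * p) * (real m ^ ?k * (sqrt m * real m ^ (?k - 1)))"
          by (simp add: real_sqrt_mult power_mult_distrib mult_ac)
        ultimately show ?thesis by simp
      qed
      also have "\<dots> \<le> 2 * D ^ ?k * D * (real m ^ ?k * real m ^ ?k) / sqrt m"
        using sm sp D_ge p_ge by (intro divide_right_mono mult_mono power_mono) auto
      also have "\<dots> \<le> 4 * D ^ ?k * D * (real m ^ ?k * real m ^ ?k) / sqrt m"
        using sm D_ge p_ge by (intro divide_right_mono mult_right_mono) auto
      also have "\<dots> = 4 * D ^ (?k + 1) * real m ^ (2 * ?k) / sqrt m"
        by (simp add: mult_2 power_add)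
      finally show False using big by simp
    qed
  qed simp
qed

lemma offdiagonal_product:
  assumes R: "finite R" "R \<noteq> {}" "card R \<le> K" and P: "P \<subseteq> R"
    and F: "admissible R c F" "admissible R c' F'" "c \<noteq> c'" and G: "admissible R e G" "admissible R e' G'" "e \<noteq> e'"
    and \<kappa>: "\<And>i. i \<in> P \<Longrightarrow> \<kappa> i = Free" "\<And>i. i \<in> R - P \<Longrightarrow> \<kappa> i = Tied"
    and \<kappa>': "\<And>i. i \<in> P \<Longrightarrow> \<kappa>' i = Tied" "\<And>i. i \<in> R - P \<Longrightarrow> \<kappa>' i = Free"
    and IH: "\<And>k. k < card R \<Longrightarrow> off_claim K r k" and r: "3 * card R + 10 \<le> r"
  shows "small (Suc r) (\<lambda>x. \<bar>form R \<kappa> F F' x * form R \<kappa>' G G' x\<bar>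
           > 4 * D ^ (card R + 1) * real m ^ (2 * card R) / sqrt m)"
proof -
  consider "P = {}" | "P = R" | "P \<noteq> {}" "R - P \<noteq> {}" using P by auto
  then show ?thesis
  proof cases
    case 1
    have "small (3 * card R + 10) (\<lambda>x. \<bar>form R \<kappa>' G G' x * form R \<kappa> F F' x\<bar>
           > 4 * D ^ (card R + 1) * real m ^ (2 * card R) / sqrt m)"
      using 1 \<kappa> \<kappa>' by (intro free_tied_product[OF R(1,2) G(1,2) F]) auto
    then show ?thesis by (rule small_mono) (use r in \<open>auto simp: mult.commute\<close>)
  next
    case 2
    have "small (3 * card R + 10) (\<lambda>x. \<bar>form R \<kappa> F F' x * form R \<kappa>' G G' x\<bar>
           > 4 * D ^ (card R + 1) * real m ^ (2 * card R) / sqrt m)"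
      using 2 \<kappa> \<kappa>' by (intro free_tied_product[OF R(1,2) F(1,2) G]) auto
    then show ?thesis by (rule small_lift) (use r in auto)
  next
    case 3
    have finP: "finite P" using P R(1) finite_subset by blast
    have cards: "card P + card (R - P) = card R"
      using P R(1) finP by (metis card_Diff_subset card_mono le_add_diff_inverse)
    have pos: "card P > 0" "card (R - P) > 0" using 3 finP R(1) by (auto simp: card_gt_0_iff)
    have e1: "{i \<in> R. \<kappa> i = Free} = P" 
    proof (intro set_eqI iffI)
      fix i assume "i \<in> {i \<in> R. \<kappa> i = Free}"
      then show "i \<in> P" using \<kappa>(2)[of i] by (cases "i \<in> P") auto
    qed (use \<kappa>(1) P in auto)
    have e2: "{i \<in> R. \<kappa>' i = Free} = R - P" 
    proof (intro set_eqI iffI)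
      fix i assume "i \<in> {i \<in> R. \<kappa>' i = Free}"
      then show "i \<in> R - P" using \<kappa>'(1)[of i] by (cases "i \<in> P") auto
    qed (use \<kappa>'(2) in auto)
    have tf: "\<kappa> i = Tied \<or> \<kappa> i = Free" "\<kappa>' i = Tied \<or> \<kappa>' i = Free" if "i \<in> R" for i
      using that \<kappa>[of i] \<kappa>'[of i] by (cases "i \<in> P"; simp)+
    \<comment> \<open>Here both forms keep a tied coordinate and have fewer free coordinates than
      \<open>card R\<close>, so the induction hypothesis applies to each; the two gains multiply to
      \<open>1 / sqrt m\<close>.\<close>
    have A: "small r (\<lambda>x. \<bar>form R \<kappa> F F' x\<bar> > 2 * gain_bound (card P) (card R))"
      using cards pos 3 \<kappa>(2) by (intro off_claimD[OF IH R(1,3) _ tf(1) _ F]) (auto simp: e1)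
    have B: "small r (\<lambda>x. \<bar>form R \<kappa>' G G' x\<bar> > 2 * gain_bound (card (R - P)) (card R))"
      using cards pos 3 \<kappa>'(1) P by (intro off_claimD[OF IH R(1,3) _ tf(2) _ G]) (auto simp: e2)
    show ?thesis
    proof (rule small_mono[OF small_disj[OF A B]])
      fix x
      assume big: "\<bar>form R \<kappa> F F' x * form R \<kappa>' G G' x\<bar> > 4 * D ^ (card R + 1) * real m ^ (2 * card R) / sqrt m"
      show "\<bar>form R \<kappa> F F' x\<bar> > 2 * gain_bound (card P) (card R) \<or> \<bar>form R \<kappa>' G G' x\<bar> > 2 * gain_bound (card (R - P)) (card R)"
      proof (rule ccontr)
        assume "\<not> ?thesis"
        then have "\<bar>form R \<kappa> F F' x\<bar> * \<bar>form R \<kappa>' G G' x\<bar>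
            \<le> (2 * gain_bound (card P) (card R)) * (2 * gain_bound (card (R - P)) (card R))"
          by (intro mult_mono) auto
        also have "\<dots> = 4 * (D ^ card P * D ^ card (R - P)) * (sqrt D * sqrt D)
             * (real m ^ card R * real m ^ card R) / (sqrt (sqrt m) * sqrt (sqrt m))"
          by (simp add: gain_bound_def mult_ac)
        also have "\<dots> = 4 * D ^ (card R + 1) * real m ^ (2 * card R) / sqrt m"
          using D_ge(2) by (simp add: power_add[symmetric] cards mult_2 mult_2_right mult_ac)
        finally show False using big by (simp add: abs_mult)
      qed
    qed simp
  qed
qed

text \<open>The summands with given maxima \<open>u\<close> are martingale differences in every coordinate of \<open>R\<close>. After the
  constraint \<open>l < u\<close> has been decoupled, their square function is a double sum over the tied
  coordinate of products of two forms. For \<open>t \<noteq> t'\<close> both factors are of the same type with fewer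
  free coordinates, so each contributes half of the gain, unless one of them has none, in which case
  the other is completely tied and gains \<open>m powr (-1/2)\<close>.\<close>

lemma separated_bound:
  assumes R: "finite R" "R \<noteq> {}" "card R \<le> K" and P: "P \<subseteq> R" and \<tau>: "\<tau> \<notin> R" "\<pi> \<tau> = Tied"
    and \<pi>: "\<And>i. i \<in> P \<Longrightarrow> \<pi> i = Below" "\<And>i. i \<in> R - P \<Longrightarrow> \<pi> i = Above"
    and f: "admissible (insert \<tau> R) c f" and g: "admissible (insert \<tau> R) c' g"
    and IH: "\<And>k. k < card R \<Longrightarrow> off_claim K r k" and r: "5 * card R + 10 \<le> r"
  shows "small (r + card R + 10) (\<lambda>x. \<bar>form (insert \<tau> R) \<pi> f g x\<bar> > gain_bound (card R) (card R + 1) / 3 ^ card R)"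
proof -
  define k where "k = card R"
  define f' where "f' t = freeze \<tau> t f" for t
  define g' where "g' t = freeze \<tau> t g" for t
  have cm: "m \<le> c" "m \<le> c'" using f g R(1) \<tau>(1) by (auto simp: admissible_def)
  have f': "admissible R (c - t) (f' t)" if "t < m" for t
    unfolding f'_def using R(1) \<tau>(1) f that by (rule admissible_freeze)
  have g': "admissible R (c' - t) (g' t)" if "t < m" for t
    unfolding g'_def using R(1) \<tau>(1) g that by (rule admissible_freeze)
  show ?thesis
  proof (rule multi_less_decomposition[OF R(1)])
    fix J :: "(nat \<Rightarrow> nat) set" and cc :: "(nat \<Rightarrow> nat) \<Rightarrow> real"
      and G H :: "(nat \<Rightarrow> nat) \<Rightarrow> (nat \<Rightarrow> nat) \<Rightarrow> nat \<Rightarrow> real"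
    assume J: "finite J" "card J \<le> m ^ card R" "\<And>j. j \<in> J \<Longrightarrow> cc j \<ge> 0"
        "(\<Sum>j\<in>J. cc j) = real L ^ card R"
      and GH: "\<And>j l i. j \<in> J \<Longrightarrow> i \<in> R \<Longrightarrow> \<bar>G j l i\<bar> \<le> 1" "\<And>j u i. j \<in> J \<Longrightarrow> i \<in> R \<Longrightarrow> \<bar>H j u i\<bar> \<le> 1"
        "\<And>j l l' i. l i = l' i \<Longrightarrow> G j l i = G j l' i"
      and dec: "\<And>l u. l \<in> box R \<Longrightarrow> u \<in> box R \<Longrightarrow>
         of_bool (\<forall>i\<in>R. l i < u i) = (\<Sum>j\<in>J. cc j * (\<Prod>i\<in>R. G j l i) * (\<Prod>i\<in>R. H j u i))"
    define X where "X u x = (\<Sum>t<m. \<Sum>l\<in>box R. of_bool (\<forall>i\<in>R. l i < u i) * (f' t (mix P l u) x * g' t (mix P u l) x))"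
      for u x
    \<comment> \<open>The factors of the decoupled constraint are distributed so that each is
      evaluated where \<open>l\<close> occurs: on \<open>P\<close> in the argument of
      \<open>f'\<close>, off \<open>P\<close> in the argument of \<open>g'\<close>. Being bounded by
      1, they preserve admissibility.\<close>
    define F where "F j t = (\<lambda>q x. (\<Prod>i\<in>P. G j q i) * f' t q x)" for j t
    define E where "E j t = (\<lambda>q x. (\<Prod>i\<in>R - P. G j q i) * g' t q x)" for j t
    define Z where "Z j u x = (\<Sum>t<m. \<Sum>l\<in>box R. F j t (mix P l u) x * E j t (mix P u l) x)" for j u x
    define \<kappa> where "\<kappa> i = (if i \<in> P then Free else Tied)" for i
    define \<kappa>' where "\<kappa>' i = (if i \<in> P then Tied else Free)" for i
    define \<beta> where "\<beta> = 4 * D ^ (k + 1) * real m ^ (2 * k) / sqrt m"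
    define \<beta>' where "\<beta>' = 4 * (4 * p) ^ k * real m ^ (2 * k)"
    have prod_le: "\<bar>\<Prod>i\<in>A. G j q i\<bar> \<le> 1" if "j \<in> J" "A \<subseteq> R" for j A q
      unfolding abs_prod using GH(1) that by (intro prod_le_1) auto
    have F: "admissible R (c - t) (F j t)" if "j \<in> J" "t < m" for j t
      unfolding F_def using that prod_le P by (intro admissible_scale f') auto
    have E: "admissible R (c' - t) (E j t)" if "j \<in> J" "t < m" for j t
      unfolding E_def using that prod_le P by (intro admissible_scale g') auto
    have form_eq: "form (insert \<tau> R) \<pi> f g x = (\<Sum>u\<in>box R. X u x)" for x
    proof -
      have "form (insert \<tau> R) \<pi> f g x = (\<Sum>t<m. form R \<pi> (f' t) (g' t) x)"
        unfolding f'_def g'_def by (rule form_insert_Tied[of R \<tau> \<pi>, OF R(1) \<tau>])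
      also have "\<dots> = (\<Sum>t<m. \<Sum>u\<in>box R. \<Sum>l\<in>box R.
          of_bool (\<forall>i\<in>R. l i < u i) * (f' t (mix P l u) x * g' t (mix P u l) x))"
        by (intro sum.cong refl form_ordered[OF R(1) P] \<pi>)
      also have "\<dots> = (\<Sum>u\<in>box R. X u x)" unfolding X_def by (rule sum.swap)
      finally show ?thesis .
    qed
    \<comment> \<open>In coordinate \<open>i\<close> the strictly larger exponent \<open>u i\<close>
      belongs to exactly one of the two factors, and \<open>l i < u i\<close> makes the other one
      predictable.\<close>
    have Xmd: "martingale_diff i (u i) (X u)" if u: "u \<in> box R" and i: "i \<in> R" for u i
      unfolding X_def
    proof (intro martingale_diff_sum)
      fix t l assume t: "t \<in> {..<m}" and l: "l \<in> box R"
      show "martingale_diff i (u i) (\<lambda>x. of_bool (\<forall>i\<in>R. l i < u i) * (f' t (mix P l u) x * g' t (mix P u l) x))"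
      proof (cases "\<forall>i\<in>R. l i < u i")
        case True
        have a: "martingale_diff i (mix P l u i) (f' t (mix P l u))" using f'[of t] t u l i by (intro admissible_md mix_box) auto
        have b: "martingale_diff i (mix P u l i) (g' t (mix P u l))" using g'[of t] t u l i by (intro admissible_md mix_box) auto
        have "martingale_diff i (u i) (\<lambda>x. f' t (mix P l u) x * g' t (mix P u l) x)"
        proof (cases "i \<in> P")
          case T: True
          have "inv_from i (u i) (f' t (mix P l u))"
            by (rule martingale_diff_imp_inv_from[OF a]) (use T True i in simp)
          from martingale_diff_mult_inv[OF this b[unfolded mix_in[OF T]]] show ?thesis .
        next
          case T: False
          have "inv_from i (u i) (g' t (mix P u l))"
            by (rule martingale_diff_imp_inv_from[OF b]) (use T True i in simp)
          from martingale_diff_mult_inv[OF this a[unfolded mix_notin[OF T]]] show ?thesis by (simp add: mult.commute)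
        qed
        then show ?thesis by (rule martingale_diff_cmult)
      next
        case False
        then have e: "(\<forall>i\<in>R. l i < u i) = False" by simp
        show ?thesis unfolding e by (simp add: martingale_diff_def)
      qed
    qed
    have Xle: "\<bar>X u x\<bar> \<le> real m ^ (k + 1)" if u: "u \<in> box R" and x: "x \<in> \<Omega>" for u x
    proof -
      have 1: "\<bar>of_bool (\<forall>i\<in>R. l i < u i) * (f' t (mix P l u) x * g' t (mix P u l) x)\<bar> \<le> 1"
        if "t < m" "l \<in> box R" for t l
        using admissible_le[OF f'[OF that(1)] mix_box[OF that(2) u] x] admissible_le[OF g'[OF that(1)] mix_box[OF u that(2)] x]
        by (simp add: abs_mult mult_le_one)
      have "\<bar>X u x\<bar> \<le> (\<Sum>t<m. \<bar>\<Sum>l\<in>box R. of_bool (\<forall>i\<in>R. l i < u i) * (f' t (mix P l u) x * g' t (mix P u l) x)\<bar>)"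
        unfolding X_def by (rule sum_abs)
      also have "\<dots> \<le> (\<Sum>t<m. \<Sum>l\<in>box R. \<bar>of_bool (\<forall>i\<in>R. l i < u i) * (f' t (mix P l u) x * g' t (mix P u l) x)\<bar>)"
        by (intro sum_mono sum_abs)
      also have "\<dots> \<le> (\<Sum>t<m. \<Sum>l\<in>box R. 1)" using 1 by (intro sum_mono) auto
      also have "\<dots> = real m ^ (k + 1)" using card_box[OF R(1)] by (simp add: k_def)
      finally show ?thesis .
    qed
    have s1: "small (5 * k + 7) (\<lambda>x. (\<Sum>u\<in>box R. X u x)\<^sup>2 >
             (4 * p) ^ k * ((\<Sum>u\<in>box R. (X u x)\<^sup>2) + real m ^ k - 1))"
    proof -
      have "small (3 * card R + 2 * (k + 1) + 5) (\<lambda>x. (\<Sum>u\<in>box R. X u x)\<^sup>2 >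
             (4 * p) ^ card R * ((\<Sum>u\<in>box R. (X u x)\<^sup>2) + real m ^ card R - 1))"
        by (rule multi_azuma[OF R(1) Xmd Xle])
      then show ?thesis by (rule small_mono) (auto simp: k_def)
    qed
    have ZX: "X u x = (\<Sum>j\<in>J. cc j * ((\<Prod>i\<in>R. H j u i) * Z j u x))" if u: "u \<in> box R" for u x
    proof -
      have "X u x = (\<Sum>t<m. \<Sum>l\<in>box R. \<Sum>j\<in>J. cc j * ((\<Prod>i\<in>R. H j u i) *
          (F j t (mix P l u) x * E j t (mix P u l) x)))"
        unfolding X_def
      proof (intro sum.cong refl)
        fix t l assume l: "l \<in> box R"
        have G: "(\<Prod>i\<in>R. G j l i) = (\<Prod>i\<in>P. G j (mix P l u) i) * (\<Prod>i\<in>R - P. G j (mix P u l) i)" for j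
        proof -
          have "(\<Prod>i\<in>P. G j (mix P l u) i) = (\<Prod>i\<in>P. G j l i)"
            by (intro prod.cong refl GH(3)) simp
          moreover have "(\<Prod>i\<in>R - P. G j (mix P u l) i) = (\<Prod>i\<in>R - P. G j l i)"
            by (intro prod.cong refl GH(3)) simp
          ultimately show ?thesis using prod.subset_diff[OF P R(1)] by (simp add: mult.commute)
        qed
        show "of_bool (\<forall>i\<in>R. l i < u i) * (f' t (mix P l u) x * g' t (mix P u l) x) =
          (\<Sum>j\<in>J. cc j * ((\<Prod>i\<in>R. H j u i) * (F j t (mix P l u) x * E j t (mix P u l) x)))"
          unfolding dec[OF l u] sum_distrib_right G F_def E_def by (intro sum.cong refl) (simp add: mult_ac)
      qed
      also have "\<dots> = (\<Sum>t<m. \<Sum>j\<in>J. \<Sum>l\<in>box R. cc j * ((\<Prod>i\<in>R. H j u i) *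
          (F j t (mix P l u) x * E j t (mix P u l) x)))"
        by (intro sum.cong refl sum.swap)
      also have "\<dots> = (\<Sum>j\<in>J. \<Sum>t<m. \<Sum>l\<in>box R. cc j * ((\<Prod>i\<in>R. H j u i) *
          (F j t (mix P l u) x * E j t (mix P u l) x)))"
        by (rule sum.swap)
      also have "\<dots> = (\<Sum>j\<in>J. cc j * ((\<Prod>i\<in>R. H j u i) * Z j u x))"
        unfolding Z_def by (simp add: sum_distrib_left)
      finally show ?thesis .
    qed
    have X2: "(\<Sum>u\<in>box R. (X u x)\<^sup>2) \<le> real L ^ k * (\<Sum>j\<in>J. cc j * (\<Sum>u\<in>box R. (Z j u x)\<^sup>2))" for x
    proof -
      have "(X u x)\<^sup>2 \<le> real L ^ k * (\<Sum>j\<in>J. cc j * (Z j u x)\<^sup>2)" if u: "u \<in> box R" for u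
      proof -
        have "(X u x)\<^sup>2 \<le> real L ^ k * (\<Sum>j\<in>J. cc j * ((\<Prod>i\<in>R. H j u i) * Z j u x)\<^sup>2)"
          unfolding ZX[OF u] k_def J(4)[symmetric] by (rule sum_square_weighted_le[OF J(3)])
        also have "\<dots> \<le> real L ^ k * (\<Sum>j\<in>J. cc j * (Z j u x)\<^sup>2)"
        proof (intro mult_left_mono sum_mono)
          fix j assume j: "j \<in> J"
          have "\<bar>\<Prod>i\<in>R. H j u i\<bar> \<le> 1" unfolding abs_prod using GH(2) j by (intro prod_le_1) auto
          then have "(\<Prod>i\<in>R. H j u i)\<^sup>2 \<le> 1" by (simp add: abs_square_le_1)
          then show "((\<Prod>i\<in>R. H j u i) * Z j u x)\<^sup>2 \<le> (Z j u x)\<^sup>2"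
            unfolding power_mult_distrib by (rule mult_left_le_one_le[rotated 2]) auto
        qed (use J(3) in auto)
        finally show ?thesis .
      qed
      then have "(\<Sum>u\<in>box R. (X u x)\<^sup>2) \<le> (\<Sum>u\<in>box R. real L ^ k * (\<Sum>j\<in>J. cc j * (Z j u x)\<^sup>2))"
        by (rule sum_mono)
      also have "\<dots> = real L ^ k * (\<Sum>j\<in>J. cc j * (\<Sum>u\<in>box R. (Z j u x)\<^sup>2))"
        unfolding sum_distrib_left by (subst sum.swap) (simp add: mult_ac)
      finally show ?thesis .
    qed
    have Z2: "(\<Sum>u\<in>box R. (Z j u x)\<^sup>2) = (\<Sum>t<m. \<Sum>t'<m. form R \<kappa> (F j t) (F j t') x * form R \<kappa>' (E j t) (E j t') x)"
      for j x
    proof -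
      have "(\<Sum>u\<in>box R. (Z j u x)\<^sup>2) = (\<Sum>u\<in>box R. \<Sum>t<m. \<Sum>t'<m. \<Sum>l\<in>box R. \<Sum>l'\<in>box R.
         F j t (mix P l u) x * E j t (mix P u l) x * (F j t' (mix P l' u) x * E j t' (mix P u l') x))"
        unfolding Z_def power2_eq_square sum_product by (intro sum.cong refl)
      also have "\<dots> = (\<Sum>t<m. \<Sum>u\<in>box R. \<Sum>t'<m. \<Sum>l\<in>box R. \<Sum>l'\<in>box R.
         F j t (mix P l u) x * E j t (mix P u l) x * (F j t' (mix P l' u) x * E j t' (mix P u l') x))"
        by (rule sum.swap)
      also have "\<dots> = (\<Sum>t<m. \<Sum>t'<m. \<Sum>u\<in>box R. \<Sum>l\<in>box R. \<Sum>l'\<in>box R.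
         F j t (mix P l u) x * E j t (mix P u l) x * (F j t' (mix P l' u) x * E j t' (mix P u l') x))"
        by (intro sum.cong refl sum.swap)
      also have "\<dots> = (\<Sum>t<m. \<Sum>t'<m. form R \<kappa> (F j t) (F j t') x * form R \<kappa>' (E j t) (E j t') x)"
        by (intro sum.cong refl form_product[OF R(1) P]) (auto simp: \<kappa>_def \<kappa>'_def)
      finally show ?thesis .
    qed
    define b where "b t t' = (if t = t' then \<beta>' else \<beta>)" for t t' :: nat
    let ?bad = "\<lambda>j t t' x. \<bar>form R \<kappa> (F j t) (F j t') x * form R \<kappa>' (E j t) (E j t') x\<bar> > b t t'"
    have sp: "small (Suc r) (?bad j t t')" if j: "j \<in> J" and t: "t < m" "t' < m" for j t t'
    proof (cases "t = t'")
      case False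
      \<comment> \<open>The offsets needed for the induction hypothesis: the tied coordinate is
        frozen at two different values, and \<open>m\<close> being at most \<open>c\<close> and
        \<open>c'\<close> prevents truncation.\<close>
      then have ne: "c - t \<noteq> c - t'" "c' - t \<noteq> c' - t'" using t cm by auto
      have "small (Suc r) (\<lambda>x. \<bar>form R \<kappa> (F j t) (F j t') x * form R \<kappa>' (E j t) (E j t') x\<bar>
             > 4 * D ^ (card R + 1) * real m ^ (2 * card R) / sqrt m)"
        by (rule offdiagonal_product[OF R P F[OF j t(1)] F[OF j t(2)] ne(1) E[OF j t(1)] E[OF j t(2)] ne(2)
              _ _ _ _ IH]) (use r in \<open>auto simp: \<kappa>_def \<kappa>'_def\<close>)
      then show ?thesis using False by (simp add: b_def \<beta>_def k_def)
    next
      case True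
      have finP: "finite P" using P R(1) finite_subset by blast
      have cards: "card P + card (R - P) = k"
        using P R(1) finP unfolding k_def by (metis card_Diff_subset card_mono le_add_diff_inverse)
      have RP: "(R - P) \<union> P = R" "P \<union> (R - P) = R" using P by auto
      have A: "small (3 * card P + 5 + card (R - P)) (\<lambda>x. \<bar>form R \<kappa> (F j t) (F j t) x\<bar>
          > 2 * real m ^ card (R - P) * (4 * p * m) ^ card P)"
        using diagonal_bound[of "R - P" P \<kappa> "c - t" "F j t"] F[OF j t(1)] R(1) finP RP
        by (auto simp: \<kappa>_def)
      have B: "small (3 * card (R - P) + 5 + card P) (\<lambda>x. \<bar>form R \<kappa>' (E j t) (E j t) x\<bar>
          > 2 * real m ^ card P * (4 * p * m) ^ card (R - P))"
        using diagonal_bound[of P "R - P" \<kappa>' "c' - t" "E j t"] E[OF j t(1)] R(1) finP RP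
        by (auto simp: \<kappa>'_def)
      show ?thesis
      proof (rule small_mono[OF small_disj[OF A B]])
        fix x assume big: "?bad j t t' x"
        show "\<bar>form R \<kappa> (F j t) (F j t) x\<bar> > 2 * real m ^ card (R - P) * (4 * p * m) ^ card P \<or>
          \<bar>form R \<kappa>' (E j t) (E j t) x\<bar> > 2 * real m ^ card P * (4 * p * m) ^ card (R - P)"
        proof (rule ccontr)
          assume "\<not> ?thesis"
          then have "\<bar>form R \<kappa> (F j t) (F j t) x\<bar> * \<bar>form R \<kappa>' (E j t) (E j t) x\<bar> \<le>
             (2 * real m ^ card (R - P) * (4 * p * m) ^ card P) * (2 * real m ^ card P * (4 * p * m) ^ card (R - P))"
            using p_ge by (intro mult_mono) auto
          also have "\<dots> = 4 * (real m ^ card P * real m ^ card (R - P)) * ((4 * p) ^ card P * (4 * p) ^ card (R - P))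
              * (real m ^ card P * real m ^ card (R - P))"
            by (simp add: power_mult_distrib mult_ac)
          also have "\<dots> = \<beta>'"
            unfolding power_add[symmetric] cards \<beta>'_def by (simp add: mult_2 mult_2_right power_add mult_ac)
          finally show False using big True by (simp add: abs_mult b_def)
        qed
      qed (use cards r k_def in auto)
    qed
    have s2: "small (Suc r + 1 + 1 + k) (\<lambda>x. \<exists>j\<in>J. \<exists>t\<in>{..<m}. \<exists>t'\<in>{..<m}. ?bad j t t' x)"
      using J(1,2) sp by (intro small_UN) (auto simp: k_def)
    show "small (r + card R + 10) (\<lambda>x. \<bar>form (insert \<tau> R) \<pi> f g x\<bar> > gain_bound (card R) (card R + 1) / 3 ^ card R)"
    proof (rule small_mono[OF small_disj[OF s1 s2]])
      fix x assume big: "\<bar>form (insert \<tau> R) \<pi> f g x\<bar> > gain_bound (card R) (card R + 1) / 3 ^ card R"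
      show "(\<Sum>u\<in>box R. X u x)\<^sup>2 > (4 * p) ^ k * ((\<Sum>u\<in>box R. (X u x)\<^sup>2) + real m ^ k - 1) \<or>
         (\<exists>j\<in>J. \<exists>t\<in>{..<m}. \<exists>t'\<in>{..<m}. ?bad j t t' x)"
      proof (rule ccontr)
        assume "\<not> ?thesis"
        then have h1: "(\<Sum>u\<in>box R. X u x)\<^sup>2 \<le> (4 * p) ^ k * ((\<Sum>u\<in>box R. (X u x)\<^sup>2) + real m ^ k - 1)"
          and h2: "\<And>j t t'. j \<in> J \<Longrightarrow> t < m \<Longrightarrow> t' < m \<Longrightarrow>
            form R \<kappa> (F j t) (F j t') x * form R \<kappa>' (E j t) (E j t') x \<le> b t t'"
          by (auto simp: not_less)
             (meson abs_le_D1 lessThan_iff not_le)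
        define W where "W = D ^ (k + 1) * real m ^ (2 * k + 2) / sqrt m"
        have D1: "D \<ge> 1" using D_ge by simp
        have m1: "real m \<ge> 1" using m_ge by simp
        have sm: "sqrt m \<ge> 1" "sqrt m \<le> m" "sqrt m * sqrt m = m"
          using m_ge real_sqrt_le_mono[of "real m" "(real m)\<^sup>2"] by (auto simp: power2_eq_square)
        have Zb: "(\<Sum>u\<in>box R. (Z j u x)\<^sup>2) \<le> 8 * W" if j: "j \<in> J" for j
        proof -
          have row: "(\<Sum>t'<m. b t t') \<le> 8 * D ^ (k + 1) * real m ^ (2 * k + 1) / sqrt m" if "t < m" for t
          proof -
            have b0: "\<beta> \<ge> 0" using D1 by (simp add: \<beta>_def)
            have "(\<Sum>t'<m. b t t') \<le> (\<Sum>t'<m. (if t = t' then \<beta>' else 0) + \<beta>)"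
              using b0 by (intro sum_mono) (auto simp: b_def)
            also have "\<dots> = \<beta>' + real m * \<beta>" using that by (simp add: sum.distrib)
            also have "real m * \<beta> = 4 * D ^ (k + 1) * real m ^ (2 * k + 1) / sqrt m"
              by (simp add: \<beta>_def)
            \<comment> \<open>The term \<open>t' = t\<close> has no gain, but it is one out of
              \<open>m\<close> in the row, and a spare factor \<open>m\<close> exceeds the required
              \<open>sqrt m\<close>.\<close>
            also have "\<beta>' \<le> 4 * D ^ (k + 1) * real m ^ (2 * k + 1) / sqrt m"
            proof -
              have "(4 * p) ^ k \<le> D ^ k" using D_ge p_ge by (intro power_mono) auto
              also have "\<dots> \<le> D ^ (k + 1)" using D1 by (intro power_increasing) auto
              finally have a: "(4 * p) ^ k \<le> D ^ (k + 1)" .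
              have "real m ^ (2 * k) * sqrt m \<le> real m ^ (2 * k) * real m"
                using sm m1 by (intro mult_left_mono) auto
              then have "real m ^ (2 * k) \<le> real m ^ (2 * k + 1) / sqrt m"
                using sm by (simp add: pos_le_divide_eq mult_ac)
              with a have "(4 * p) ^ k * real m ^ (2 * k) \<le> D ^ (k + 1) * (real m ^ (2 * k + 1) / sqrt m)"
                using D1 by (intro mult_mono) auto
              then have "4 * ((4 * p) ^ k * real m ^ (2 * k)) \<le> 4 * (D ^ (k + 1) * (real m ^ (2 * k + 1) / sqrt m))"
                by (intro mult_left_mono) auto
              then show ?thesis unfolding \<beta>'_def by (simp only: mult.assoc times_divide_eq_right)
            qed
            finally show ?thesis by (simp add: mult_ac)
          qed
          have "(\<Sum>u\<in>box R. (Z j u x)\<^sup>2) \<le> (\<Sum>t<m. \<Sum>t'<m. b t t')"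
            unfolding Z2 using h2 j by (intro sum_mono) auto
          also have "\<dots> \<le> (\<Sum>t<m. 8 * D ^ (k + 1) * real m ^ (2 * k + 1) / sqrt m)"
            using row by (intro sum_mono) auto
          also have "\<dots> = 8 * W" by (simp add: W_def)
          finally show ?thesis .
        qed
        have W0: "W \<ge> 0" using D1 by (simp add: W_def)
        have Lk: "1 \<le> real L ^ k" using L_ge_real by (rule one_le_power)
        have "(\<Sum>u\<in>box R. (X u x)\<^sup>2) \<le> real L ^ k * (\<Sum>j\<in>J. cc j * (\<Sum>u\<in>box R. (Z j u x)\<^sup>2))"
          by (rule X2)
        also have "\<dots> \<le> real L ^ k * (\<Sum>j\<in>J. cc j * (8 * W))"
          using Zb J(3) by (intro mult_left_mono sum_mono) auto
        also have "\<dots> = real L ^ k * real L ^ k * (8 * W)"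
          unfolding sum_distrib_right[symmetric] J(4) k_def by (simp only: mult.assoc)
        finally have x1: "(\<Sum>u\<in>box R. (X u x)\<^sup>2) \<le> real L ^ k * real L ^ k * (8 * W)" .
        have mW: "real m ^ k \<le> W"
        proof -
          have "real m ^ k * sqrt m \<le> real m ^ k * real m"
            using sm m1 by (intro mult_left_mono) auto
          also have "\<dots> = real m ^ (k + 1)" by simp
          also have "\<dots> \<le> real m ^ (2 * k + 2)" using m1 by (intro power_increasing) auto
          also have "\<dots> \<le> D ^ (k + 1) * real m ^ (2 * k + 2)"
            using mult_right_mono[OF one_le_power[OF D1, of "k + 1"], of "real m ^ (2 * k + 2)"] by simp
          finally show ?thesis using sm by (simp add: W_def pos_le_divide_eq)
        qed
        also have "W \<le> real L ^ k * real L ^ k * W"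
          using mult_right_mono[OF mult_mono[OF Lk Lk], of W] W0 by simp
        finally have "(\<Sum>u\<in>box R. (X u x)\<^sup>2) + real m ^ k - 1 \<le> 9 * (real L ^ k * real L ^ k * W)"
          using x1 by simp
        then have "(4 * p) ^ k * ((\<Sum>u\<in>box R. (X u x)\<^sup>2) + real m ^ k - 1)
            \<le> (4 * p) ^ k * (9 * (real L ^ k * real L ^ k * W))"
          using p_ge by (intro mult_left_mono) auto
        also have "\<dots> = 9 * (4 * p * real L ^ 2) ^ k * W"
          by (simp add: power_mult_distrib power2_eq_square mult_ac)
        also have "\<dots> \<le> (9 * (4 * p * real L ^ 2)) ^ k * W"
        proof -
          have "k \<noteq> 0" using R by (simp add: k_def)
          then have "(9::real) \<le> 9 ^ k" using power_increasing[of 1 k "9::real"] by simp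
          then show ?thesis unfolding power_mult_distrib[of 9] using W0 p_ge
            by (intro mult_right_mono) auto
        qed
        \<comment> \<open>Origin of 324 = 4 * 9 * 9 in \<open>D\<close>: the 4 is that of
          \<open>multi_azuma\<close>; one 9 is 8 + 1, for the square function and the additive term;
          the other 9 becomes \<open>3 ^ k\<close> after the square root and pays for splitting free
          coordinates into three cases.\<close>
        also have "9 * (4 * p * real L ^ 2) = D / 9" by (simp add: D_def)
        finally have "(form (insert \<tau> R) \<pi> f g x)\<^sup>2 \<le> (D / 9) ^ k * W"
          using h1 unfolding form_eq by simp
        \<comment> \<open>The powers of \<open>D\<close> are self-consistent: two bounds whose free
          coordinates number \<open>k\<close> together contribute
          \<open>D ^ k * (sqrt D)\<^sup>2 = D ^ (k + 1)\<close>, the present step adds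
          \<open>D ^ k\<close>, and the root of the product is \<open>D ^ k * sqrt D\<close>
          again.\<close>
        also have "\<dots> = (gain_bound k (k + 1) / 3 ^ k)\<^sup>2"
        proof -
          have "(gain_bound k (k + 1) / 3 ^ k)\<^sup>2 = (D ^ k)\<^sup>2 * (sqrt D)\<^sup>2 * (real m ^ (k + 1))\<^sup>2 / (sqrt (sqrt m))\<^sup>2 / (3 ^ k)\<^sup>2"
            by (simp add: gain_bound_def power_mult_distrib power_divide)
          also have "(3 ^ k)\<^sup>2 = (9::real) ^ k" by (simp add: power2_eq_square flip: power_mult_distrib)
          also have "(sqrt D)\<^sup>2 = D" using D1 by simp
          also have "(sqrt (sqrt m))\<^sup>2 = sqrt m" by simp
          also have "(real m ^ (k + 1))\<^sup>2 = real m ^ (2 * k + 2)"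
            unfolding power_mult[symmetric] by (rule arg_cong[where f = "power (real m)"]) simp
          finally show ?thesis by (simp add: W_def power_divide power2_eq_square mult_ac)
        qed
        finally have "\<bar>form (insert \<tau> R) \<pi> f g x\<bar> \<le> gain_bound k (k + 1) / 3 ^ k"
          using D1 by (simp add: abs_le_square_iff[symmetric] gain_bound_def)
        then show False using big by (simp add: k_def)
      qed
    qed (use r in \<open>auto simp: k_def\<close>)
  qed
qed

section \<open>Reduction of free coordinates to tied and strictly ordered ones\<close>

lemma gain_bound_nonneg: "gain_bound k n \<ge> 0"
  using D_ge by (simp add: gain_bound_def)

lemma gain_bound_Suc: "gain_bound k (Suc n) = real m * gain_bound k n"
  by (simp add: gain_bound_def)

text \<open>A single tied coordinate already yields the gain; the others are frozen and summed
  trivially, which multiplies both the form and \<open>gain_bound\<close> by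
  \<open>m\<close>.\<close>

lemma tied_separated_bound:
  assumes "finite T" "T \<noteq> {}" and R: "finite R" "R \<noteq> {}" "card R \<le> K" and "T \<inter> R = {}"
    and "\<And>i. i \<in> T \<Longrightarrow> \<pi> i = Tied" and \<pi>: "\<And>i. i \<in> R \<Longrightarrow> \<pi> i = Below \<or> \<pi> i = Above"
    and "admissible (T \<union> R) c f" "admissible (T \<union> R) c' g"
    and IH: "\<And>k. k < card R \<Longrightarrow> off_claim K r k" and r: "5 * card R + 10 \<le> r"
  shows "small (r + card R + 9 + card T)
     (\<lambda>x. \<bar>form (T \<union> R) \<pi> f g x\<bar> > gain_bound (card R) (card R + card T) / 3 ^ card R)"
  using assms(1,2,6,7,9,10)
proof (induction T arbitrary: c c' f g rule: finite_ne_induct)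
  case (singleton \<tau>)
  let ?P = "{i\<in>R. \<pi> i = Below}"
  have "small (r + card R + 10) (\<lambda>x. \<bar>form (insert \<tau> R) \<pi> f g x\<bar> > gain_bound (card R) (card R + 1) / 3 ^ card R)"
  proof (rule separated_bound[where P = ?P and K = K])
    show "\<pi> i = Above" if "i \<in> R - ?P" for i using \<pi>[of i] that by auto
  qed (use singleton R IH r in auto)
  then show ?case by (rule small_mono) auto
next
  case (insert i T)
  let ?S = "T \<union> R"
  let ?b = "gain_bound (card R) (card R + card T) / 3 ^ card R"
  let ?s = "\<lambda>t x. form ?S \<pi> (freeze i t f) (freeze i t g) x"
  have i: "i \<notin> ?S" using insert by auto
  have "small ((r + card R + 9 + card T) + 1) (\<lambda>x. \<exists>t\<in>{..<m}. \<bar>?s t x\<bar> > ?b)"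
  proof (rule small_UN)
    fix t assume t: "t \<in> {..<m}"
    show "small (r + card R + 9 + card T) (\<lambda>x. \<bar>?s t x\<bar> > ?b)"
      by (rule insert.IH[of "c - t" _ "c' - t"]) (use insert t i R in \<open>auto intro: admissible_freeze\<close>)
  qed auto
  then show ?case
  proof (rule small_mono)
    fix x
    assume big: "\<bar>form (insert i T \<union> R) \<pi> f g x\<bar> > gain_bound (card R) (card R + card (insert i T)) / 3 ^ card R"
    have e: "form (insert i T \<union> R) \<pi> f g x = (\<Sum>t<m. ?s t x)"
      using form_insert_Tied[of ?S i \<pi> f g x] insert i R by simp
    show "\<exists>t\<in>{..<m}. \<bar>?s t x\<bar> > ?b"
    proof (rule ccontr)
      assume "\<not> ?thesis"
      then have bd: "\<bar>?s t x\<bar> \<le> ?b" if "t \<in> {..<m}" for t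
        using that by (meson not_less)
      have "\<bar>\<Sum>t<m. ?s t x\<bar> \<le> (\<Sum>t<m. \<bar>?s t x\<bar>)" by (rule sum_abs)
      also have "\<dots> \<le> real (card {..<m}) * ?b" by (rule sum_bounded_above[OF bd])
      also have "\<dots> = gain_bound (card R) (card R + card (insert i T)) / 3 ^ card R"
        using insert.hyps by (simp add: gain_bound_Suc)
      finally show False using big e by simp
    qed
  qed (use insert.hyps in simp)
qed

text \<open>The part \<open>q = q'\<close> of \<open>form\<close>. In the final application, to the
  quadratic variation, it is the main term of full size, so a gain is possible only for the
  difference \<open>form - diag\<close>.\<close>

definition diag :: "nat set \<Rightarrow> (nat \<Rightarrow> pattern) \<Rightarrow> ((nat \<Rightarrow> nat) \<Rightarrow> 'a \<Rightarrow> real) \<Rightarrow>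
    ((nat \<Rightarrow> nat) \<Rightarrow> 'a \<Rightarrow> real) \<Rightarrow> 'a \<Rightarrow> real" where
  "diag S \<pi> f g x = (\<Sum>q\<in>box S. kerprod S \<pi> q q * (f q x * g q x))"

lemma diag_Tied_Free:
  assumes "\<And>i. i \<in> S \<Longrightarrow> \<pi> i = Tied \<or> \<pi> i = Free"
  shows "diag S \<pi> f g x = (\<Sum>q\<in>box S. f q x * g q x)"
proof -
  have "kerprod S \<pi> q q = 1" for q
    unfolding kerprod_def
  proof (intro prod.neutral ballI)
    fix i assume "i \<in> S" then show "ker (\<pi> i) (q i) (q i) = 1" using assms[of i] by auto
  qed
  then show ?thesis by (simp add: diag_def)
qed

lemma diag_strict:
  assumes "finite S" "i \<in> S" "\<pi> i = Below \<or> \<pi> i = Above"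
  shows "diag S \<pi> f g x = 0"
proof -
  have "kerprod S \<pi> q q = 0" for q
    unfolding kerprod_def using assms(1)
    by (rule prod_zero) (rule bexI[of _ i], use assms(2,3) in auto)
  then show ?thesis by (simp add: diag_def)
qed

lemma kerprod_split:
  assumes "finite S" "i \<in> S" "\<pi> i = Free"
  shows "kerprod S \<pi> q q' = kerprod S (\<pi>(i := Tied)) q q' + kerprod S (\<pi>(i := Below)) q q'
      + kerprod S (\<pi>(i := Above)) q q'"
proof -
  have "kerprod S (\<pi>(i := a)) q q' = ker a (q i) (q' i) * kerprod (S - {i}) \<pi> q q'" for a
  proof -
    have "(\<Prod>j\<in>S - {i}. ker ((\<pi>(i := a)) j) (q j) (q' j)) = (\<Prod>j\<in>S - {i}. ker (\<pi> j) (q j) (q' j))"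
      by (intro prod.cong) auto
    then show ?thesis unfolding kerprod_def using assms(1,2) by (simp add: prod.remove[of S i])
  qed
  moreover have "\<pi>(i := Free) = \<pi>" using assms(3) by auto
  ultimately show ?thesis
    using ker_Free_split[of "q i" "q' i"] by (metis distrib_right)
qed

lemma offdiag_split:
  assumes "finite S" "i \<in> S" "\<pi> i = Free"
  shows "form S \<pi> f g x - diag S \<pi> f g x =
      (form S (\<pi>(i := Tied)) f g x - diag S (\<pi>(i := Tied)) f g x)
    + (form S (\<pi>(i := Below)) f g x - diag S (\<pi>(i := Below)) f g x)
    + (form S (\<pi>(i := Above)) f g x - diag S (\<pi>(i := Above)) f g x)"
  unfolding form_def diag_def kerprod_split[of S i \<pi>, OF assms]
  by (simp add: distrib_right sum.distrib)

text \<open>Each free pair of indices is equal, increasing or decreasing, so \<open>a\<close> free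
  coordinates lead to \<open>3 ^ a\<close> patterns without free ones. A pattern with a strict
  coordinate has no diagonal and falls under \<open>tied_separated_bound\<close>; a completely tied
  one is nothing but diagonal. Both applications have \<open>a = k\<close>, where the powers of 3
  cancel.\<close>

lemma offdiag_bound:
  assumes "finite S" "card S \<le> K" "\<exists>i\<in>S. \<pi> i = Tied"
    and "card {i\<in>S. \<pi> i = Free} = a" "card {i\<in>S. \<pi> i \<noteq> Tied} = k"
    and f: "admissible S c f" and g: "admissible S c' g"
    and "\<And>k'. k' < k \<Longrightarrow> off_claim K r k'" and r: "5 * K + 10 \<le> r"
  shows "small (r + 2 * K + 9 + 2 * a)
     (\<lambda>x. \<bar>form S \<pi> f g x - diag S \<pi> f g x\<bar> > 3 ^ a / 3 ^ k * gain_bound k (card S))"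
  using assms(3-5,8)
proof (induction a arbitrary: \<pi> k)
  case 0
  let ?T = "{i\<in>S. \<pi> i = Tied}" and ?R = "{i\<in>S. \<pi> i \<noteq> Tied}"
  have noFree: "\<pi> i \<noteq> Free" if "i \<in> S" for i using 0(2) that assms(1) by auto
  show ?case
  proof (cases "k = 0")
    case True
    then have T: "\<And>i. i \<in> S \<Longrightarrow> \<pi> i = Tied" using 0(3) assms(1) by auto
    have "form S \<pi> f g x - diag S \<pi> f g x = 0" for x
      using form_Tied[of S \<pi> f g x] diag_Tied_Free[of S \<pi> f g x] assms(1) T by simp
    moreover have "3 ^ 0 / 3 ^ k * gain_bound k (card S) \<ge> 0" using gain_bound_nonneg by simp
    ultimately show ?thesis by (intro small_False) (simp add: not_less)
  next
    case False
    have RS: "?T \<union> ?R = S" by auto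
    have cS: "card ?T + card ?R = card S"
      using assms(1) by (subst card_Un_disjoint[symmetric]) (auto intro: arg_cong[where f = card])
    have ne: "?R \<noteq> {}" using False 0(3) by force
    then obtain i where i: "i \<in> S" "\<pi> i \<noteq> Tied" by auto
    have str: "\<pi> j = Below \<or> \<pi> j = Above" if "j \<in> ?R" for j
      using noFree[of j] that by (cases "\<pi> j") auto
    have "small (r + card ?R + 9 + card ?T)
      (\<lambda>x. \<bar>form (?T \<union> ?R) \<pi> f g x\<bar> > gain_bound (card ?R) (card ?R + card ?T) / 3 ^ card ?R)"
    proof (rule tied_separated_bound[where K = K and c = c and c' = c'])
      show "card ?R \<le> K" using cS assms(2) by linarith
      then show "5 * card ?R + 10 \<le> r" using r by linarith
    qed (use assms(1) 0 f g ne RS str in auto)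
    then have "small (r + card ?R + 9 + card ?T) (\<lambda>x. \<bar>form S \<pi> f g x\<bar> > gain_bound k (card S) / 3 ^ k)"
      using RS cS 0(3) by (simp add: add.commute)
    then show ?thesis
      by (rule small_mono) (use cS assms(2) diag_strict[of S i \<pi> f g] assms(1) i str in auto)
  qed
next
  case (Suc a)
  have "{i\<in>S. \<pi> i = Free} \<noteq> {}" using Suc.prems(2) by force
  then obtain i where i: "i \<in> S" "\<pi> i = Free" by auto
  let ?d = "\<lambda>b x. form S (\<pi>(i := b)) f g x - diag S (\<pi>(i := b)) f g x"
  have fr: "card {j\<in>S. (\<pi>(i := b)) j = Free} = a" if "b \<noteq> Free" for b
  proof -
    have "{j\<in>S. (\<pi>(i := b)) j = Free} = {j\<in>S. \<pi> j = Free} - {i}" using that by auto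
    then show ?thesis using Suc.prems(2) i assms(1) by simp
  qed
  have nt: "card {j\<in>S. (\<pi>(i := b)) j \<noteq> Tied} = k" if "b \<noteq> Tied" for b
  proof -
    have "{j\<in>S. (\<pi>(i := b)) j \<noteq> Tied} = {j\<in>S. \<pi> j \<noteq> Tied}" using that i by auto
    then show ?thesis using Suc.prems(3) by simp
  qed
  have nT: "card {j\<in>S. (\<pi>(i := Tied)) j \<noteq> Tied} = k - 1"
  proof -
    have "{j\<in>S. (\<pi>(i := Tied)) j \<noteq> Tied} = {j\<in>S. \<pi> j \<noteq> Tied} - {i}" by auto
    then show ?thesis using Suc.prems(3) i assms(1) by simp
  qed
  have "i \<in> {j\<in>S. \<pi> j \<noteq> Tied}" using i by simp
  then have "{j\<in>S. \<pi> j \<noteq> Tied} \<noteq> {}" by blast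
  then have "card {j\<in>S. \<pi> j \<noteq> Tied} > 0" using assms(1) by (simp only: card_gt_0_iff) simp
  then have k0: "k > 0" using Suc.prems(3) by simp
  have tied: "\<exists>j\<in>S. (\<pi>(i := b)) j = Tied" for b
  proof -
    obtain j where j: "j \<in> S" "\<pi> j = Tied" using Suc.prems(1) by auto
    then have "j \<noteq> i" using i by auto
    then show ?thesis using j by (intro bexI[of _ j]) auto
  qed
  let ?e = "r + 2 * K + 9 + 2 * a"
  have "small ?e (\<lambda>x. \<bar>?d Tied x\<bar> > 3 ^ a / 3 ^ (k - 1) * gain_bound (k - 1) (card S))"
    by (rule Suc.IH[OF tied fr nT]) (use Suc.prems(4) in auto)
  moreover have "small ?e (\<lambda>x. \<bar>?d b x\<bar> > 3 ^ a / 3 ^ k * gain_bound k (card S))"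
    if "b = Below \<or> b = Above" for b
    by (rule Suc.IH[OF tied fr nt]) (use Suc.prems(4) that in auto)
  ultimately have "small (Suc (max (Suc (max ?e ?e)) ?e)) (\<lambda>x.
      (\<bar>?d Tied x\<bar> > 3 ^ a / 3 ^ (k - 1) * gain_bound (k - 1) (card S) \<or>
       \<bar>?d Below x\<bar> > 3 ^ a / 3 ^ k * gain_bound k (card S)) \<or> \<bar>?d Above x\<bar> > 3 ^ a / 3 ^ k * gain_bound k (card S))"
    by (intro small_disj) auto
  then show ?case
  proof (rule small_mono)
    fix x assume big: "\<bar>form S \<pi> f g x - diag S \<pi> f g x\<bar> > 3 ^ Suc a / 3 ^ k * gain_bound k (card S)"
    let ?b = "3 ^ a / 3 ^ k * gain_bound k (card S)"
    \<comment> \<open>Tying a coordinate lowers \<open>k\<close> and forfeits a factor 3, which is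
      covered by the factor \<open>D\<close> between consecutive values of
      \<open>gain_bound\<close>.\<close>
    have "3 ^ a / 3 ^ (k - 1) * gain_bound (k - 1) (card S) \<le> ?b"
    proof -
      have k: "k = Suc (k - 1)" using k0 by simp
      have "gain_bound k (card S) = D * gain_bound (k - 1) (card S)"
        by (subst k) (simp add: gain_bound_def)
      moreover have "(3::real) ^ k = 3 * 3 ^ (k - 1)" by (subst k) simp
      ultimately have "?b = D / 3 * (3 ^ a / 3 ^ (k - 1) * gain_bound (k - 1) (card S))" by simp
      moreover have "1 * (3 ^ a / 3 ^ (k - 1) * gain_bound (k - 1) (card S)) \<le> D / 3 * (3 ^ a / 3 ^ (k - 1) * gain_bound (k - 1) (card S))"
        using D_ge gain_bound_nonneg by (intro mult_right_mono) auto
      ultimately show ?thesis by simp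
    qed
    moreover have "\<bar>?d Tied x + ?d Below x + ?d Above x\<bar> > 3 * ?b"
      using big unfolding offdiag_split[of S i \<pi>, OF assms(1) i] by simp
    ultimately show "(\<bar>?d Tied x\<bar> > 3 ^ a / 3 ^ (k - 1) * gain_bound (k - 1) (card S) \<or>
       \<bar>?d Below x\<bar> > 3 ^ a / 3 ^ k * gain_bound k (card S)) \<or> \<bar>?d Above x\<bar> > 3 ^ a / 3 ^ k * gain_bound k (card S)"
      by linarith
  qed simp
qed

lemma off_claim_lift: "off_claim K r k \<Longrightarrow> r \<le> r' \<Longrightarrow> off_claim K r' k"
  unfolding off_claim_def using small_lift by blast

text \<open>The off-diagonal part is \<open>offdiag_bound\<close>, which appeals only to smaller
  \<open>k\<close>. The diagonal is small as well because \<open>c \<noteq> c'\<close>, by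
  \<open>offset_tied_bound\<close>. Each round of the induction adds at most
  \<open>10 * K + 25\<close> to the exponent of the exceptional set.\<close>

lemma off_claim: "off_claim K ((k + 1) * (10 * K + 25)) k"
proof (induction k rule: less_induct)
  case (less k)
  define r where "r = k * (10 * K + 25) + 5 * K + 10"
  have IH: "off_claim K r k'" if "k' < k" for k'
  proof (rule off_claim_lift[OF less[OF that]])
    have "(k' + 1) * (10 * K + 25) \<le> k * (10 * K + 25)" using that by (intro mult_right_mono) auto
    then show "(k' + 1) * (10 * K + 25) \<le> r" by (simp add: r_def)
  qed
  show ?case
    unfolding off_claim_def
  proof (intro allI impI, elim conjE)
    fix S \<pi> c c' and f g :: "(nat \<Rightarrow> nat) \<Rightarrow> 'a \<Rightarrow> real"
    assume S: "finite S" "card S \<le> K" "\<exists>i\<in>S. \<pi> i = Tied"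
      "\<forall>i\<in>S. \<pi> i = Tied \<or> \<pi> i = Free" "card {i \<in> S. \<pi> i = Free} = k"
      and f: "admissible S c f" and g: "admissible S c' g" and cc: "c \<noteq> c'"
    have "{i\<in>S. \<pi> i \<noteq> Tied} = {i\<in>S. \<pi> i = Free}" using S(4) by force
    then have k: "card {i\<in>S. \<pi> i \<noteq> Tied} = k" using S(5) by simp
    have ne: "S \<noteq> {}" using S(3) by auto
    have kK: "k \<le> K" using card_mono[OF S(1), of "{i \<in> S. \<pi> i = Free}"] S(2,5) by auto
    have A: "small (r + 2 * K + 9 + 2 * k)
     (\<lambda>x. \<bar>form S \<pi> f g x - diag S \<pi> f g x\<bar> > 3 ^ k / 3 ^ k * gain_bound k (card S))"
      by (rule offdiag_bound[OF S(1-3,5) k f g IH]) (auto simp: r_def)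
    have B: "small (card S) (\<lambda>x. \<bar>\<Sum>q\<in>box S. f q x * g q x\<bar> > sqrt (2 * p * m) * real m ^ (card S - 1))"
      by (rule offset_tied_bound[OF S(1) ne f g cc])
    have le: "sqrt (2 * p * m) * real m ^ (card S - 1) \<le> gain_bound k (card S)"
    proof -
      have m1: "real m \<ge> 1" using m_ge by simp
      have D1: "D \<ge> 1" using D_ge by simp
      have sm: "sqrt m \<ge> 1" "sqrt m * sqrt m = m" "sqrt (sqrt m) \<ge> 1" "sqrt (sqrt m) * sqrt (sqrt m) = sqrt m"
        using m1 by auto
      have "card S \<noteq> 0" using ne S(1) by simp
      then have mk: "real m ^ card S = real m * real m ^ (card S - 1)" by (metis power_eq_if)
      have "sqrt (2 * p * m) * real m ^ (card S - 1) * sqrt (sqrt m)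
          = sqrt (2 * p) * (sqrt m * sqrt (sqrt m)) * real m ^ (card S - 1)"
        by (simp add: real_sqrt_mult mult_ac)
      also have "\<dots> \<le> sqrt D * (sqrt m * sqrt m) * real m ^ (card S - 1)"
      proof (intro mult_mono)
        show "sqrt (2 * p) \<le> sqrt D" using D_ge p_ge by simp
        have "sqrt (sqrt m) * 1 \<le> sqrt (sqrt m) * sqrt (sqrt m)" using sm by (intro mult_left_mono) auto
        then show "sqrt (sqrt m) \<le> sqrt m" using sm by simp
      qed (use D1 sm in auto)
      also have "\<dots> = sqrt D * real m ^ card S" using sm mk by simp
      also have "\<dots> \<le> D ^ k * (sqrt D * real m ^ card S)"
        using mult_right_mono[OF one_le_power[OF D1, of k], of "sqrt D * real m ^ card S"] D1 by simp
      finally show ?thesis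
        using sm by (simp add: gain_bound_def pos_le_divide_eq mult_ac)
    qed
    show "small ((k + 1) * (10 * K + 25)) (\<lambda>x. \<bar>form S \<pi> f g x\<bar> > 2 * gain_bound k (card S))"
    proof (rule small_mono[OF small_disj[OF A B]])
      fix x assume big: "\<bar>form S \<pi> f g x\<bar> > 2 * gain_bound k (card S)"
      have d: "diag S \<pi> f g x = (\<Sum>q\<in>box S. f q x * g q x)" using S(4) by (intro diag_Tied_Free) auto
      show "\<bar>form S \<pi> f g x - diag S \<pi> f g x\<bar> > 3 ^ k / 3 ^ k * gain_bound k (card S) \<or>
         \<bar>\<Sum>q\<in>box S. f q x * g q x\<bar> > sqrt (2 * p * m) * real m ^ (card S - 1)"
        using big le unfolding d by simp linarith
    next
      show "Suc (max (r + 2 * K + 9 + 2 * k) (card S)) \<le> (k + 1) * (10 * K + 25)"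
        using kK S(2) by (simp add: r_def algebra_simps)
    qed
  qed
qed

text \<open>In coordinate \<open>i\<^sub>0\<close> the sum is a martingale \<open>\<Sum>t. G t\<close>, and \<open>\<Prod>t. exp (\<theta> * G t) / cosh (\<theta> * G t)\<close> has mean
  one. Since the quadratic variation \<open>\<Sum>t. (G t)\<^sup>2\<close> rarely drops below half of its mean, the product of
  the \<open>cosh\<close> is large, which forces \<open>exp (\<theta> * M)\<close> to be large.\<close>

lemma sup_lower_bound:
  assumes S: "finite S" "i\<^sub>0 \<in> S" and F: "admissible S c F"
    and F1: "\<And>q x. q \<in> box S \<Longrightarrow> x \<in> \<Omega> \<Longrightarrow> \<bar>F q x\<bar> = 1"
    and M: "\<And>x. x \<in> \<Omega> \<Longrightarrow> (\<Sum>q\<in>box S. F q x) \<le> M"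
    and c1: "gain_bound (card S - 1) (card S) \<le> real m ^ card S / 2"
    and c2: "8 * p * (2 * (4 * p * m) ^ (card S - 1)) \<le> real m ^ card S"
    and c3: "real m ^ ((card S + 1) * (10 * card S + 25)) + 1 \<le> exp (p / 2)"
  shows "sqrt p * sqrt (real m ^ card S) / (2 * sqrt 8) \<le> M"
proof -
  define n where "n = card S"
  define Q where "Q = S - {i\<^sub>0}"
  have Q: "finite Q" "i\<^sub>0 \<notin> Q" "insert i\<^sub>0 Q = S" "card Q = n - 1" using S by (auto simp: Q_def n_def)
  have n0: "n > 0" using S by (auto simp: n_def card_gt_0_iff)
  define \<pi> where "\<pi> i = (if i = i\<^sub>0 then Tied else Free)" for i
  define G where "G t x = (\<Sum>q\<in>box Q. freeze i\<^sub>0 t F q x)" for t x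
  have Ft: "admissible Q (c - t) (freeze i\<^sub>0 t F)" if "t < m" for t
    using admissible_freeze[of Q i\<^sub>0 c F t] Q F that by simp
  have Gmd: "martingale_diff i\<^sub>0 t (G t)" if t: "t \<in> {..<m}" for t
    unfolding G_def
  proof (rule martingale_diff_sum)
    fix q assume "q \<in> box Q"
    then have "q(i\<^sub>0 := t) \<in> box S" using box_upd[of q Q t i\<^sub>0] t Q(3) by simp
    from admissible_md[OF F this S(2)] show "martingale_diff i\<^sub>0 t (freeze i\<^sub>0 t F q)" by (simp add: freeze_def)
  qed
  have H: "(\<Sum>q\<in>box S. F q x) = (\<Sum>t<m. G t x)" for x
    unfolding G_def freeze_def using sum_box_insert[OF Q(2), of "\<lambda>q. F q x"] Q(3) by simp
  have Gsq: "form Q \<pi> (freeze i\<^sub>0 t F) (freeze i\<^sub>0 t F) x = (G t x)\<^sup>2" for t x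
  proof -
    have "\<pi> i = Free" if "i \<in> Q" for i using that Q(2) by (auto simp: \<pi>_def)
    then show ?thesis
      using form_Free[of Q \<pi> "freeze i\<^sub>0 t F" "freeze i\<^sub>0 t F" x] by (simp add: G_def power2_eq_square)
  qed
  have V: "form S \<pi> F F x = (\<Sum>t<m. (G t x)\<^sup>2)" for x
    using form_insert_Tied[of Q i\<^sub>0 \<pi> F F x] Q Gsq by (simp add: \<pi>_def)
  have dg: "diag S \<pi> F F x = real m ^ n" if x: "x \<in> \<Omega>" for x
  proof -
    have "diag S \<pi> F F x = (\<Sum>q\<in>box S. F q x * F q x)" by (rule diag_Tied_Free) (simp add: \<pi>_def)
    also have "\<dots> = (\<Sum>q\<in>box S. 1)"
    proof (intro sum.cong refl)
      fix q assume "q \<in> box S"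
      from F1[OF this x] show "F q x * F q x = 1" by (metis abs_mult_self_eq mult_1)
    qed
    finally show ?thesis using card_box[OF S(1)] by (simp add: n_def)
  qed
  have fr: "{i\<in>S. \<pi> i = Free} = Q" "{i\<in>S. \<pi> i \<noteq> Tied} = Q" by (auto simp: \<pi>_def Q_def)
  define r where "r = n * (10 * n + 25) + 5 * n + 10"
  have "small (r + 2 * n + 9 + 2 * (n - 1))
     (\<lambda>x. \<bar>form S \<pi> F F x - diag S \<pi> F F x\<bar> > 3 ^ (n - 1) / 3 ^ (n - 1) * gain_bound (n - 1) (card S))"
  proof (rule offdiag_bound[where K = n])
    show "off_claim n r k'" if "k' < n - 1" for k'
    proof (rule off_claim_lift[OF off_claim])
      have "(k' + 1) * (10 * n + 25) \<le> n * (10 * n + 25)" using that by (intro mult_right_mono) auto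
      then show "(k' + 1) * (10 * n + 25) \<le> r" by (simp add: r_def)
    qed
    show "\<exists>i\<in>S. \<pi> i = Tied" using S by (auto simp: \<pi>_def)
  qed (use S F fr Q in \<open>auto simp: n_def r_def\<close>)
  then have A: "small (r + 4 * n + 7) (\<lambda>x. \<bar>form S \<pi> F F x - diag S \<pi> F F x\<bar> > gain_bound (n - 1) n)"
    by (rule small_mono) (use n0 in \<open>auto simp: n_def\<close>)
  \<comment> \<open>Besides the quadratic variation every single increment must be controlled, so
    that \<open>exp_le_cosh\<close> applies to \<open>\<theta> * G t x\<close>.\<close>
  have B: "small ((3 * (n - 1) + 5) + 1) (\<lambda>x. \<exists>t\<in>{..<m}. (G t x)\<^sup>2 > 2 * (4 * p * m) ^ (n - 1))"
  proof (rule small_UN)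
    fix t assume t: "t \<in> {..<m}"
    have "small (3 * card Q + 5 + card ({} :: nat set)) (\<lambda>x. \<bar>form ({} \<union> Q) \<pi> (freeze i\<^sub>0 t F) (freeze i\<^sub>0 t F) x\<bar>
        > 2 * real m ^ card ({} :: nat set) * (4 * p * m) ^ card Q)"
      by (rule diagonal_bound) (use Q Ft t in \<open>auto simp: \<pi>_def\<close>)
    then show "small (3 * (n - 1) + 5) (\<lambda>x. (G t x)\<^sup>2 > 2 * (4 * p * m) ^ (n - 1))"
      using Q(4) by (simp add: Gsq)
  qed auto
  let ?bad = "\<lambda>x. \<bar>form S \<pi> F F x - diag S \<pi> F F x\<bar> > gain_bound (n - 1) n \<or>
     (\<exists>t\<in>{..<m}. (G t x)\<^sup>2 > 2 * (4 * p * m) ^ (n - 1))"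
  have bad: "small ((n + 1) * (10 * n + 25)) ?bad"
    by (rule small_mono[OF small_disj[OF A B]]) (auto simp: r_def algebra_simps)
  define N where "N = real m ^ n"
  have N0: "N > 0" using m_ge by (simp add: N_def)
  \<comment> \<open>Chosen so that a quadratic variation of at least \<open>N / 2\<close> makes the
    product of the \<open>cosh\<close> at least
    \<open>exp (\<theta>\<^sup>2 * (N / 2) / 4) = exp p\<close>.\<close>
  define \<theta> where "\<theta> = sqrt (8 * p / N)"
  have th: "\<theta> > 0" "\<theta>\<^sup>2 = 8 * p / N" using N0 p_ge by (auto simp: \<theta>_def)
  let ?C = "\<lambda>x. \<Prod>t<m. cosh (\<theta> * G t x)"
  have C1: "?C x \<ge> 1" for x by (rule prod_ge_1) (rule cosh_real_ge_1)
  have good: "1 / ?C x \<le> exp (- p)" if x: "x \<in> \<Omega>" and "\<not> ?bad x" for x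
  proof -
    have h: "\<bar>form S \<pi> F F x - diag S \<pi> F F x\<bar> \<le> gain_bound (n - 1) n"
      "\<And>t. t < m \<Longrightarrow> (G t x)\<^sup>2 \<le> 2 * (4 * p * m) ^ (n - 1)"
      using that(2) by (auto simp: not_less)
    have V2: "(\<Sum>t<m. (G t x)\<^sup>2) \<ge> N / 2"
      using h(1) c1 unfolding V dg[OF x] N_def n_def by linarith
    have le1: "\<bar>\<theta> * G t x\<bar> \<le> 1" if "t < m" for t
    proof -
      have "(\<theta> * G t x)\<^sup>2 \<le> 8 * p / N * (2 * (4 * p * m) ^ (n - 1))"
        unfolding power_mult_distrib[of \<theta>] th(2) using h(2)[OF that] p_ge N0 by (intro mult_left_mono) auto
      also have "\<dots> \<le> 1" using c2 N0 by (simp add: n_def N_def)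
      finally show ?thesis by (simp add: abs_square_le_1)
    qed
    have "p = \<theta>\<^sup>2 * (N / 2) / 4" using th(2) N0 by simp
    also have "\<dots> \<le> \<theta>\<^sup>2 * (\<Sum>t<m. (G t x)\<^sup>2) / 4" using V2 by (intro divide_right_mono mult_left_mono) auto
    also have "\<dots> = (\<Sum>t<m. (\<theta> * G t x)\<^sup>2 / 4)"
      by (simp add: sum_distrib_left sum_divide_distrib power_mult_distrib)
    finally have "exp p \<le> exp (\<Sum>t<m. (\<theta> * G t x)\<^sup>2 / 4)" by simp
    also have "\<dots> = (\<Prod>t<m. exp ((\<theta> * G t x)\<^sup>2 / 4))" by (rule exp_sum) simp
    also have "\<dots> \<le> ?C x" using le1 by (intro prod_mono) (auto intro: exp_le_cosh)
    finally have "exp p \<le> ?C x" .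
    then have "1 / ?C x \<le> 1 / exp p" by (intro divide_left_mono) (use C1[of x] in auto)
    then show ?thesis by (simp add: exp_minus inverse_eq_divide)
  qed
  have "real (card \<Omega>) = (\<Sum>x\<in>\<Omega>. \<Prod>t<m. exp (\<theta> * G t x) / cosh (\<theta> * G t x))"
    by (rule exp_martingale[where s = id and i = i\<^sub>0, symmetric]) (use Gmd in auto)
  also have "\<dots> = (\<Sum>x\<in>\<Omega>. exp (\<theta> * (\<Sum>q\<in>box S. F q x)) * (1 / ?C x))"
    unfolding H by (intro sum.cong refl) (simp add: prod_dividef exp_sum sum_distrib_left)
  also have "\<dots> \<le> (\<Sum>x\<in>\<Omega>. exp (\<theta> * M) * (1 / ?C x))"
    using M th(1) by (intro sum_mono mult_right_mono) (auto intro!: prod_nonneg)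
  also have "\<dots> \<le> (\<Sum>x\<in>\<Omega>. exp (\<theta> * M) * (of_bool (?bad x) + exp (- p)))"
  proof (intro sum_mono mult_left_mono)
    fix x assume x: "x \<in> \<Omega>"
    show "1 / ?C x \<le> of_bool (?bad x) + exp (- p)"
    proof (cases "?bad x")
      case True
      have "1 / ?C x \<le> 1" using C1[of x] by simp
      then show ?thesis using True by (simp add: add_increasing2)
    next
      case False
      have "of_bool (?bad x) = (0::real)" unfolding of_bool_def by (rule if_not_P[OF False])
      with good[OF x False] show ?thesis by (simp only: add_0)
    qed
  qed simp
  also have "\<dots> = exp (\<theta> * M) * (real (card {x\<in>\<Omega>. ?bad x}) + exp (- p) * card \<Omega>)"
  proof -
    have "(\<Sum>x\<in>\<Omega>. of_bool (?bad x)) = real (card {x\<in>\<Omega>. ?bad x})"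
      using finite_Omega by (simp add: of_bool_def sum.inter_filter[symmetric])
    then show ?thesis unfolding sum_distrib_left[symmetric] sum.distrib by (simp only: sum_constant mult.commute)
  qed
  also have "\<dots> \<le> exp (\<theta> * M) * ((real m ^ ((n + 1) * (10 * n + 25)) + 1) * exp (- p) * card \<Omega>)"
    using bad by (intro mult_left_mono) (auto simp: small_def algebra_simps)
  \<comment> \<open>Half of \<open>p\<close> pays for the polynomial factor of the exceptional set;
    the other half remains as a lower bound for \<open>\<theta> * M\<close>.\<close>
  also have "\<dots> \<le> exp (\<theta> * M) * (exp (p / 2) * exp (- p) * card \<Omega>)"
    using c3 by (intro mult_left_mono mult_right_mono) (auto simp: n_def)
  also have "\<dots> = exp (\<theta> * M - p / 2) * card \<Omega>"
    by (simp add: exp_add[symmetric] flip: mult.assoc)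
  finally have "1 \<le> exp (\<theta> * M - p / 2)"
    using finite_Omega Omega_ne by (simp add: card_gt_0_iff)
  then have "p / 2 \<le> \<theta> * M" by simp
  then have "p / (2 * \<theta>) \<le> M" using th(1) by (simp add: field_simps)
  moreover have "p / (2 * \<theta>) = sqrt p * sqrt N / (2 * sqrt 8)"
  proof -
    have e: "\<theta> = sqrt 8 * sqrt p / sqrt N" by (simp add: \<theta>_def real_sqrt_divide real_sqrt_mult)
    have gen: "a * a / (2 * (b * a / d)) = a * d / (2 * b)" if "a > 0" "b > 0" "d > 0" for a b d :: real
      using that by (simp add: field_simps)
    show ?thesis
      using gen[of "sqrt p" "sqrt 8" "sqrt N"] p_ge N0 unfolding e by simp
  qed
  ultimately show ?thesis by (simp add: N_def n_def)
qed

text \<open>Flipping the bit of level \<open>u\<close> preserves the terms with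
  \<open>e r < u\<close> and negates those with \<open>e r = u\<close>. Averaging the sum over a
  point and its flip therefore removes the finest level without increasing the supremum. Levels are
  removed from the finest one downwards, starting at \<open>B\<close>, where the truncation changes
  nothing.\<close>

lemma truncate_coordinate:
  assumes "finite A" "\<And>r. r \<in> A \<Longrightarrow> martingale_diff i (e r) (f r)"
    and "\<And>x. x \<in> \<Omega> \<Longrightarrow> \<bar>\<Sum>r\<in>A. f r x\<bar> \<le> M" and x: "x \<in> \<Omega>"
  shows "\<bar>\<Sum>r\<in>{r\<in>A. e r < u}. f r x\<bar> \<le> M"
proof -
  obtain B where B: "\<And>r. r \<in> A \<Longrightarrow> e r < B"
    using finite_nat_set_iff_bounded[of "e ` A"] assms(1) by auto
  have "\<forall>x\<in>\<Omega>. \<bar>\<Sum>r\<in>{r\<in>A. e r < u}. f r x\<bar> \<le> M" if "B \<le> u + k" for k u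
    using that
  proof (induction k arbitrary: u)
    case 0
    have "{r\<in>A. e r < u} = A" using B 0 by fastforce
    then show ?case using assms(3) by simp
  next
    case (Suc k)
    show ?case
    proof
      fix x assume x: "x \<in> \<Omega>"
      let ?lt = "\<lambda>x. \<Sum>r\<in>{r\<in>A. e r < u}. f r x" and ?eq = "\<lambda>x. \<Sum>r\<in>{r\<in>A. e r = u}. f r x"
      have sp: "(\<Sum>r\<in>{r\<in>A. e r < Suc u}. f r x) = ?lt x + ?eq x" for x
      proof -
        have "{r\<in>A. e r < Suc u} = {r\<in>A. e r < u} \<union> {r\<in>A. e r = u}" by auto
        then show ?thesis using assms(1) by (simp add: sum.union_disjoint disjoint_iff)
      qed
      have "?lt (fl i u x) = ?lt x"
        using assms(2) x by (intro sum.cong) (auto simp: martingale_diff_def)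
      moreover have "?eq (fl i u x) = - ?eq x"
        unfolding sum_negf[symmetric] using assms(2) x by (intro sum.cong) (auto simp: martingale_diff_def)
      moreover have "\<bar>?lt x + ?eq x\<bar> \<le> M" "\<bar>?lt (fl i u x) + ?eq (fl i u x)\<bar> \<le> M"
        using Suc.IH[of "Suc u"] Suc.prems x fl_in[OF x] unfolding sp[symmetric] by auto
      ultimately show "\<bar>?lt x\<bar> \<le> M" by linarith
    qed
  qed
  from this[of u B] x show ?thesis by simp
qed

lemma truncate:
  assumes "finite I" "finite A" "\<And>r i. r \<in> A \<Longrightarrow> i \<in> I \<Longrightarrow> martingale_diff i (e i r) (f r)"
    and "\<And>x. x \<in> \<Omega> \<Longrightarrow> \<bar>\<Sum>r\<in>A. f r x\<bar> \<le> M"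
  shows "\<forall>x\<in>\<Omega>. \<bar>\<Sum>r\<in>{r\<in>A. \<forall>i\<in>I. e i r < u}. f r x\<bar> \<le> M"
  using assms(1,3)
proof (induction I rule: finite_induct)
  case empty
  then show ?case using assms(4) by simp
next
  case (insert i I)
  have "{r\<in>A. \<forall>j\<in>insert i I. e j r < u} = {r\<in>{r\<in>A. \<forall>j\<in>I. e j r < u}. e i r < u}" by auto
  then show ?case
    using truncate_coordinate[of "{r\<in>A. \<forall>j\<in>I. e j r < u}" i "e i" f M _ u] insert assms(2) by auto
qed

end

section \<open>Choice of the parameters\<close>

text \<open>Taking \<kappa> below \<open>\<kappa>' = 1 / (4 * d)\<close> leaves a power of
  \<open>x\<close> for the constant and the logarithm in \<open>D\<close>, so that
  \<open>D \<le> x powr \<kappa>'\<close>. The product of \<open>d\<close> such powers is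
  \<open>x powr (1/4)\<close>: \<open>d - 1\<close> of them bound \<open>D ^ (d - 1)\<close>, and
  the last absorbs a factor 2. The first two clauses follow from this; the third compares a power
  with an exponential of a power.\<close>

lemma parameters_exist:
  fixes \<kappa> :: real and d A :: nat
  assumes d: "d \<ge> 2" and \<kappa>: "0 < \<kappa>" "\<kappa> < 1 / (4 * real d)"
  shows "\<forall>\<^sub>F x in at_top.
     (324 * x powr \<kappa> * (log 2 x)\<^sup>2) ^ (d - 2) * sqrt (324 * x powr \<kappa> * (log 2 x)\<^sup>2) * x ^ (d - 1) / sqrt (sqrt x)
        \<le> x ^ (d - 1) / 2
   \<and> 8 * x powr \<kappa> * (2 * (4 * x powr \<kappa> * x) ^ (d - 2)) \<le> x ^ (d - 1)
   \<and> x ^ A + 1 \<le> exp (x powr \<kappa> / 2)"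
proof -
  define \<kappa>' where "\<kappa>' = 1 / (4 * real d)"
  define \<delta> where "\<delta> = \<kappa>' - \<kappa>"
  have \<delta>: "\<delta> > 0" and \<kappa>': "\<kappa>' > 0" using \<kappa> d by (auto simp: \<delta>_def \<kappa>'_def)
  have e1: "\<forall>\<^sub>F x::real in at_top. 324 * (log 2 x)\<^sup>2 \<le> x powr \<delta>"
    using \<delta> by real_asymp
  have e2: "\<forall>\<^sub>F x::real in at_top. 2 \<le> x powr \<kappa>'"
    using \<kappa>' by real_asymp
  have e3: "\<forall>\<^sub>F x::real in at_top. x powr real A + 1 \<le> exp (x powr \<kappa> / 2)"
    using \<kappa>(1) by real_asymp
  have e4: "\<forall>\<^sub>F x::real in at_top. x \<ge> 2" by (rule eventually_ge_at_top)
  from e1 e2 e3 e4 show ?thesis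
  proof eventually_elim
    case (elim x)
    define p where "p = x powr \<kappa>"
    define D where "D = 324 * p * (log 2 x)\<^sup>2"
    have x: "x > 0" using elim by simp
    have p1: "p \<ge> 1" using elim \<kappa> by (simp add: p_def ge_one_powr_ge_zero)
    have lg: "log 2 x \<ge> 1" using elim by simp
    have Dp: "324 * p \<le> D" unfolding D_def using p1 lg by simp
    have D1: "D \<ge> 1" using Dp p1 by simp
    have "D = p * (324 * (log 2 x)\<^sup>2)" by (simp add: D_def)
    also have "\<dots> \<le> p * x powr \<delta>" using elim p1 by (intro mult_left_mono) auto
    also have "\<dots> = x powr \<kappa>'" using x by (simp add: p_def \<delta>_def powr_add[symmetric])
    finally have Dx: "D \<le> x powr \<kappa>'" .
    have q: "x powr (1/4) = sqrt (sqrt x)"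
      using x by (simp add: powr_half_sqrt[symmetric] powr_powr)
    have "2 * D ^ (d - 1) \<le> x powr \<kappa>' * (x powr \<kappa>') ^ (d - 1)"
      using elim Dx D1 by (intro mult_mono power_mono) auto
    also have "\<dots> = x powr (\<kappa>' * d)"
    proof -
      have "x powr \<kappa>' * (x powr \<kappa>') ^ (d - 1) = (x powr \<kappa>') ^ d"
        using d by (metis One_nat_def Suc_pred less_le_trans pos2 power_Suc)
      then show ?thesis using x by (simp add: powr_powr powr_realpow[symmetric])
    qed
    also have "\<kappa>' * d = 1/4" using d by (simp add: \<kappa>'_def)
    finally have main: "2 * D ^ (d - 1) \<le> sqrt (sqrt x)" unfolding q .
    have d1: "d - 1 = Suc (d - 2)" using d by simp
    have sD: "sqrt D \<le> D" using D1 real_sqrt_le_mono[of D "D\<^sup>2"] by (simp add: power2_eq_square)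
    have sx: "sqrt (sqrt x) > 0" using x by simp
    have "D ^ (d - 2) * sqrt D \<le> D ^ (d - 2) * D" using sD D1 by (intro mult_left_mono) auto
    then have "2 * (D ^ (d - 2) * sqrt D) \<le> sqrt (sqrt x)" using main d1 by (simp add: mult.commute)
    then have "2 * (D ^ (d - 2) * sqrt D) * x ^ (d - 1) \<le> sqrt (sqrt x) * x ^ (d - 1)"
      using x by (intro mult_right_mono) auto
    then have c1: "D ^ (d - 2) * sqrt D * x ^ (d - 1) / sqrt (sqrt x) \<le> x ^ (d - 1) / 2"
      using sx by (simp add: field_simps)
    have "16 * p * (4 * p) ^ (d - 2) \<le> D * D ^ (d - 2)"
      using Dp p1 by (intro mult_mono power_mono) auto
    also have "\<dots> = D ^ (d - 1)" using d1 by simp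
    also have "\<dots> \<le> sqrt (sqrt x)"
    proof -
      have "D ^ (d - 1) \<ge> 1" using D1 by (rule one_le_power)
      with main show ?thesis by linarith
    qed
    also have "\<dots> \<le> x"
    proof -
      have "sqrt x \<le> x" using elim real_sqrt_le_mono[of x "x\<^sup>2"] by (simp add: power2_eq_square)
      moreover have "sqrt (sqrt x) \<le> sqrt x" using calculation by simp
      ultimately show ?thesis by linarith
    qed
    finally have "16 * p * (4 * p) ^ (d - 2) * x ^ (d - 2) \<le> x * x ^ (d - 2)"
      using x by (intro mult_right_mono) auto
    then have c2: "8 * p * (2 * (4 * p * x) ^ (d - 2)) \<le> x ^ (d - 1)"
      using d1 by (simp add: power_mult_distrib mult_ac)
    show ?case
      using c1 c2 elim(3) x by (simp add: D_def p_def powr_realpow)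
  qed
qed

section \<open>Haar functions on the dyadic grid\<close>

definition cube :: "nat \<Rightarrow> ('d::finite \<Rightarrow> nat) \<Rightarrow> (real ^ 'd) set" where
  "cube N x = {y. \<forall>j. y $ j \<in> {x j / 2 ^ N ..< (real (x j) + 1) / 2 ^ N}}"

definition rect :: "('d::finite \<Rightarrow> nat) \<Rightarrow> ('d \<Rightarrow> nat) \<Rightarrow> (real ^ 'd) set" where
  "rect r k = {y. \<forall>j. y $ j \<in> {k j / 2 ^ r j ..< (real (k j) + 1) / 2 ^ r j}}"

lemma half_open_ne: "{k / 2 ^ r ..< (k + 1) / 2 ^ r} \<noteq> ({} :: real set)"
  by (simp add: divide_strict_right_mono)

lemma side_rect: "side (rect r k) j = {k j / 2 ^ r j ..< (real (k j) + 1) / 2 ^ r j}"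
  unfolding rect_def using half_open_ne by (intro side_box) blast

lemma measure_rect:
  fixes r k :: "'d::finite \<Rightarrow> nat"
  shows "rect r k \<in> lmeasurable" "measure lebesgue (rect r k) = 1 / 2 ^ (\<Sum>j\<in>UNIV. r j)"
proof -
  define a :: "real ^ 'd" where "a = (\<chi> j. k j / 2 ^ r j)"
  define b :: "real ^ 'd" where "b = (\<chi> j. (real (k j) + 1) / 2 ^ r j)"
  have ab: "a $ j < b $ j" for j by (simp add: a_def b_def divide_strict_right_mono)
  have sub: "box a b \<subseteq> rect r k" "rect r k \<subseteq> cbox a b"
    by (auto simp: rect_def mem_box_cart a_def b_def less_imp_le)
  have "rect r k = (\<Inter>j. {y. y $ j \<in> {k j / 2 ^ r j ..< (real (k j) + 1) / 2 ^ r j}})"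
    by (auto simp: rect_def)
  also have "\<dots> \<in> sets borel"
  proof (rule sets.finite_INT)
    fix j :: 'd
    have "{y :: real ^ 'd. y $ j \<in> {k j / 2 ^ r j ..< (real (k j) + 1) / 2 ^ r j}}
        = {y. k j / 2 ^ r j \<le> y $ j} \<inter> {y. y $ j < (real (k j) + 1) / 2 ^ r j}" by auto
    also have "\<dots> \<in> sets borel"
      by (intro sets.Int borel_closed borel_open closed_Collect_le open_Collect_less continuous_intros)
    finally show "{y :: real ^ 'd. y $ j \<in> {k j / 2 ^ r j ..< (real (k j) + 1) / 2 ^ r j}} \<in> sets borel" .
  qed auto
  finally have borel: "rect r k \<in> sets borel" .
  then have meas: "rect r k \<in> sets lebesgue" by simp
  show lm: "rect r k \<in> lmeasurable"
    using fmeasurableI2[OF lmeasurable_cbox sub(2) meas] .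
  have c: "measure lebesgue (cbox a b) = (\<Prod>j\<in>UNIV. b $ j - a $ j)"
    using content_cbox_cart[of a b] ab by (auto simp: interval_ne_empty_cart less_imp_le)
  have "measure lebesgue (box a b) = measure lebesgue (cbox a b)"
    by (simp add: measure_lborel_box_eq measure_lborel_cbox_eq)
  moreover have "measure lebesgue (box a b) \<le> measure lebesgue (rect r k)"
    by (rule measure_mono_fmeasurable[OF sub(1)]) (auto intro: lm)
  moreover have "measure lebesgue (rect r k) \<le> measure lebesgue (cbox a b)"
    by (rule measure_mono_fmeasurable[OF sub(2) meas]) simp
  ultimately have "measure lebesgue (rect r k) = (\<Prod>j\<in>UNIV. b $ j - a $ j)" using c by simp
  also have "\<dots> = (\<Prod>j\<in>UNIV. 1 / 2 ^ r j)"
    by (intro prod.cong refl) (simp add: a_def b_def diff_divide_distrib[symmetric])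
  also have "\<dots> = 1 / 2 ^ (\<Sum>j\<in>UNIV. r j)" by (simp add: prod_dividef power_sum)
  finally show "measure lebesgue (rect r k) = 1 / 2 ^ (\<Sum>j\<in>UNIV. r j)" .
qed

lemma dyadic_interval_unit:
  assumes "dyadic_interval I" "I \<subseteq> {0..1}"
  obtains r k :: nat where "k < 2 ^ r" "I = {k / 2 ^ r ..< (real k + 1) / 2 ^ r}"
proof -
  obtain j e :: int where I: "I = {of_int j * 2 powi e ..< (of_int j + 1) * 2 powi e}"
    using assms(1) by (auto simp: dyadic_interval_def)
  define w where "w = (2::real) powi e"
  have w: "w > 0" by (simp add: w_def)
  have lt: "of_int j * w < (of_int j + 1) * w" using w by (intro mult_strict_right_mono) auto
  have "of_int j * w \<in> I" using lt unfolding I w_def by simp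
  then have lo: "0 \<le> of_int j * w" using assms(2) by auto
  then have j0: "j \<ge> 0" using w by (simp add: zero_le_mult_iff)
  \<comment> \<open>The right endpoint does not belong to the half-open interval, so it is
    approached from below.\<close>
  have hi: "(of_int j + 1) * w \<le> 1"
  proof (rule dense_le_bounded[OF lt])
    fix t assume "of_int j * w < t" "t < (of_int j + 1) * w"
    then have "t \<in> I" unfolding I w_def by simp
    then show "t \<le> 1" using assms(2) by auto
  qed
  have "1 * w \<le> (of_int j + 1) * w" using j0 w by (intro mult_right_mono) auto
  then have w1: "w \<le> 1" using hi by simp
  have e0: "e \<le> 0"
  proof (rule ccontr)
    assume "\<not> e \<le> 0"
    then have "(2::real) powi e > 1" by (intro one_less_power_int) auto
    then show False using w1 by (simp add: w_def)
  qed
  define r where "r = nat (- e)"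
  define k where "k = nat j"
  have wr: "w = 1 / 2 ^ r" using e0 by (simp add: w_def r_def power_int_def inverse_eq_divide power_divide)
  have kj: "of_int j = real k" using j0 by (simp add: k_def)
  have "real k + 1 \<le> 2 ^ r" using hi unfolding wr kj by (simp add: field_simps)
  then have "k < 2 ^ r"
    by (metis add.commute less_eq_real_def linorder_not_less nat_less_real_le numeral_power_eq_of_nat_cancel_iff of_nat_numeral of_nat_power)
  moreover have "I = {k / 2 ^ r ..< (real k + 1) / 2 ^ r}" unfolding I w_def[symmetric] wr kj by simp
  ultimately show ?thesis by (rule that)
qed

lemma dyadic_interval_ratio: "dyadic_interval {real k / 2 ^ r ..< (real k + 1) / 2 ^ r}"
  unfolding dyadic_interval_def
  by (intro exI[of _ "int k"] exI[of _ "- int r"]) (simp add: power_int_minus divide_inverse)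

lemma dyadic_rectangles_eq:
  "dyadic_rectangles n = {rect r k | r k :: 'd::finite \<Rightarrow> nat. (\<Sum>j\<in>UNIV. r j) = n \<and> (\<forall>j. k j < 2 ^ r j)}"
proof (intro set_eqI iffI)
  fix R :: "(real ^ 'd) set" assume "R \<in> dyadic_rectangles n"
  then have R: "dyadic_rectangle R" "R \<subseteq> cbox 0 1" "measure lebesgue R = 1 / 2 ^ n"
    by (auto simp: dyadic_rectangles_def)
  obtain I where I: "\<And>j. dyadic_interval (I j)" "R = {x. \<forall>j. x $ j \<in> I j}"
    using R(1) by (auto simp: dyadic_rectangle_def)
  have ne: "I j \<noteq> {}" for j
    using dyadic_intervalE[OF I(1)[of j]] by (metis atLeastLessThan_empty_iff not_le)
  have "I j \<subseteq> {0..1}" for j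
  proof -
    have "I j = (\<lambda>x. x $ j) ` R" using side_box[of I j, OF ne] unfolding I(2) side_def by simp
    then show ?thesis using R(2) by (auto simp: mem_box_cart)
  qed
  then have "\<exists>r k. k < 2 ^ r \<and> I j = {real k / 2 ^ r ..< (real k + 1) / 2 ^ r}" for j
    using dyadic_interval_unit[OF I(1)] by metis
  then obtain r k where rk: "\<And>j. k j < 2 ^ r j" "\<And>j. I j = {real (k j) / 2 ^ r j ..< (real (k j) + 1) / 2 ^ r j}"
    by metis
  have Rr: "R = rect r k" unfolding I(2) rect_def rk(2) ..
  have "(1::real) / 2 ^ (\<Sum>j\<in>UNIV. r j) = 1 / 2 ^ n" using R(3) measure_rect(2)[of r k] Rr by simp
  then have "(\<Sum>j\<in>UNIV. r j) = n" by simp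
  then show "R \<in> {rect r k | r k. (\<Sum>j\<in>UNIV. r j) = n \<and> (\<forall>j. k j < 2 ^ r j)}"
    using Rr rk(1) by blast
next
  fix R :: "(real ^ 'd) set" assume "R \<in> {rect r k | r k. (\<Sum>j\<in>UNIV. r j) = n \<and> (\<forall>j. k j < 2 ^ r j)}"
  then obtain r k where R: "R = rect r k" "(\<Sum>j\<in>UNIV. r j) = n" "\<And>j. k j < 2 ^ r j" by auto
  have "dyadic_rectangle R"
    unfolding dyadic_rectangle_def R(1) rect_def using dyadic_interval_ratio
    by (intro exI[of _ "\<lambda>j. {real (k j) / 2 ^ r j ..< (real (k j) + 1) / 2 ^ r j}"]) simp
  moreover have "R \<subseteq> cbox 0 1"
  proof
    fix y assume y: "y \<in> R"
    have "0 \<le> y $ j \<and> y $ j \<le> 1" for j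
    proof -
      have h: "real (k j) / 2 ^ r j \<le> y $ j" "y $ j < (real (k j) + 1) / 2 ^ r j"
        using y by (auto simp: R(1) rect_def)
      have "real (Suc (k j)) \<le> real (2 ^ r j)" using R(3)[of j] by (intro of_nat_mono) simp
      then have "(real (k j) + 1) / 2 ^ r j \<le> 1" by simp
      moreover have "0 \<le> real (k j) / 2 ^ r j" by simp
      ultimately show ?thesis using h by linarith
    qed
    then show "y \<in> cbox 0 1" by (simp add: mem_box_cart)
  qed
  ultimately show "R \<in> dyadic_rectangles n"
    using R(2) measure_rect(2)[of r k] by (simp add: dyadic_rectangles_def R(1))
qed

text \<open>Both endpoints and the midpoint of the interval are multiples of
  \<open>1 / 2 ^ Suc n\<close>, hence comparing \<open>y\<close> with them is comparing natural
  numbers with the cell index \<open>x\<close>. The extra binary digit in \<open>Suc n\<close>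
  resolves the halves of intervals of length \<open>1 / 2 ^ n\<close>.\<close>

lemma haar_interval_cell:
  assumes y: "y \<in> {real x / 2 ^ Suc n ..< (real x + 1) / 2 ^ Suc n}" and r: "r \<le> n"
  shows "haar_interval {real k / 2 ^ r ..< (real k + 1) / 2 ^ r} y =
     (if x div 2 ^ (Suc n - r) = k then if bit x (n - r) then 1 else -1 else 0)"
proof -
  define s where "s = n - r"
  have n: "n = r + s" using r by (simp add: s_def)
  define z where "z = y * 2 ^ Suc n"
  have z: "real x \<le> z" "z < real x + 1" using y by (auto simp: z_def pos_divide_le_eq pos_less_divide_eq)
  have cmp: "real b \<le> z \<longleftrightarrow> b \<le> x" for b :: nat using z by linarith
  have cmp': "z < real b \<longleftrightarrow> x < b" for b :: nat using cmp[of b] by linarith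
  have lt: "real k / 2 ^ r < (real k + 1) / 2 ^ r" by (simp add: divide_strict_right_mono)
  have e: "(2::real) ^ Suc n = 2 ^ r * (2 * 2 ^ s)" by (simp add: n power_add)
  have lo: "real k / 2 ^ r \<le> y \<longleftrightarrow> k * (2 * 2 ^ s) \<le> x"
  proof -
    have "real k / 2 ^ r \<le> y \<longleftrightarrow> real (k * (2 * 2 ^ s)) \<le> z"
      unfolding z_def e by (simp add: pos_divide_le_eq mult.assoc[symmetric])
    then show ?thesis by (simp only: cmp)
  qed
  have hi: "y < (real k + 1) / 2 ^ r \<longleftrightarrow> x < (k + 1) * (2 * 2 ^ s)"
  proof -
    have "y < (real k + 1) / 2 ^ r \<longleftrightarrow> y * 2 ^ r < real k + 1" by (simp add: pos_less_divide_eq)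
    also have "\<dots> \<longleftrightarrow> y * 2 ^ r * (2 * 2 ^ s) < (real k + 1) * (2 * 2 ^ s)"
      by (rule mult_less_cancel_right_pos[symmetric]) simp
    also have "\<dots> \<longleftrightarrow> z < real ((k + 1) * (2 * 2 ^ s))"
      by (simp only: z_def e of_nat_mult of_nat_add of_nat_1 of_nat_power of_nat_numeral mult.assoc)
    finally have "y < (real k + 1) / 2 ^ r \<longleftrightarrow> z < real ((k + 1) * (2 * 2 ^ s))" .
    then show ?thesis by (simp only: cmp')
  qed
  have mid: "(real k / 2 ^ r + (real k + 1) / 2 ^ r) / 2 \<le> y \<longleftrightarrow> (2 * k + 1) * 2 ^ s \<le> x"
  proof -
    have "(real k / 2 ^ r + (real k + 1) / 2 ^ r) / 2 = (2 * real k + 1) / (2 * 2 ^ r)"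
      by (simp add: field_simps)
    then have "(real k / 2 ^ r + (real k + 1) / 2 ^ r) / 2 \<le> y \<longleftrightarrow> 2 * real k + 1 \<le> y * (2 * 2 ^ r)"
      by (simp only: pos_divide_le_eq zero_less_mult_iff zero_less_numeral zero_less_power simp_thms)
    also have "\<dots> \<longleftrightarrow> (2 * real k + 1) * 2 ^ s \<le> y * (2 * 2 ^ r) * 2 ^ s"
      by (rule mult_le_cancel_right_pos[symmetric]) simp
    also have "y * (2 * 2 ^ r) * 2 ^ s = z" unfolding z_def e by (simp add: mult_ac)
    also have "(2 * real k + 1) * 2 ^ s = real ((2 * k + 1) * 2 ^ s)"
      by (simp add: distrib_right)
    finally have "(real k / 2 ^ r + (real k + 1) / 2 ^ r) / 2 \<le> y \<longleftrightarrow> real ((2 * k + 1) * 2 ^ s) \<le> z" .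
    then show ?thesis by (simp only: cmp)
  qed
  have dv: "x div 2 ^ (Suc n - r) = k \<longleftrightarrow> k * (2 * 2 ^ s) \<le> x \<and> x < (k + 1) * (2 * 2 ^ s)"
  proof -
    have b: "2 ^ (Suc n - r) = (2 * 2 ^ s :: nat)" by (simp add: n)
    have "x div (2 * 2 ^ s) = k \<longleftrightarrow> k \<le> x div (2 * 2 ^ s) \<and> x div (2 * 2 ^ s) < k + 1" by auto
    also have "\<dots> \<longleftrightarrow> k * (2 * 2 ^ s) \<le> x \<and> x < (k + 1) * (2 * 2 ^ s)"
      by (intro arg_cong2[where f = conj] less_eq_div_iff_mult_less_eq div_less_iff_less_mult) auto
    finally show ?thesis unfolding b .
  qed
  have bt: "bit x (n - r) \<longleftrightarrow> (2 * k + 1) * 2 ^ s \<le> x" if "x div 2 ^ (Suc n - r) = k"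
  proof -
    have "x div 2 ^ (Suc n - r) = (x div 2 ^ s) div 2"
    proof -
      have "2 ^ (Suc n - r) = (2 ^ s * 2 :: nat)" by (simp add: n)
      then show ?thesis by (simp only: div_mult2_eq)
    qed
    then have k: "k = (x div 2 ^ s) div 2" using that by simp
    have od: "odd a \<longleftrightarrow> 2 * (a div 2) + 1 \<le> a" for a :: nat by presburger
    have "bit x (n - r) \<longleftrightarrow> odd (x div 2 ^ s)" by (simp add: bit_iff_odd n)
    also have "\<dots> \<longleftrightarrow> 2 * k + 1 \<le> x div 2 ^ s" unfolding k by (rule od)
    also have "\<dots> \<longleftrightarrow> (2 * k + 1) * 2 ^ s \<le> x" by (simp add: less_eq_div_iff_mult_less_eq)
    finally show ?thesis .
  qed
  show ?thesis
    unfolding haar_interval_def halves_atLeastLessThan[OF lt]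
    using lo hi mid dv bt by (auto simp: indicator_def)
qed

lemma haar_rect_cell:
  assumes "y \<in> cube (Suc n) x" "\<And>j. r j \<le> n"
  shows "haar (rect r k) y = (\<Prod>j\<in>UNIV. if x j div 2 ^ (Suc n - r j) = k j
           then if bit (x j) (n - r j) then 1 else -1 else 0)"
  unfolding haar_def side_rect
  using assms by (intro prod.cong refl haar_interval_cell) (auto simp: cube_def)

section \<open>Rectangles of given shape and the r-functions\<close>

definition compositions :: "nat \<Rightarrow> ('d::finite \<Rightarrow> nat) set" where
  "compositions n = {r. (\<Sum>j\<in>UNIV. r j) = n}"

lemma compositions_le: "r \<in> compositions n \<Longrightarrow> r j \<le> n"
  unfolding compositions_def using member_le_sum[of j UNIV r] by auto

lemma finite_bounded_funs: "finite {r :: 'd::finite \<Rightarrow> nat. \<forall>j. r j \<le> B}"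
proof -
  have "{r :: 'd \<Rightarrow> nat. \<forall>j. r j \<le> B} = (\<Pi>\<^sub>E j\<in>UNIV. {..B})" by (auto simp: PiE_def Pi_def)
  then show ?thesis by (simp add: finite_PiE)
qed

lemma finite_compositions: "finite (compositions n :: ('d::finite \<Rightarrow> nat) set)"
  by (rule finite_subset[OF _ finite_bounded_funs[of n]]) (auto intro: compositions_le)

text \<open>The one dyadic rectangle with side exponents \<open>r\<close> that contains the grid
  cell \<open>x\<close>.\<close>

definition ancestor :: "nat \<Rightarrow> ('d::finite \<Rightarrow> nat) \<Rightarrow> ('d \<Rightarrow> nat) \<Rightarrow> (real ^ 'd) set" where
  "ancestor n r x = rect r (\<lambda>j. x j div 2 ^ (Suc n - r j))"

text \<open>The r-function of discrepancy theory: the signed sum of the Haar functions of all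
  rectangles of shape \<open>r\<close>, evaluated on a grid cell, where only the ancestor
  contributes.\<close>

definition r_function :: "nat \<Rightarrow> ((real ^ 'd::finite) set \<Rightarrow> real) \<Rightarrow> ('d \<Rightarrow> nat) \<Rightarrow> ('d \<Rightarrow> nat) \<Rightarrow> real" where
  "r_function n \<alpha> r x = \<alpha> (ancestor n r x) * (\<Prod>j\<in>UNIV. if bit (x j) (n - r j) then 1 else -1)"

lemma ancestor_in:
  assumes "r \<in> compositions n" "\<And>j. x j < 2 ^ Suc n"
  shows "ancestor n r x \<in> dyadic_rectangles n"
proof -
  have "x j div 2 ^ (Suc n - r j) < 2 ^ r j" for j
  proof -
    have "(2::nat) ^ r j * 2 ^ (Suc n - r j) = 2 ^ Suc n"
      using compositions_le[OF assms(1), of j] by (simp add: power_add[symmetric])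
    then show ?thesis using assms(2)[of j] by (simp add: less_mult_imp_div_less)
  qed
  then show ?thesis
    unfolding dyadic_rectangles_eq ancestor_def using assms(1) unfolding compositions_def by blast
qed

lemma rect_inject:
  assumes "rect r k = rect r' k'" shows "r = r'"
proof
  fix j
  have "{real (k j) / 2 ^ r j ..< (real (k j) + 1) / 2 ^ r j} = {real (k' j) / 2 ^ r' j ..< (real (k' j) + 1) / 2 ^ r' j}"
    using arg_cong[OF assms, of "\<lambda>R. side R j"] unfolding side_rect .
  then have "real (k j) / 2 ^ r j = real (k' j) / 2 ^ r' j" "(real (k j) + 1) / 2 ^ r j = (real (k' j) + 1) / 2 ^ r' j"
    using Ico_eq_Ico half_open_ne by (metis atLeastLessThan_empty_iff)+
  then have "(1::real) / 2 ^ r j = 1 / 2 ^ r' j" by (simp add: add_divide_distrib)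
  then show "r j = r' j" by simp
qed

lemma sum_haar_cell:
  fixes x :: "'d::finite \<Rightarrow> nat"
  assumes y: "y \<in> cube (Suc n) x" and x: "\<And>j. x j < 2 ^ Suc n"
  shows "(\<Sum>R\<in>dyadic_rectangles n. \<alpha> R * haar R y) = (\<Sum>r\<in>compositions n. r_function n \<alpha> r x)"
proof -
  let ?g = "\<lambda>r. ancestor n r x"
  \<comment> \<open>Finiteness has to be established first, since a sum over an infinite set would
    be 0 by convention.\<close>
  have "dyadic_rectangles n \<subseteq> (\<lambda>(r, k). rect r k) `
      ({r. \<forall>j. r j \<le> n} \<times> {k :: 'd \<Rightarrow> nat. \<forall>j. k j \<le> 2 ^ n})"
  proof
    fix R :: "(real ^ 'd) set" assume "R \<in> dyadic_rectangles n"
    then obtain r k where R: "R = rect r k" "r \<in> compositions n" "\<And>j. k j < 2 ^ r j"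
      unfolding dyadic_rectangles_eq compositions_def by blast
    have "k j \<le> 2 ^ n" for j
    proof -
      have "k j < 2 ^ r j" by (rule R(3))
      also have "\<dots> \<le> 2 ^ n" using compositions_le[OF R(2), of j] by (intro power_increasing) auto
      finally show ?thesis by simp
    qed
    then show "R \<in> (\<lambda>(r, k). rect r k) ` ({r. \<forall>j. r j \<le> n} \<times> {k :: 'd \<Rightarrow> nat. \<forall>j. k j \<le> 2 ^ n})"
      using R(1) compositions_le[OF R(2)] by (intro image_eqI[of _ _ "(r, k)"]) auto
  qed
  then have fin: "finite (dyadic_rectangles n :: (real ^ 'd) set set)"
    by (rule finite_subset) (intro finite_imageI finite_cartesian_product finite_bounded_funs)
  have inj: "inj_on ?g (compositions n)"
    by (rule inj_onI) (auto simp: ancestor_def dest: rect_inject)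
  have "(\<Sum>R\<in>dyadic_rectangles n. \<alpha> R * haar R y) = (\<Sum>R\<in>?g ` compositions n. \<alpha> R * haar R y)"
  proof (rule sum.mono_neutral_right[OF fin])
    show "?g ` compositions n \<subseteq> dyadic_rectangles n" using ancestor_in x by auto
    show "\<forall>R\<in>dyadic_rectangles n - ?g ` compositions n. \<alpha> R * haar R y = 0"
    proof
      fix R assume R': "R \<in> dyadic_rectangles n - ?g ` compositions n"
      then obtain r k where R: "R = rect r k" "r \<in> compositions n"
        unfolding dyadic_rectangles_eq compositions_def by blast
      have "\<exists>j. x j div 2 ^ (Suc n - r j) \<noteq> k j"
      proof (rule ccontr)
        assume "\<not> ?thesis"
        then have "(\<lambda>j. x j div 2 ^ (Suc n - r j)) = k" by auto
        then have "R = ?g r" by (simp add: R(1) ancestor_def)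
        then show False using R' R(2) by auto
      qed
      then obtain j where j: "x j div 2 ^ (Suc n - r j) \<noteq> k j" by blast
      have "haar R y = 0"
        unfolding R(1) haar_rect_cell[OF y compositions_le[OF R(2)]]
        using j by (intro prod_zero) (auto intro!: bexI[of _ j])
      then show "\<alpha> R * haar R y = 0" by simp
    qed
  qed
  also have "\<dots> = (\<Sum>r\<in>compositions n. \<alpha> (?g r) * haar (?g r) y)"
    by (rule sum.reindex_cong[OF inj]) auto
  also have "\<dots> = (\<Sum>r\<in>compositions n. r_function n \<alpha> r x)"
  proof (intro sum.cong refl)
    fix r assume r: "r \<in> (compositions n :: ('d \<Rightarrow> nat) set)"
    show "\<alpha> (?g r) * haar (?g r) y = r_function n \<alpha> r x"
      unfolding r_function_def unfolding ancestor_def haar_rect_cell[OF y compositions_le[OF r]] by simp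
  qed
  finally show ?thesis .
qed

section \<open>Bit flips acting on the grid\<close>

lemma flip_bit_flip_bit: "flip_bit k (flip_bit k a) = (a :: nat)"
  by (rule bit_eqI) (auto simp: bit_flip_bit_iff)

lemma flip_bit_less: "k \<le> n \<Longrightarrow> a < 2 ^ Suc n \<Longrightarrow> flip_bit k a < (2 ^ Suc n :: nat)"
  by (metis take_bit_flip_bit_eq take_bit_nat_eq_self_iff not_less_eq_eq)

lemma flip_bit_div:
  assumes "k < s" shows "flip_bit k a div 2 ^ s = a div (2 ^ s :: nat)"
proof -
  have "drop_bit s (flip_bit k a) = drop_bit s a"
    using assms by (intro bit_eqI) (auto simp: bit_drop_bit_eq bit_flip_bit_iff)
  then show ?thesis by (simp add: drop_bit_eq_div)
qed

definition grid :: "nat \<Rightarrow> ('d::finite \<Rightarrow> nat) set" where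
  "grid n = {x. \<forall>j. x j < 2 ^ Suc n}"

text \<open>The bit of level \<open>u\<close>, i.e. the one deciding between the halves of a dyadic interval of
  length \<open>2 powi (-u)\<close>, is the binary digit number \<open>n - u\<close> of a grid point.\<close>

definition flip_level :: "nat \<Rightarrow> (nat \<Rightarrow> 'd) \<Rightarrow> nat \<Rightarrow> nat \<Rightarrow> ('d::finite \<Rightarrow> nat) \<Rightarrow> 'd \<Rightarrow> nat" where
  "flip_level n \<phi> i u x = (if u \<le> n then x(\<phi> i := flip_bit (n - u) (x (\<phi> i))) else x)"

lemma flip_space_grid:
  assumes "L \<ge> 1" "p \<ge> 1"
  shows "flip_space (grid n :: ('d::finite \<Rightarrow> nat) set) (flip_level n \<phi>) L p"
proof
  have "grid n \<subseteq> {x :: 'd \<Rightarrow> nat. \<forall>j. x j \<le> 2 ^ Suc n}" by (auto simp: grid_def intro: less_imp_le)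
  then show "finite (grid n :: ('d \<Rightarrow> nat) set)" by (rule finite_subset[OF _ finite_bounded_funs])
  have "(\<lambda>_. 0) \<in> (grid n :: ('d \<Rightarrow> nat) set)" by (simp add: grid_def)
  then show "grid n \<noteq> ({} :: ('d \<Rightarrow> nat) set)" by blast
  fix x :: "'d \<Rightarrow> nat" and i j
  assume x: "x \<in> grid n"
  show "flip_level n \<phi> i j x \<in> grid n"
    using x flip_bit_less[of "n - j" n] by (auto simp: grid_def flip_level_def simp del: power_Suc)
  show "flip_level n \<phi> i j (flip_level n \<phi> i j x) = x"
    by (auto simp: flip_level_def flip_bit_flip_bit)
qed (use assms in auto)

lemma r_function_flip_same:
  assumes r: "r \<in> compositions n"
  shows "r_function n \<alpha> r (flip_level n \<phi> i (r (\<phi> i)) x) = - r_function n \<alpha> r x"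
proof -
  let ?j = "\<phi> i"
  let ?x = "x(?j := flip_bit (n - r ?j) (x ?j))"
  let ?s = "\<lambda>x j. if bit (x j) (n - r j) then 1 else - 1 :: real"
  have le: "r ?j \<le> n" using compositions_le[OF r] .
  have x: "flip_level n \<phi> i (r ?j) x = ?x" using le by (simp add: flip_level_def)
  have "?x j div 2 ^ (Suc n - r j) = x j div 2 ^ (Suc n - r j)" for j
    using flip_bit_div[of "n - r ?j" "Suc n - r ?j"] le by (cases "j = ?j") auto
  then have a: "ancestor n r ?x = ancestor n r x" by (simp only: ancestor_def)
  have "(\<Prod>j\<in>UNIV. ?s ?x j) = ?s ?x ?j * (\<Prod>j\<in>UNIV - {?j}. ?s ?x j)"
    by (rule prod.remove) auto
  also have "(\<Prod>j\<in>UNIV - {?j}. ?s ?x j) = (\<Prod>j\<in>UNIV - {?j}. ?s x j)"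
    by (intro prod.cong) auto
  also have "?s ?x ?j = - ?s x ?j" by (simp add: bit_flip_bit_iff)
  also have "- ?s x ?j * (\<Prod>j\<in>UNIV - {?j}. ?s x j) = - (\<Prod>j\<in>UNIV. ?s x j)"
    using prod.remove[of UNIV ?j "?s x"] by simp
  finally show ?thesis unfolding r_function_def x a by simp
qed

lemma r_function_flip_finer:
  assumes r: "r \<in> compositions n" and u: "u > r (\<phi> i)"
  shows "r_function n \<alpha> r (flip_level n \<phi> i u x) = r_function n \<alpha> r x"
proof (cases "u \<le> n")
  case True
  let ?j = "\<phi> i"
  let ?x = "x(?j := flip_bit (n - u) (x ?j))"
  have x: "flip_level n \<phi> i u x = ?x" using True by (simp add: flip_level_def)
  have "?x j div 2 ^ (Suc n - r j) = x j div 2 ^ (Suc n - r j)" for j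
    using flip_bit_div[of "n - u" "Suc n - r ?j"] True u by (cases "j = ?j") auto
  then have a: "ancestor n r ?x = ancestor n r x" by (simp only: ancestor_def)
  have "bit (?x j) (n - r j) = bit (x j) (n - r j)" for j
    using True u by (cases "j = ?j") (auto simp: bit_flip_bit_iff)
  then show ?thesis unfolding r_function_def x a by simp
qed (simp add: flip_level_def)

lemma r_function_md:
  assumes "(L :: nat) \<ge> 1" "(p :: real) \<ge> 1" "r \<in> compositions n"
  shows "flip_space.martingale_diff (grid n) (flip_level n \<phi>) i (r (\<phi> i)) (r_function n \<alpha> r)"
proof -
  interpret flip_space "grid n" "flip_level n \<phi>" L p by (rule flip_space_grid[OF assms(1,2)])
  show ?thesis
    using r_function_flip_same[OF assms(3)] r_function_flip_finer[OF assms(3)] by (simp add: martingale_diff_def)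
qed

lemma abs_r_function:
  assumes "\<forall>R\<in>dyadic_rectangles n. \<alpha> R \<in> {-1, 1}" "r \<in> compositions n" "x \<in> grid n"
  shows "\<bar>r_function n \<alpha> r x\<bar> = 1"
proof -
  have "ancestor n r x \<in> dyadic_rectangles n" using ancestor_in[OF assms(2)] assms(3) by (auto simp: grid_def)
  then have "\<bar>\<alpha> (ancestor n r x)\<bar> = 1" using assms(1) by auto
  moreover have "\<bar>\<Prod>j\<in>UNIV. if bit (x j) (n - r j) then 1 else -1 :: real\<bar> = 1"
    unfolding abs_prod by (intro prod.neutral) auto
  ultimately show ?thesis by (simp add: r_function_def abs_mult)
qed

section \<open>Free exponents and passage to the essential supremum\<close>

definition extend :: "nat \<Rightarrow> (nat \<Rightarrow> 'd::finite) \<Rightarrow> (nat \<Rightarrow> nat) \<Rightarrow> 'd \<Rightarrow> nat" where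
  "extend n \<phi> q j = (let i = inv_into {..<CARD('d)} \<phi> j in
     if i < CARD('d) - 1 then q i else n - (\<Sum>i<CARD('d) - 1. q i))"

lemma extend_apply:
  fixes \<phi> :: "nat \<Rightarrow> 'd::finite"
  assumes "bij_betw \<phi> {..<CARD('d)} UNIV"
  shows "i < CARD('d) - 1 \<Longrightarrow> extend n \<phi> q (\<phi> i) = q i"
    and "extend n \<phi> q (\<phi> (CARD('d) - 1)) = n - (\<Sum>i<CARD('d) - 1. q i)"
proof -
  have inj: "inj_on \<phi> {..<CARD('d)}" using assms by (rule bij_betw_imp_inj_on)
  show "extend n \<phi> q (\<phi> i) = q i" if "i < CARD('d) - 1"
    using inv_into_f_f[OF inj, of i] that by (simp add: extend_def)
  have "CARD('d) - 1 < CARD('d)" by simp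
  then show "extend n \<phi> q (\<phi> (CARD('d) - 1)) = n - (\<Sum>i<CARD('d) - 1. q i)"
    using inv_into_f_f[OF inj, of "CARD('d) - 1"] by (simp add: extend_def)
qed

lemma sum_UNIV_split:
  fixes \<phi> :: "nat \<Rightarrow> 'd::finite" and r :: "'d \<Rightarrow> nat"
  assumes "bij_betw \<phi> {..<CARD('d)} UNIV"
  shows "(\<Sum>j\<in>UNIV. r j) = (\<Sum>i<CARD('d) - 1. r (\<phi> i)) + r (\<phi> (CARD('d) - 1))"
proof -
  have "(\<Sum>j\<in>UNIV. r j) = (\<Sum>i<CARD('d). r (\<phi> i))"
    by (rule sum.reindex_bij_betw[OF assms, symmetric])
  also have "CARD('d) = Suc (CARD('d) - 1)" by simp
  finally show ?thesis by (simp only: sum.lessThan_Suc)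
qed

text \<open>The volume fixes the last exponent. Since the first ones add up to at most
  \<open>(CARD('d) - 1) * m \<le> n\<close>, the subtraction in \<open>extend\<close> is exact, and
  every choice of first exponents below \<open>m\<close> occurs.\<close>

lemma truncated_compositions:
  fixes \<phi> :: "nat \<Rightarrow> 'd::finite"
  assumes \<phi>: "bij_betw \<phi> {..<CARD('d)} UNIV" and mn: "(CARD('d) - 1) * m \<le> n"
  shows "bij_betw (extend n \<phi>) (\<Pi>\<^sub>E i\<in>{..<CARD('d) - 1}. {..<m})
           {r \<in> compositions n. \<forall>i\<in>{..<CARD('d) - 1}. r (\<phi> i) < m}"
proof (rule bij_betw_byWitness[where f' = "\<lambda>r. restrict (\<lambda>i. r (\<phi> i)) {..<CARD('d) - 1}"])
  let ?d = "CARD('d) - 1"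
  let ?B = "\<Pi>\<^sub>E i\<in>{..<?d}. {..<m}"
  note ext = extend_apply[OF \<phi>]
  show "\<forall>q\<in>?B. restrict (\<lambda>i. extend n \<phi> q (\<phi> i)) {..<?d} = q"
    using ext(1) by (auto simp: fun_eq_iff PiE_iff extensional_def)
  show "\<forall>r\<in>{r \<in> compositions n. \<forall>i\<in>{..<?d}. r (\<phi> i) < m}. extend n \<phi> (restrict (\<lambda>i. r (\<phi> i)) {..<?d}) = r"
  proof
    fix r :: "'d \<Rightarrow> nat" assume "r \<in> {r \<in> compositions n. \<forall>i\<in>{..<?d}. r (\<phi> i) < m}"
    then have s: "(\<Sum>i<?d. r (\<phi> i)) + r (\<phi> ?d) = n"
      using sum_UNIV_split[OF \<phi>, of r] by (simp add: compositions_def)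
    show "extend n \<phi> (restrict (\<lambda>i. r (\<phi> i)) {..<?d}) = r"
    proof
      fix j
      obtain i where i: "i < CARD('d)" "j = \<phi> i"
        using bij_betw_imp_surj_on[OF \<phi>] by auto
      show "extend n \<phi> (restrict (\<lambda>i. r (\<phi> i)) {..<?d}) j = r j"
      proof (cases "i = ?d")
        case True
        have "(\<Sum>i<?d. restrict (\<lambda>i. r (\<phi> i)) {..<?d} i) = (\<Sum>i<?d. r (\<phi> i))" by (intro sum.cong) auto
        then show ?thesis using True i ext(2) s by simp
      next
        case False
        then have "i < ?d" using i by simp
        then show ?thesis using i ext(1) by simp
      qed
    qed
  qed
  show "extend n \<phi> ` ?B \<subseteq> {r \<in> compositions n. \<forall>i\<in>{..<?d}. r (\<phi> i) < m}"
  proof clarify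
    fix q assume q: "q \<in> ?B"
    have "(\<Sum>i<?d. q i) \<le> of_nat (card {..<?d}) * m"
      by (rule sum_bounded_above) (use q in \<open>auto simp: PiE_iff intro: less_imp_le\<close>)
    then have "(\<Sum>i<?d. q i) \<le> n" using mn by simp
    moreover have "(\<Sum>i<?d. extend n \<phi> q (\<phi> i)) = (\<Sum>i<?d. q i)" using ext(1) by (intro sum.cong) auto
    ultimately have "extend n \<phi> q \<in> compositions n"
      using sum_UNIV_split[OF \<phi>, of "extend n \<phi> q"] ext(2)[of n q] by (simp add: compositions_def)
    moreover have "extend n \<phi> q (\<phi> i) < m" if "i < ?d" for i
      using ext(1)[OF that] q that by (auto simp: PiE_iff)
    ultimately show "extend n \<phi> q \<in> compositions n \<and> (\<forall>i\<in>{..<?d}. extend n \<phi> q (\<phi> i) < m)" by auto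
  qed
  show "(\<lambda>r. restrict (\<lambda>i. r (\<phi> i)) {..<?d}) ` {r \<in> compositions n. \<forall>i\<in>{..<?d}. r (\<phi> i) < m} \<subseteq> ?B"
    by (rule image_subsetI) (simp only: restrict_PiE_iff mem_Collect_eq lessThan_iff Ball_def, blast)
qed

text \<open>Carries \<open>sup_lower_bound\<close> over to the truncated sum on the grid. The
  numerical hypotheses are the three clauses of \<open>parameters_exist\<close> at
  \<open>x = 2 ^ L\<close> with \<open>p = x powr \<kappa>\<close>.\<close>

lemma grid_bound:
  fixes \<phi> :: "nat \<Rightarrow> 'd::finite" and \<alpha> :: "(real ^ 'd) set \<Rightarrow> real" and p :: real
  defines "d \<equiv> CARD('d)"
  assumes \<phi>: "bij_betw \<phi> {..<CARD('d)} UNIV" and d2: "CARD('d) \<ge> 2"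
    and \<alpha>: "\<forall>R\<in>dyadic_rectangles n. \<alpha> R \<in> {-1, 1}"
    and M: "\<And>x. x \<in> grid n \<Longrightarrow> \<bar>\<Sum>r\<in>compositions n. r_function n \<alpha> r x\<bar> \<le> M"
    and L: "L \<ge> 1" and p: "p \<ge> 1" and mn: "(d - 1) * 2 ^ L \<le> n"
    and c1: "(324 * p * real L ^ 2) ^ (d - 2) * sqrt (324 * p * real L ^ 2) * (2 ^ L) ^ (d - 1) / sqrt (sqrt (2 ^ L))
        \<le> (2 ^ L) ^ (d - 1) / 2"
    and c2: "8 * p * (2 * (4 * p * 2 ^ L) ^ (d - 2)) \<le> (2 ^ L) ^ (d - 1)"
    and c3: "(2 ^ L) ^ (d * (10 * (d - 1) + 25)) + 1 \<le> exp (p / 2)"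
  shows "sqrt p * sqrt ((2 ^ L) ^ (d - 1)) / (2 * sqrt 8) \<le> M"
proof -
  interpret flip_space "grid n" "flip_level n \<phi>" L p "d - 1" by (rule flip_space_grid[OF L p])
  let ?S = "{..<d - 1}"
  let ?F = "\<lambda>q. r_function n \<alpha> (extend n \<phi> q)"
  have bij: "bij_betw (extend n \<phi>) (box ?S) {r \<in> compositions n. \<forall>i\<in>?S. r (\<phi> i) < m}"
    using truncated_compositions[OF \<phi>, of m n] mn by (simp add: box_def d_def m_def)
  have comp: "extend n \<phi> q \<in> compositions n" if "q \<in> box ?S" for q
    using bij_betw_apply[OF bij that] by simp
  have tr: "\<forall>x\<in>grid n. \<bar>\<Sum>r\<in>{r \<in> compositions n. \<forall>i\<in>?S. r (\<phi> i) < m}. r_function n \<alpha> r x\<bar> \<le> M"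
    by (rule truncate[where e = "\<lambda>i r. r (\<phi> i)"])
       (auto intro: finite_compositions r_function_md[OF L p] M)
  have sum_le: "(\<Sum>q\<in>box ?S. ?F q x) \<le> M" if "x \<in> grid n" for x
    using tr that sum.reindex_bij_betw[OF bij, of "\<lambda>r. r_function n \<alpha> r x"] by fastforce
  have ext: "extend n \<phi> q (\<phi> i) = q i" if "i < d - 1" for q i
    using extend_apply(1)[OF \<phi>] that by (simp add: d_def)
  have ext': "extend n \<phi> q (\<phi> (d - 1)) = n - (\<Sum>i\<in>?S. q i)" for q
    using extend_apply(2)[OF \<phi>] by (simp add: d_def)
  have admissible: "admissible ?S n ?F"
    unfolding admissible_def
  proof (intro conjI ballI)
    show "card ?S * m \<le> n" using mn by (simp add: m_def)
    fix q assume q: "q \<in> box ?S"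
    show "\<bar>?F q x\<bar> \<le> 1" if "x \<in> grid n" for x
      using abs_r_function[OF \<alpha> comp[OF q] that] by simp
    show "martingale_diff i (q i) (?F q)" if "i \<in> ?S" for i
      using r_function_md[OF L p comp[OF q], of \<phi> i \<alpha>] ext[of i q] that by simp
    show "martingale_diff (d - 1) (n - (\<Sum>i\<in>?S. q i)) (?F q)"
      using r_function_md[OF L p comp[OF q], of \<phi> "d - 1" \<alpha>] ext'[of q] by simp
  qed
  have "0 \<in> ?S" using d2 by (simp add: d_def)
  have "sqrt p * sqrt (real m ^ card ?S) / (2 * sqrt 8) \<le> M"
  proof (rule sup_lower_bound[OF _ \<open>0 \<in> ?S\<close> admissible _ sum_le])
    have d1: "d - 1 - 1 = d - 2" "d - 1 + 1 = d" using d2 by (auto simp: d_def)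
    show "\<bar>?F q x\<bar> = 1" if "q \<in> box ?S" "x \<in> grid n" for q x
      using abs_r_function[OF \<alpha> comp[OF that(1)] that(2)] .
    show "gain_bound (card ?S - 1) (card ?S) \<le> real m ^ card ?S / 2"
      using c1 d1 by (simp add: gain_bound_def D_def m_def)
    show "8 * p * (2 * (4 * p * real m) ^ (card ?S - 1)) \<le> real m ^ card ?S"
      using c2 d1 by (simp add: m_def)
    show "real m ^ ((card ?S + 1) * (10 * card ?S + 25)) + 1 \<le> exp (p / 2)"
      using c3 d1 by (simp add: m_def)
  qed simp
  then show ?thesis by (simp add: m_def)
qed

text \<open>Covers the finitely many small \<open>n\<close>. Truncation at 1 leaves only the
  composition with all of \<open>n\<close> in one coordinate, whose r-function has modulus
  one.\<close>

lemma grid_bound_one: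
  fixes \<phi> :: "nat \<Rightarrow> 'd::finite" and \<alpha> :: "(real ^ 'd) set \<Rightarrow> real"
  assumes \<phi>: "bij_betw \<phi> {..<CARD('d)} UNIV"
    and \<alpha>: "\<forall>R\<in>dyadic_rectangles n. \<alpha> R \<in> {-1, 1}"
    and M: "\<And>x. x \<in> grid n \<Longrightarrow> \<bar>\<Sum>r\<in>compositions n. r_function n \<alpha> r x\<bar> \<le> M"
  shows "1 \<le> M"
proof -
  interpret flip_space "grid n" "flip_level n \<phi>" 1 1 0 by (rule flip_space_grid) auto
  let ?d = "CARD('d) - 1"
  define r\<^sub>0 where "r\<^sub>0 j = (if j = \<phi> ?d then n else 0)" for j
  have tr: "\<forall>x\<in>grid n. \<bar>\<Sum>r\<in>{r \<in> compositions n. \<forall>i\<in>{..<?d}. r (\<phi> i) < 1}. r_function n \<alpha> r x\<bar> \<le> M"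
    by (rule truncate[where e = "\<lambda>i r. r (\<phi> i)"])
       (auto intro: finite_compositions r_function_md[of 1 1] M)
  have r0: "r\<^sub>0 \<in> compositions n" by (simp add: compositions_def r\<^sub>0_def)
  have "{r \<in> compositions n. \<forall>i\<in>{..<?d}. r (\<phi> i) < 1} = {r\<^sub>0}"
  proof (intro equalityI subsetI)
    fix r assume "r \<in> {r \<in> compositions n. \<forall>i\<in>{..<?d}. r (\<phi> i) < 1}"
    then have r: "(\<Sum>j\<in>UNIV. r j) = n" "\<And>i. i < ?d \<Longrightarrow> r (\<phi> i) = 0" by (auto simp: compositions_def)
    have "r j = r\<^sub>0 j" for j
    proof -
      obtain i where i: "i < CARD('d)" "j = \<phi> i" using bij_betw_imp_surj_on[OF \<phi>] by auto
      show ?thesis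
      proof (cases "i = ?d")
        case True
        then show ?thesis using sum_UNIV_split[OF \<phi>, of r] r i by (simp add: r\<^sub>0_def)
      next
        case False
        then have "i < ?d" using i by simp
        moreover have "\<phi> i \<noteq> \<phi> ?d"
          using False i bij_betw_imp_inj_on[OF \<phi>] by (auto dest: inj_onD)
        ultimately show ?thesis using r(2) i by (simp add: r\<^sub>0_def)
      qed
    qed
    then show "r \<in> {r\<^sub>0}" by auto
  next
    fix r assume "r \<in> {r\<^sub>0}"
    moreover have "r\<^sub>0 (\<phi> i) = 0" if "i < ?d" for i
    proof -
      have "\<phi> i \<noteq> \<phi> ?d" using that bij_betw_imp_inj_on[OF \<phi>] by (auto dest: inj_onD)
      then show ?thesis by (simp add: r\<^sub>0_def)
    qed
    ultimately show "r \<in> {r \<in> compositions n. \<forall>i\<in>{..<?d}. r (\<phi> i) < 1}" using r0 by auto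
  qed
  moreover obtain x where x: "x \<in> (grid n :: ('d \<Rightarrow> nat) set)" using Omega_ne by auto
  ultimately have "\<bar>r_function n \<alpha> r\<^sub>0 x\<bar> \<le> M" using tr by auto
  then show ?thesis using abs_r_function[OF \<alpha> r0 x] by simp
qed

lemma cube_eq_rect: "cube N x = rect (\<lambda>_. N) x"
  by (simp add: cube_def rect_def)

text \<open>A cell has positive measure, so a bound holding almost everywhere holds for the constant
  value of \<open>f\<close> on that cell.\<close>

lemma Linf_grid:
  fixes f :: "real ^ 'd::finite \<Rightarrow> real"
  assumes "Linf_norm_on (cbox 0 1) f \<le> ereal M" and x: "x \<in> grid n"
    and const: "\<And>y. y \<in> cube (Suc n) x \<Longrightarrow> f y = v"
  shows "\<bar>v\<bar> \<le> M"
proof (rule ccontr)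
  assume "\<not> ?thesis"
  have sub: "cube (Suc n) x \<subseteq> cbox 0 1"
  proof
    fix y assume y: "y \<in> cube (Suc n) x"
    have "0 \<le> y $ j \<and> y $ j \<le> 1" for j
    proof -
      have h: "real (x j) / 2 ^ Suc n \<le> y $ j" "y $ j < (real (x j) + 1) / 2 ^ Suc n"
        using y by (auto simp: cube_def)
      have "Suc (x j) \<le> 2 ^ Suc n" using x by (auto simp: grid_def Suc_le_eq simp del: power_Suc)
      then have "real (Suc (x j)) \<le> real (2 ^ Suc n)" by (rule of_nat_mono)
      then have "(real (x j) + 1) / 2 ^ Suc n \<le> 1" by (simp del: power_Suc)
      moreover have "0 \<le> real (x j) / 2 ^ Suc n" by simp
      ultimately show ?thesis using h by linarith
    qed
    then show "y \<in> cbox 0 1" by (simp add: mem_box_cart)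
  qed
  have "AE y in lebesgue_on (cbox 0 1). ereal \<bar>f y\<bar> \<le> esssup (lebesgue_on (cbox 0 1)) (\<lambda>x. ereal \<bar>f x\<bar>)"
    by (rule esssup_AE)
  then have "AE y in lebesgue_on (cbox 0 1). ereal \<bar>f y\<bar> \<le> ereal M"
  proof (rule eventually_mono)
    fix y assume "ereal \<bar>f y\<bar> \<le> esssup (lebesgue_on (cbox 0 1)) (\<lambda>x. ereal \<bar>f x\<bar>)"
    then show "ereal \<bar>f y\<bar> \<le> ereal M" using assms(1) unfolding Linf_norm_on_def by (rule order_trans)
  qed
  then have "AE y in lebesgue. y \<in> cbox 0 1 \<longrightarrow> \<bar>f y\<bar> \<le> M"
    by (subst (asm) AE_restrict_space_iff) auto
  then have "AE y in lebesgue. y \<notin> cube (Suc n) x"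
    by (rule eventually_mono) (use sub const \<open>\<not> \<bar>v\<bar> \<le> M\<close> in auto)
  then have "emeasure lebesgue (cube (Suc n) x) = 0"
    by (subst (asm) AE_iff_measurable[where N = "cube (Suc n) x"]) (use measure_rect(1) in \<open>auto simp: cube_eq_rect\<close>)
  then have "measure lebesgue (cube (Suc n) x) = 0" by (simp add: measure_def)
  then show False using measure_rect(2)[of "\<lambda>_. Suc n" x] by (simp add: cube_eq_rect)
qed

theorem theorem1p9:
  fixes \<eta> :: real
  assumes "CARD('d::finite) \<ge> 3"
    and "\<eta> < (real CARD('d) - 1) / 2 + 1 / (8 * real CARD('d))"
  shows "\<exists>c>0. \<forall>n\<ge>1. \<forall>\<alpha> :: (real ^ 'd) set \<Rightarrow> real.
    (\<forall>R \<in> dyadic_rectangles n. \<alpha> R \<in> {-1, 1}) \<longrightarrow>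
    ereal (c * real n powr \<eta>)
      \<le> Linf_norm_on (cbox 0 1) (\<lambda>x. \<Sum>R \<in> dyadic_rectangles n. \<alpha> R * haar R x)"
proof -
  define d where "d = CARD('d)"
  \<comment> \<open>The second entry would make \<gamma> equal to \<eta>; the first is a fixed
    admissible value that keeps \<kappa> positive when \<eta> is small.\<close>
  define \<kappa> where "\<kappa> = max (1 / (8 * real d)) (2 * \<eta> - (real d - 1))"
  define \<gamma> where "\<gamma> = \<kappa> / 2 + (real d - 1) / 2"
  have d3: "d \<ge> 3" using assms(1) by (simp add: d_def)
  have "2 * \<eta> - (real d - 1) < 1 / (4 * real d)"
    using assms(2) d3 by (simp add: d_def[symmetric] field_simps)
  moreover have "1 / (8 * real d) < 1 / (4 * real d)" using d3 by (simp add: field_simps)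
  ultimately have \<kappa>: "0 < \<kappa>" "\<kappa> < 1 / (4 * real d)" using d3 by (auto simp: \<kappa>_def less_max_iff_disj)
  have "2 * \<eta> - (real d - 1) \<le> \<kappa>" by (simp add: \<kappa>_def)
  moreover have "real d \<ge> 3" using d3 by simp
  ultimately have \<gamma>: "\<eta> \<le> \<gamma>" "\<gamma> > 0" using \<kappa>(1) by (auto simp: \<gamma>_def field_simps)
  obtain \<phi> :: "nat \<Rightarrow> 'd" where \<phi>: "bij_betw \<phi> {..<CARD('d)} UNIV"
    using ex_bij_betw_nat_finite[of "UNIV :: 'd set"] by (auto simp: lessThan_atLeast0)
  define A where "A = d * (10 * (d - 1) + 25)"
  have "d \<ge> 2" using d3 by simp
  from parameters_exist[OF this \<kappa>, of A] obtain x0 where x0: "\<And>x. x \<ge> x0 \<Longrightarrow>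
     (324 * x powr \<kappa> * (log 2 x)\<^sup>2) ^ (d - 2) * sqrt (324 * x powr \<kappa> * (log 2 x)\<^sup>2) * x ^ (d - 1) / sqrt (sqrt x)
        \<le> x ^ (d - 1) / 2
   \<and> 8 * x powr \<kappa> * (2 * (4 * x powr \<kappa> * x) ^ (d - 2)) \<le> x ^ (d - 1)
   \<and> x ^ A + 1 \<le> exp (x powr \<kappa> / 2)"
    unfolding eventually_at_top_linorder by blast
  obtain L1 where "x0 < 2 ^ L1" using real_arch_pow[of 2 x0] by auto
  \<comment> \<open>The successor guarantees \<open>L \<ge> 1\<close> for every
    \<open>L \<ge> L0\<close>, as \<open>grid_bound\<close> requires.\<close>
  define L0 where "L0 = Suc L1"
  have L0: "x0 \<le> 2 ^ L0" using \<open>x0 < 2 ^ L1\<close> by (simp add: L0_def)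
       (smt (verit) one_le_power zero_le_power)
  define n0 where "n0 = d * 2 ^ L0"
  define c1 where "c1 = 1 / (2 * sqrt 8 * (2 * real d) powr \<gamma>)"
  \<comment> \<open>The second entry serves \<open>n < n0\<close>, where the norm is at least 1; the
    absolute value covers negative \<eta>.\<close>
  define c where "c = min c1 (1 / real n0 powr \<bar>\<eta>\<bar>)"
  have n0: "n0 > 0" using d3 by (simp add: n0_def)
  have c: "c > 0" using d3 n0 by (simp add: c_def c1_def)
  show ?thesis
  proof (intro exI[of _ c] conjI allI impI)
    show "c > 0" by (rule c)
    fix n :: nat and \<alpha> :: "(real ^ 'd) set \<Rightarrow> real"
    assume n: "n \<ge> 1" and \<alpha>: "\<forall>R\<in>dyadic_rectangles n. \<alpha> R \<in> {-1, 1}"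
    let ?f = "\<lambda>x. \<Sum>R\<in>dyadic_rectangles n. \<alpha> R * haar R x"
    show "ereal (c * real n powr \<eta>) \<le> Linf_norm_on (cbox 0 1) ?f"
    proof (rule ccontr)
      assume "\<not> ?thesis"
      then have "Linf_norm_on (cbox 0 1) ?f < ereal (c * real n powr \<eta>)" by simp
      \<comment> \<open>A real number strictly in between: \<open>Linf_grid\<close> needs a real
        bound, and strictness makes \<open>c * real n powr \<eta> \<le> M\<close>
        contradictory.\<close>
      then obtain M where M: "Linf_norm_on (cbox 0 1) ?f < ereal M" "ereal M < ereal (c * real n powr \<eta>)"
        using ereal_dense2 by blast
      have grid: "\<bar>\<Sum>r\<in>compositions n. r_function n \<alpha> r x\<bar> \<le> M" if x: "x \<in> grid n" for x
        by (rule Linf_grid[OF less_imp_le[OF M(1)] x])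
           (use x in \<open>auto intro: sum_haar_cell simp: grid_def simp del: power_Suc\<close>)
      show False
      proof (cases "n < n0")
        case True
        have "1 \<le> M" by (rule grid_bound_one[OF \<phi> \<alpha> grid])
        moreover have "real n powr \<eta> \<le> real n0 powr \<bar>\<eta>\<bar>"
        proof -
          have "real n powr \<eta> \<le> real n powr \<bar>\<eta>\<bar>" using n by (intro powr_mono) auto
          also have "\<dots> \<le> real n0 powr \<bar>\<eta>\<bar>" using True by (intro powr_mono2) auto
          finally show ?thesis .
        qed
        then have "c * real n powr \<eta> \<le> 1 / real n0 powr \<bar>\<eta>\<bar> * real n0 powr \<bar>\<eta>\<bar>"
          using c by (intro mult_mono) (auto simp: c_def)
        ultimately show False using M(2) n0 by simp
      next
        case False
        have N1: "n div d \<ge> 2 ^ L0" using False d3 by (simp add: n0_def less_eq_div_iff_mult_less_eq mult.commute)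
        then have "n div d \<ge> 1" by (metis one_le_numeral one_le_power order_trans)
        \<comment> \<open>Rounding \<open>n / d\<close> down to a power of two keeps
          \<open>(d - 1) * 2 ^ L \<le> n\<close>, while \<open>n < 2 * d * 2 ^ L\<close> accounts
          for the factor \<open>(2 * real d) powr \<gamma>\<close> in \<open>c1\<close>.\<close>
        then obtain L where L: "2 ^ L \<le> n div d" "n div d < 2 ^ (L + 1)"
          using ex_power_ivl1[of 2 "n div d"] by auto
        have "(2::nat) ^ L0 < 2 ^ (L + 1)" using N1 L(2) by linarith
        then have L0L: "L0 \<le> L" by (simp add: power_strict_increasing_iff del: power_Suc)
        define x where "x = (2::real) ^ L"
        have xx0: "x \<ge> x0" 
          unfolding x_def using L0L by (intro order_trans[OF L0] power_increasing) auto
        have x1: "x \<ge> 1" by (simp add: x_def)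
        have lg: "log 2 x = real L" by (simp add: x_def log_nat_power)
        have p: "x powr \<kappa> \<ge> 1" using x1 \<kappa> by (simp add: ge_one_powr_ge_zero)
        have mn: "(CARD('d) - 1) * 2 ^ L \<le> n"
        proof -
          have "(CARD('d) - 1) * 2 ^ L \<le> d * (n div d)" using L(1) by (intro mult_mono) (auto simp: d_def)
          then show ?thesis using times_div_less_eq_dividend[of d n] by linarith
        qed
        have "sqrt (x powr \<kappa>) * sqrt ((2 ^ L) ^ (CARD('d) - 1)) / (2 * sqrt 8) \<le> M"
          by (rule grid_bound[OF \<phi> _ \<alpha> grid _ p mn])
             (use x0[OF xx0] d3 L0L in \<open>auto simp: d_def[symmetric] lg A_def L0_def simp flip: x_def\<close>)
        moreover have "sqrt (x powr \<kappa>) * sqrt ((2 ^ L) ^ (CARD('d) - 1)) = x powr \<gamma>"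
        proof -
          have "real (d - 1) = real d - 1" using d3 by simp
          then have "x ^ (d - 1) = x powr (real d - 1)" using x1 by (simp add: powr_realpow[symmetric])
          then show ?thesis using x1
            by (simp add: \<gamma>_def d_def[symmetric] x_def[symmetric] powr_half_sqrt[symmetric] powr_powr powr_add)
        qed
        ultimately have M2: "x powr \<gamma> / (2 * sqrt 8) \<le> M" by simp
        have "n < d * 2 ^ (L + 1)" using L(2) d3 by (simp add: div_less_iff_less_mult mult.commute)
        then have "real n < real (d * 2 ^ (L + 1))" by (rule less_imp_of_nat_less)
        then have "real n \<le> 2 * real d * x" by (simp add: x_def)
        then have "real n powr \<eta> \<le> (2 * real d * x) powr \<gamma>"
          using n \<gamma> by (intro order_trans[OF powr_mono[OF \<gamma>(1)] powr_mono2]) auto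
        also have "\<dots> = (2 * real d) powr \<gamma> * x powr \<gamma>" using x1 by (simp add: powr_mult)
        finally have "c1 * real n powr \<eta> \<le> c1 * ((2 * real d) powr \<gamma> * x powr \<gamma>)"
          using d3 by (intro mult_left_mono) (auto simp: c1_def)
        also have "\<dots> = x powr \<gamma> / (2 * sqrt 8)" using d3 by (simp add: c1_def)
        finally have "c1 * real n powr \<eta> \<le> M" using M2 by linarith
        moreover have "c * real n powr \<eta> \<le> c1 * real n powr \<eta>"
          by (intro mult_right_mono) (auto simp: c_def)
        ultimately show False using M(2) by simp
      qed
    qed
  qed
qed

end
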